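(* $\mathbf{PL}$ is the logic of the class of all convex polyhedra: $\mathbf{PL}=\mathrm{Logic}(\mathsf{Convex})$.
   Context: Kripke frames are posets; a subset $U$ of a poset $F$ is an upset if $x\in U$, $x\le y$ imply $y\in U$, and $\mathrm{Up}(F)$ is the Heyting algebra of upsets. A p-morphism $f\colon F\to G$ is a map with $f(\uparrow x)=\uparrow f(x)$ for all $x$; an up-reduction of $F$ onto $G$ is a surjective p-morphism from an upset of $F$ onto $G$. For a finite rooted poset $Q$, $\chi(Q)$ denotes its Jankov–Fine (Jankov–de Jongh) formula, which has the property that a frame $F$ validates $\chi(Q)$ iff there is no up-reduction of $F$ onto $Q$. $\mathbf{IPC}$ is intuitionistic propositional logic. The 3-fork is the poset $\{r,a,b,c\}$ with $r<a$, $r<b$, $r<c$ and no other strict relations. The Scott frame is the poset $\{r,u_1,u_2,v\}$ with $r<u_1<u_2$, $r<v$ (and $r<u_2$) and no other strict relations. $\mathbf{PL}$ is the smallest intermediate logic containing $\chi(\text{3-fork})$ and $\chi(\text{Scott frame})$. A polyhedron is a finite union of convex hulls of finite subsets of some $\mathbb R^d$ (so it is compact); it is convex if it is a convex set. A subpolyhedron of $P$ is a polyhedron contained in $P$; an open subpolyhedron of $P$ is a set $P\setminus Q$ with $Q$ a subpolyhedron of $P$. The set $\mathrm{Sub}_o P$ of open subpolyhedra of $P$ is a Heyting subalgebra of the Heyting algebra of open subsets of $P$. An intuitionistic formula $\varphi$ is valid on $P$ if it is valid on the Heyting algebra $\mathrm{Sub}_o P$; for a class $\mathbf C$ of polyhedra,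 $\mathrm{Logic}(\mathbf C)$ is the set of formulas valid on every member. $\mathsf{Convex}$ is the class of all convex polyhedra. *)

theory Defs
  imports Complex_Main
begin

datatype fm = Var nat | Bot | Conj fm fm | Disj fm fm | Imp fm fm

definition Top :: fm where "Top = Imp Bot Bot"
definition Iff :: "fm \<Rightarrow> fm \<Rightarrow> fm" where "Iff a b = Conj (Imp a b) (Imp b a)"
definition Conjs :: "fm list \<Rightarrow> fm" where "Conjs xs = foldr Conj xs Top"

primrec subst :: "(nat \<Rightarrow> fm) \<Rightarrow> fm \<Rightarrow> fm" where
  "subst s (Var n) = s n"
| "subst s Bot = Bot"
| "subst s (Conj a b) = Conj (subst s a) (subst s b)"
| "subst s (Disj a b) = Disj (subst s a) (subst s b)"
| "subst s (Imp a b) = Imp (subst s a) (subst s b)"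

definition upsets :: "nat set \<Rightarrow> (nat \<Rightarrow> nat \<Rightarrow> bool) \<Rightarrow> nat set set" where
  "upsets W le = {U. U \<subseteq> W \<and> (\<forall>x\<in>U. \<forall>y\<in>W. le x y \<longrightarrow> y \<in> U)}"

definition up_imp :: "nat set \<Rightarrow> (nat \<Rightarrow> nat \<Rightarrow> bool) \<Rightarrow> nat set \<Rightarrow> nat set \<Rightarrow> nat set" where
  "up_imp W le U V = {x\<in>W. \<forall>y\<in>W. le x y \<and> y \<in> U \<longrightarrow> y \<in> V}"

definition set_code :: "nat set \<Rightarrow> nat" where "set_code U = (\<Sum>i\<in>U. 2 ^ i)"
definition code_set :: "nat \<Rightarrow> nat set" where "code_set k = {i. odd (k div 2 ^ i)}"

definition poset_root :: "nat set \<Rightarrow> (nat \<Rightarrow> nat \<Rightarrow> bool) \<Rightarrow> nat" where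
  "poset_root W le = (THE r. r \<in> W \<and> (\<forall>x\<in>W. le r x))"

text \<open>Jankov's characteristic formula of the finite subdirectly irreducible Heyting
  algebra Up(Q), for a finite rooted poset Q = (W, le): the variable p_U (named
  set_code U) stands for the upset U; the formula is (diagram of Up(Q)) \<longrightarrow> p_s,
  where s = W - {root} is the second largest element (opremum).\<close>
definition jankov :: "nat set \<Rightarrow> (nat \<Rightarrow> nat \<Rightarrow> bool) \<Rightarrow> fm" where
  "jankov W le =
    (let L = sorted_list_of_set (set_code ` upsets W le);
         p = (\<lambda>U. Var (set_code U));
         cl = (\<lambda>a b. let A = code_set a; B = code_set b in
                 [Iff (p (A \<inter> B)) (Conj (Var a) (Var b)),
                  Iff (p (A \<union> B)) (Disj (Var a) (Var b)),
                  Iff (p (up_imp W le A B)) (Imp (Var a) (Var b))]);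
         \<delta> = Conjs (Iff (p {}) Bot # concat (map (\<lambda>a. concat (map (cl a) L)) L))
     in Imp \<delta> (p (W - {poset_root W le})))"

definition fork3_le :: "nat \<Rightarrow> nat \<Rightarrow> bool" where
  "fork3_le x y \<longleftrightarrow> x = y \<or> x = 0"      \<comment> \<open>r = 0; a, b, c = 1, 2, 3\<close>

definition scott_le :: "nat \<Rightarrow> nat \<Rightarrow> bool" where
  "scott_le x y \<longleftrightarrow> x = y \<or> x = 0 \<or> (x = 1 \<and> y = 2)"  \<comment> \<open>r = 0; u1 = 1; u2 = 2; v = 3\<close>

definition chi_fork3 :: fm where "chi_fork3 = jankov {0,1,2,3} fork3_le"
definition chi_scott :: fm where "chi_scott = jankov {0,1,2,3} scott_le"

text \<open>Smallest intermediate logic containing the two formulas: closure of the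
  (Hilbert-style) axioms of IPC and all substitution instances of the two formulas
  under modus ponens.\<close>
inductive_set PL :: "fm set" where
  ax1: "Imp a (Imp b a) \<in> PL"
| ax2: "Imp (Imp a (Imp b c)) (Imp (Imp a b) (Imp a c)) \<in> PL"
| ax3: "Imp (Conj a b) a \<in> PL"
| ax4: "Imp (Conj a b) b \<in> PL"
| ax5: "Imp a (Imp b (Conj a b)) \<in> PL"
| ax6: "Imp a (Disj a b) \<in> PL"
| ax7: "Imp b (Disj a b) \<in> PL"
| ax8: "Imp (Imp a c) (Imp (Imp b c) (Imp (Disj a b) c)) \<in> PL"
| ax9: "Imp Bot a \<in> PL"
| fork3: "subst s chi_fork3 \<in> PL"
| scott: "subst s chi_scott \<in> PL"
| mp: "a \<in> PL \<Longrightarrow> Imp a b \<in> PL \<Longrightarrow> b \<in> PL"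

definition Rd :: "nat \<Rightarrow> (nat \<Rightarrow> real) set" where
  "Rd d = {x. \<forall>i\<ge>d. x i = 0}"

definition conv_hull :: "(nat \<Rightarrow> real) set \<Rightarrow> (nat \<Rightarrow> real) set" where
  "conv_hull S = {x. \<exists>u. (\<forall>s\<in>S. 0 \<le> u s) \<and> (\<Sum>s\<in>S. u s) = 1 \<and> x = (\<lambda>i. \<Sum>s\<in>S. u s * s i)}"

definition polyhedron :: "(nat \<Rightarrow> real) set \<Rightarrow> bool" where
  "polyhedron P \<longleftrightarrow> (\<exists>d F. finite F \<and> (\<forall>S\<in>F. finite S \<and> S \<subseteq> Rd d) \<and> P = \<Union> (conv_hull ` F))"

definition convex_set :: "(nat \<Rightarrow> real) set \<Rightarrow> bool" where
  "convex_set C \<longleftrightarrow> (\<forall>x\<in>C. \<forall>y\<in>C. \<forall>t::real. 0 \<le> t \<and> t \<le> 1 \<longrightarrow> (\<lambda>i. (1 - t) * x i + t * y i) \<in> C)"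

definition Sub_o :: "(nat \<Rightarrow> real) set \<Rightarrow> (nat \<Rightarrow> real) set set" where
  "Sub_o P = {P - Q | Q. polyhedron Q \<and> Q \<subseteq> P}"

text \<open>Interpretation in the Heyting algebra Sub_o P (lattice operations are union and
  intersection; implication is the greatest element U of Sub_o P with U \<inter> a \<subseteq> b).\<close>
primrec eval :: "(nat \<Rightarrow> real) set \<Rightarrow> (nat \<Rightarrow> (nat \<Rightarrow> real) set) \<Rightarrow> fm \<Rightarrow> (nat \<Rightarrow> real) set" where
  "eval P v (Var n) = v n"
| "eval P v Bot = {}"
| "eval P v (Conj a b) = eval P v a \<inter> eval P v b"
| "eval P v (Disj a b) = eval P v a \<union> eval P v b"
| "eval P v (Imp a b) = \<Union> {U \<in> Sub_o P. U \<inter> eval P v a \<subseteq> eval P v b}"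

definition valid_on :: "(nat \<Rightarrow> real) set \<Rightarrow> fm \<Rightarrow> bool" where
  "valid_on P \<phi> \<longleftrightarrow> (\<forall>v. (\<forall>n. v n \<in> Sub_o P) \<longrightarrow> eval P v \<phi> = P)"

definition Logic :: "(nat \<Rightarrow> real) set set \<Rightarrow> fm set" where
  "Logic C = {\<phi>. \<forall>P\<in>C. valid_on P \<phi>}"

definition Convex :: "(nat \<Rightarrow> real) set set" where
  "Convex = {P. polyhedron P \<and> convex_set P}"

end

theory Submission
  imports Defs "HOL-Library.Nat_Bijection"
begin

text \<open>Let P be a convex polyhedron. Finitely many affine forms H induce on P the preorder "every form
  of H that is nonzero at x keeps its sign at y". Open subpolyhedra of P are exactly the upsets of such
  preorders (Fourier--Motzkin elimination in one direction, cutting polytopes by half-spaces in the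
  other), and by convexity evaluation in P is Kripke forcing in any H that defines the valuation.

  Soundness: a refutation of one of the two Jankov formulas yields a p-morphism from an upset of P onto
  the 3-fork or the Scott frame. A generic segment between the preimages of the two components above the
  root crosses one hyperplane at a time, so at most three cells lie above each of its points. None of its
  points is therefore mapped to the root, contradicting connectedness.

  Completeness: by the two axioms the maximal types above a prime theory are connected through
  larger theories and through two-pronged forks. Walking along these connections, a theory is unravelled
  into a finite planar tree, with neighbouring leaves separated by regions labelled with maximal types.
  Such a tree is the cell structure around a vertex of a simplex cut by hyperplanes.\<close>

section \<open>Affine forms and convex hulls\<close>

text \<open>The obstacle in the completeness half is that theories live in an infinite canonical
  frame, while a polyhedron can carry only finitely many labels. Labels are therefore just the
  traces of prime theories on the finite set \<open>S\<close> of subformulas: a label need not see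
  everything its theory sees, it only has to find above it a refutation of each implication of
  \<open>S\<close> that it misses. Subtrees are either single walls or belong to theories with a
  strictly larger trace, so the number of subformulas outside the theory bounds the depth and hence
  the dimension of the simplex.

  A wall has codimension one and borders two regions, which is why forks with exactly two prongs are
  what the axioms have to deliver. One transverse coordinate suffices, because the walls are
  linearly ordered and the detours needed for refutations can be inserted into that line.

  In the soundness half the Kripke frame is the infinite set \<open>P\<close> itself rather than a
  face poset. No triangulation enters, and a p-morphism can be followed along a segment.\<close>

definition mix :: "real \<Rightarrow> (nat \<Rightarrow> real) \<Rightarrow> (nat \<Rightarrow> real) \<Rightarrow> nat \<Rightarrow> real" where
  "mix t x y = (\<lambda>i. (1 - t) * x i + t * y i)"

inductive_set aff :: "((nat \<Rightarrow> real) \<Rightarrow> real) set" where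
  const: "(\<lambda>x. c) \<in> aff"
| coord: "(\<lambda>x. x i) \<in> aff"
| add: "f \<in> aff \<Longrightarrow> g \<in> aff \<Longrightarrow> (\<lambda>x. f x + g x) \<in> aff"
| scale: "f \<in> aff \<Longrightarrow> (\<lambda>x. c * f x) \<in> aff"

lemma aff_uminus: "f \<in> aff \<Longrightarrow> (\<lambda>x. - f x) \<in> aff"
  using aff.scale[of f "-1"] by simp

lemma aff_diff: "f \<in> aff \<Longrightarrow> g \<in> aff \<Longrightarrow> (\<lambda>x. f x - g x) \<in> aff"
  using aff.add[OF _ aff_uminus, of f g] by simp

lemma aff_sum: "finite I \<Longrightarrow> (\<And>i. i \<in> I \<Longrightarrow> f i \<in> aff) \<Longrightarrow> (\<lambda>x. \<Sum>i\<in>I. f i x) \<in> aff"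
  by (induction I rule: finite_induct) (auto intro: aff.intros)

lemma aff_mix: "f \<in> aff \<Longrightarrow> f (mix t x y) = (1 - t) * f x + t * f y"
proof (induction rule: aff.induct)
  case (scale f c)
  then show ?case by (simp add: distrib_left mult.left_commute)
qed (simp_all add: mix_def algebra_simps)

lemma mix_0 [simp]: "mix 0 x y = x" and mix_1 [simp]: "mix 1 x y = y"
  by (simp_all add: mix_def)

lemma aff_barycentre:
  assumes "f \<in> aff" "sum w I = 1"
  shows "f (\<lambda>i. \<Sum>k\<in>I. w k * p k i) = (\<Sum>k\<in>I. w k * f (p k))"
  using assms(1)
proof (induction rule: aff.induct)
  case (const c)
  then show ?case using assms(2) by (simp flip: sum_distrib_right)
next
  case (scale f c)
  then show ?case by (simp add: sum_distrib_left algebra_simps)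
qed (simp_all add: algebra_simps sum.distrib)

lemma convex_mix: "convex_set C \<Longrightarrow> x \<in> C \<Longrightarrow> y \<in> C \<Longrightarrow> 0 \<le> t \<Longrightarrow> t \<le> 1 \<Longrightarrow> mix t x y \<in> C"
  unfolding convex_set_def mix_def by blast

lemma convex_barycentre:
  assumes C: "convex_set C"
  shows "finite I \<Longrightarrow> (\<And>k. k \<in> I \<Longrightarrow> p k \<in> C) \<Longrightarrow> (\<And>k. k \<in> I \<Longrightarrow> 0 \<le> w k) \<Longrightarrow> sum w I = 1
    \<Longrightarrow> (\<lambda>i. \<Sum>k\<in>I. w k * p k i) \<in> C"
proof (induction I arbitrary: w rule: finite_induct)
  case (insert k I)
  have w1: "w k + sum w I = 1" and nn: "0 \<le> sum w I"
    using insert.hyps insert.prems by (auto intro: sum_nonneg)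
  show ?case
  proof (cases "sum w I = 0")
    case True
    then have "\<forall>j\<in>I. w j = 0"
      using insert.hyps insert.prems by (subst (asm) sum_nonneg_eq_0_iff) auto
    then have "(\<lambda>i. \<Sum>k\<in>insert k I. w k * p k i) = p k"
      using w1 True insert.hyps by simp
    then show ?thesis using insert.prems by simp
  next
    case False
    define r where "r = sum w I"
    have r: "0 < r" using False nn by (simp add: r_def)
    have "(\<lambda>i. \<Sum>j\<in>I. (w j / r) * p j i) \<in> C"
      using r insert.prems by (intro insert.IH) (auto simp flip: sum_divide_distrib simp: r_def)
    then have "mix r (p k) (\<lambda>i. \<Sum>j\<in>I. (w j / r) * p j i) \<in> C"
      using w1 insert.prems(1) insert.prems(2)[of k] r by (intro convex_mix[OF C]) (auto simp flip: r_def)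
    moreover have "mix r (p k) (\<lambda>i. \<Sum>j\<in>I. (w j / r) * p j i) = (\<lambda>i. \<Sum>k\<in>insert k I. w k * p k i)"
    proof
      fix i
      have "r * (\<Sum>j\<in>I. (w j / r) * p j i) = (\<Sum>j\<in>I. w j * p j i)"
        using r by (simp add: sum_distrib_left)
      moreover have "1 - r = w k" using w1 by (simp add: r_def)
      ultimately show "mix r (p k) (\<lambda>i. \<Sum>j\<in>I. (w j / r) * p j i) i = (\<Sum>k\<in>insert k I. w k * p k i)"
        using insert.hyps by (simp add: mix_def)
    qed
    ultimately show ?thesis by simp
  qed
qed simp

lemma convex_conv_hull: "convex_set (conv_hull S)"
  unfolding convex_set_def
proof (intro ballI allI impI)
  fix x y and t :: real
  assume "x \<in> conv_hull S" "y \<in> conv_hull S" and t: "0 \<le> t \<and> t \<le> 1"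
  then obtain u v where u: "\<forall>s\<in>S. 0 \<le> u s" "sum u S = 1" "x = (\<lambda>i. \<Sum>s\<in>S. u s * s i)"
    and v: "\<forall>s\<in>S. 0 \<le> v s" "sum v S = 1" "y = (\<lambda>i. \<Sum>s\<in>S. v s * s i)"
    unfolding conv_hull_def by blast
  define w where "w s = (1 - t) * u s + t * v s" for s
  have "\<forall>s\<in>S. 0 \<le> w s" using u v t by (simp add: w_def)
  moreover have "sum w S = 1" using u v by (simp add: w_def sum.distrib flip: sum_distrib_left)
  moreover have "(\<lambda>i. (1 - t) * x i + t * y i) = (\<lambda>i. \<Sum>s\<in>S. w s * s i)"
    unfolding u(3) v(3) w_def
    by (simp only: distrib_right mult.assoc sum.distrib sum_distrib_left)
  ultimately show "(\<lambda>i. (1 - t) * x i + t * y i) \<in> conv_hull S"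
    unfolding conv_hull_def by blast
qed

lemma conv_hull_base:
  assumes "finite S" "s \<in> S" shows "s \<in> conv_hull S"
proof -
  have "s = (\<lambda>i. \<Sum>x\<in>S. (if x = s then 1 else 0) * x i)"
    using assms by (simp add: if_distrib[of "\<lambda>u. u * _"] sum.delta cong: if_cong)
  then show ?thesis using assms unfolding conv_hull_def
    by (intro CollectI exI[of _ "\<lambda>x. if x = s then 1 else 0"]) (simp add: sum.delta)
qed

lemma conv_hull_least:
  assumes "finite S" "convex_set C" "S \<subseteq> C" shows "conv_hull S \<subseteq> C"
  using convex_barycentre[OF assms(2) assms(1), of "\<lambda>s. s"] assms(3)
  unfolding conv_hull_def by auto

lemma conv_hull_subset_Rd: "S \<subseteq> Rd d \<Longrightarrow> conv_hull S \<subseteq> Rd d"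
  unfolding conv_hull_def Rd_def by (auto intro!: sum.neutral)

lemma Rd_mono: "d \<le> e \<Longrightarrow> Rd d \<subseteq> Rd e"
  by (auto simp: Rd_def)

lemma convex_Rd: "convex_set (Rd d)"
  by (auto simp: convex_set_def Rd_def)

lemma convex_halfspace: "f \<in> aff \<Longrightarrow> convex_set {x. 0 \<le> f x}"
  unfolding convex_set_def using aff_mix[of f] unfolding mix_def by auto

lemma convex_Int: "convex_set C \<Longrightarrow> convex_set D \<Longrightarrow> convex_set (C \<inter> D)"
  unfolding convex_set_def by blast

text \<open>The new vertices are the points where the segments between vertices on
  different sides cross the hyperplane.\<close>

lemma conv_hull_cut:
  assumes S: "finite S" "S \<subseteq> Rd d" and f: "f \<in> aff"
  shows "\<exists>T. finite T \<and> T \<subseteq> Rd d \<and> conv_hull S \<inter> {x. 0 \<le> f x} = conv_hull T"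
proof -
  define A where "A = {s\<in>S. 0 \<le> f s}"
  define B where "B = {s\<in>S. f s < 0}"
  define c where "c = (\<lambda>(s, t). mix (f s / (f s - f t)) s t)"
  define T where "T = A \<union> c ` (A \<times> B)"
  have fin: "finite A" "finite B" "finite T" using S by (auto simp: A_def B_def T_def)
  have AB: "S = A \<union> B" "A \<inter> B = {}" by (auto simp: A_def B_def)
  have conv: "convex_set (conv_hull S \<inter> Rd d \<inter> {x. 0 \<le> f x})"
    by (intro convex_Int convex_conv_hull convex_Rd convex_halfspace f)
  have cpt: "c (s, t) \<in> conv_hull S \<inter> Rd d \<inter> {x. 0 \<le> f x}" if "s \<in> A" "t \<in> B" for s t
  proof -
    have st: "0 \<le> f s" "f t < 0" using that by (auto simp: A_def B_def)
    have "s \<in> conv_hull S \<inter> Rd d" "t \<in> conv_hull S \<inter> Rd d"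
      using that S AB conv_hull_base by auto
    moreover have "0 \<le> f s / (f s - f t)" "f s / (f s - f t) \<le> 1" using st by auto
    ultimately have "c (s, t) \<in> conv_hull S \<inter> Rd d"
      unfolding c_def using convex_mix[OF convex_Int[OF convex_conv_hull convex_Rd]] by auto
    moreover have "f (c (s, t)) = 0"
      using st by (simp add: c_def aff_mix[OF f] field_simps)
    ultimately show ?thesis by simp
  qed
  have T_sub: "T \<subseteq> conv_hull S \<inter> Rd d \<inter> {x. 0 \<le> f x}"
  proof -
    have "A \<subseteq> conv_hull S \<inter> Rd d \<inter> {x. 0 \<le> f x}"
      using S conv_hull_base by (auto simp: A_def)
    moreover have "c ` (A \<times> B) \<subseteq> conv_hull S \<inter> Rd d \<inter> {x. 0 \<le> f x}" using cpt by blast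
    ultimately show ?thesis by (simp add: T_def)
  qed
  have "conv_hull T \<subseteq> conv_hull S \<inter> {x. 0 \<le> f x}"
    using conv_hull_least[OF fin(3) conv T_sub] by auto
  moreover have "conv_hull S \<inter> {x. 0 \<le> f x} \<subseteq> conv_hull T"
  proof
    fix x assume "x \<in> conv_hull S \<inter> {x. 0 \<le> f x}"
    then obtain u where u: "\<forall>s\<in>S. 0 \<le> u s" "sum u S = 1" "x = (\<lambda>i. \<Sum>s\<in>S. u s * s i)" and fx: "0 \<le> f x"
      unfolding conv_hull_def by blast
    define a where "a = (\<Sum>s\<in>A. u s * f s)"
    define b where "b = (\<Sum>t\<in>B. u t * (- f t))"
    have "f x = (\<Sum>s\<in>S. u s * f s)" using u(2) by (simp add: u(3) aff_barycentre[OF f])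
    also have "\<dots> = a - b" unfolding AB(1) a_def b_def
      using fin AB(2) by (subst sum.union_disjoint) (auto simp: sum_negf)
    finally have ba: "b \<le> a" using fx by simp
    have uA: "\<And>s. s \<in> A \<Longrightarrow> 0 \<le> u s" and uB: "\<And>s. s \<in> B \<Longrightarrow> 0 \<le> u s" using u AB by auto
    have a0: "0 \<le> a" using uA by (auto simp: a_def A_def intro!: sum_nonneg)
    have b0: "0 \<le> b" unfolding b_def using uB
      by (intro sum_nonneg mult_nonneg_nonneg) (auto simp: B_def)
    \<comment> \<open>If \<open>a = 0\<close>, division by zero turns \<open>b / a\<close> and all
      mixed weights into 0; the decomposition survives because then no vertex of \<open>B\<close>
      carries weight.\<close>
    have zero: "\<forall>t\<in>B. u t = 0" if "a = 0"
    proof -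
      have "b = 0" using that ba b0 by simp
      then have "\<forall>t\<in>B. u t * (- f t) = 0" unfolding b_def
        using fin uB by (subst (asm) sum_nonneg_eq_0_iff) (auto simp: B_def mult_nonneg_nonpos)
      then show ?thesis by (auto simp: B_def)
    qed
    \<comment> \<open>The weight \<open>u t\<close> of a vertex \<open>t\<close> in \<open>B\<close>
      is shared among the \<open>s\<close> in \<open>A\<close> in the proportions
      \<open>u s * f s / a\<close>. Each share is merged with the amount of \<open>s\<close> that
      cancels it under \<open>f\<close>, which gives the crossing point \<open>c (s, t)\<close>; the
      fraction \<open>1 - b / a\<close> of each \<open>s\<close> is left over.\<close>
    define I where "I = A <+> (A \<times> B)"
    define w where "w = case_sum (\<lambda>s. u s * (1 - b / a)) (\<lambda>(s, t). u s * u t * (f s - f t) / a)"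
    define p where "p = case_sum (\<lambda>s. s) c"
    have finI: "finite I" using fin by (simp add: I_def)
    have wsum: "(\<Sum>k\<in>I. w k * h k) = (\<Sum>s\<in>A. u s * (1 - b / a) * h (Inl s))
        + (\<Sum>s\<in>A. \<Sum>t\<in>B. u s * u t * (f s - f t) / a * h (Inr (s, t)))" for h :: "_ \<Rightarrow> real"
      unfolding I_def w_def using fin
      by (subst sum.Plus) (auto simp: sum.cartesian_product intro!: sum.cong)
    \<comment> \<open>Here \<open>g'\<close> gives the value of \<open>g\<close> at the crossing
      points. The instances are the constant 1, for the total weight, and each coordinate, for the
      point \<open>x\<close>.\<close>
    have key: "(\<Sum>s\<in>A. u s * (1 - b / a) * g s)
        + (\<Sum>s\<in>A. \<Sum>t\<in>B. u s * u t * (f s - f t) / a * g' s t) = (\<Sum>s\<in>S. u s * g s)"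
      if g': "\<And>s t. s \<in> A \<Longrightarrow> t \<in> B \<Longrightarrow> (f s - f t) * g' s t = f s * g t - f t * g s"
      for g :: "_ \<Rightarrow> real" and g'
    proof -
      have "u s * u t * (f s - f t) / a * g' s t
          = (u s * f s) * (u t * g t) / a + (u s * g s) * (u t * (- f t)) / a"
        if "s \<in> A" "t \<in> B" for s t
      proof -
        have "u s * u t * (f s - f t) / a * g' s t = u s * u t / a * ((f s - f t) * g' s t)" by simp
        also have "\<dots> = u s * u t / a * (f s * g t - f t * g s)" by (simp only: g'[OF that])
        also have "\<dots> = (u s * f s) * (u t * g t) / a + (u s * g s) * (u t * (- f t)) / a"
          by (simp add: algebra_simps add_divide_distrib diff_divide_distrib)
        finally show ?thesis .
      qed
      then have "(\<Sum>s\<in>A. \<Sum>t\<in>B. u s * u t * (f s - f t) / a * g' s t)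
          = (\<Sum>s\<in>A. \<Sum>t\<in>B. (u s * f s) * (u t * g t) / a + (u s * g s) * (u t * (- f t)) / a)"
        by (intro sum.cong refl) simp
      also have "\<dots> = (a / a) * (\<Sum>t\<in>B. u t * g t) + (b / a) * (\<Sum>s\<in>A. u s * g s)"
        unfolding a_def b_def
        by (simp only: sum.distrib sum_product sum_divide_distrib times_divide_eq_left
            mult.commute[of "u _ * g _" "u _ * (- f _)"] add_left_cancel) (rule sum.swap)
      also have "(a / a) * (\<Sum>t\<in>B. u t * g t) = (\<Sum>t\<in>B. u t * g t)"
        using zero by (cases "a = 0") auto
      finally have "(\<Sum>s\<in>A. \<Sum>t\<in>B. u s * u t * (f s - f t) / a * g' s t)
          = (\<Sum>t\<in>B. u t * g t) + (b / a) * (\<Sum>s\<in>A. u s * g s)" .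
      moreover have "(\<Sum>s\<in>A. u s * (1 - b / a) * g s) = (1 - b / a) * (\<Sum>s\<in>A. u s * g s)"
        by (simp add: sum_distrib_left mult_ac)
      moreover have "(\<Sum>s\<in>S. u s * g s) = (\<Sum>s\<in>A. u s * g s) + (\<Sum>t\<in>B. u t * g t)"
        unfolding AB(1) using fin AB(2) by (subst sum.union_disjoint) auto
      ultimately show ?thesis by (simp add: algebra_simps)
    qed
    have w0: "0 \<le> w k" if "k \<in> I" for k
    proof -
      have "b / a \<le> 1" using ba a0 by (cases "a = 0") (auto simp: divide_le_eq)
      then show ?thesis using that uA uB a0
        by (auto simp: I_def w_def A_def B_def intro!: mult_nonneg_nonneg divide_nonneg_nonneg)
    qed
    have w1: "sum w I = 1"
      using wsum[of "\<lambda>_. 1"] key[of "\<lambda>_ _. 1" "\<lambda>_. 1"] u(2) by simp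
    have pT: "p k \<in> conv_hull T" if "k \<in> I" for k
      using that conv_hull_base[OF fin(3)] by (auto simp: I_def p_def T_def)
    have "(\<lambda>i. \<Sum>k\<in>I. w k * p k i) \<in> conv_hull T"
      by (rule convex_barycentre[OF convex_conv_hull finI]) (use pT w0 w1 in auto)
    moreover have "(\<Sum>k\<in>I. w k * p k i) = x i" for i
    proof -
      have "(f s - f t) * c (s, t) i = f s * t i - f t * s i" if "s \<in> A" "t \<in> B" for s t
      proof -
        define D where "D = f s - f t"
        have "D \<noteq> 0" using that by (auto simp: A_def B_def D_def)
        have "D * c (s, t) i = (D - D * (f s / D)) * s i + D * (f s / D) * t i"
          unfolding c_def mix_def D_def prod.case by (simp only: algebra_simps)
        also have "\<dots> = (D - f s) * s i + f s * t i" using \<open>D \<noteq> 0\<close> by simp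
        also have "\<dots> = f s * t i - f t * s i" by (simp add: D_def algebra_simps)
        finally show ?thesis by (simp add: D_def)
      qed
      then show ?thesis
        using wsum[of "\<lambda>k. p k i"] key[of "\<lambda>s t. c (s, t) i" "\<lambda>s. s i"] by (simp add: p_def u(3))
    qed
    ultimately show "x \<in> conv_hull T" by (simp add: fun_eq_iff)
  qed
  ultimately show ?thesis using fin T_sub by (intro exI[of _ T]) auto
qed

section \<open>Fourier--Motzkin elimination\<close>

text \<open>Positive \<open>b\<close> bounds \<open>t\<close> from below by \<open>- a / b\<close>,
  negative \<open>b\<close> from above, and finitely many bounds admit a common \<open>t\<close> iff
  no lower bound exceeds an upper one. The comparison is multiplied out so that it stays linear in
  the constants \<open>a\<close>, as the elimination of the next variable requires.\<close>

lemma eliminate_one: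
  fixes K :: "(real \<times> real) set"
  assumes "finite K"
  shows "(\<exists>t. \<forall>(a, b)\<in>K. 0 \<le> a + b * t) \<longleftrightarrow>
    (\<forall>(a, b)\<in>K. b = 0 \<longrightarrow> 0 \<le> a) \<and> (\<forall>(a, b)\<in>K. \<forall>(a', b')\<in>K. 0 < b \<longrightarrow> b' < 0 \<longrightarrow> 0 \<le> b * a' + (- b') * a)"
    (is "?L \<longleftrightarrow> ?R")
proof
  assume ?L
  then obtain t where t: "\<And>a b. (a, b) \<in> K \<Longrightarrow> 0 \<le> a + b * t" by blast
  have "0 \<le> b * a' + (- b') * a" if "(a, b) \<in> K" "(a', b') \<in> K" "0 < b" "b' < 0" for a b a' b'
  proof -
    have "0 \<le> b * (a' + b' * t) + (- b') * (a + b * t)"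
      using t[OF that(1)] t[OF that(2)] that(3,4)
      by (intro add_nonneg_nonneg[OF mult_nonneg_nonneg mult_nonneg_nonneg]) simp_all
    then show ?thesis by (simp add: algebra_simps)
  qed
  moreover have "0 \<le> a" if "(a, 0) \<in> K" for a using t[OF that] by simp
  ultimately show ?R by blast
next
  assume R: ?R
  define lo where "lo = (\<lambda>k. - fst k / snd k) ` {k\<in>K. 0 < snd k}"
  define hi where "hi = (\<lambda>k. - fst k / snd k) ` {k\<in>K. snd k < 0}"
  have fin: "finite lo" "finite hi" using assms by (auto simp: lo_def hi_def intro!: finite_imageI elim: finite_subset[rotated])
  have lohi: "l \<le> h" if lh: "l \<in> lo" "h \<in> hi" for l h
  proof -
    obtain k where "k \<in> K" "0 < snd k" "l = - fst k / snd k"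
      using lh(1) unfolding lo_def by blast
    then obtain a b where ab: "(a, b) \<in> K" "0 < b" "l = - a / b"
      by (cases k) simp
    obtain k where "k \<in> K" "snd k < 0" "h = - fst k / snd k"
      using lh(2) unfolding hi_def by blast
    then obtain a' b' where ab': "(a', b') \<in> K" "b' < 0" "h = - a' / b'"
      by (cases k) simp
    have "0 \<le> b * a' + (- b') * a" using R ab ab' by blast
    moreover have "b * l = - a" "b' * h = - a'" using ab ab' by simp_all
    then have "h * (b * - b') = b * a'" "l * (b * - b') = b' * a"
      by (metis minus_mult_minus mult.commute mult.left_commute minus_minus)+
    ultimately have "l * (b * - b') \<le> h * (b * - b')" by simp
    then show ?thesis using ab(2) ab'(2) by (simp add: mult_le_cancel_right mult_less_0_iff zero_less_mult_iff)
  qed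
  have "\<exists>t. (\<forall>l\<in>lo. l \<le> t) \<and> (\<forall>h\<in>hi. t \<le> h)"
  proof (cases "lo = {}")
    case True
    then show ?thesis using fin by (cases "hi = {}") (auto intro!: exI[of _ "Min hi"])
  next
    case False
    then show ?thesis using fin lohi by (intro exI[of _ "Max lo"]) auto
  qed
  then obtain t where t: "\<And>l. l \<in> lo \<Longrightarrow> l \<le> t" "\<And>h. h \<in> hi \<Longrightarrow> t \<le> h" by blast
  have "0 \<le> a + b * t" if ab: "(a, b) \<in> K" for a b
  proof -
    consider "b = 0" | "0 < b" | "b < 0" by linarith
    then show ?thesis
    proof cases
      case 1
      then show ?thesis using R ab by auto
    next
      case 2
      then have "- a / b \<le> t" using ab by (intro t) (force simp: lo_def)
      then show ?thesis using 2 by (simp add: field_simps)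
    next
      case 3
      then have "t \<le> - a / b" using ab by (intro t) (force simp: hi_def)
      then show ?thesis using 3 by (simp add: field_simps)
    qed
  qed
  then show ?L by blast
qed

text \<open>A pair in \<open>L\<close> is an inequality with affine part \<open>f\<close> in the
  point and constant coefficients \<beta> in the unknowns \<open>u\<close>. Projecting out one
  unknown forms nonnegative combinations with constant coefficients, so affine parts stay
  affine.\<close>

lemma eliminate:
  assumes "finite S"
  shows "finite L \<Longrightarrow> fst ` L \<subseteq> aff \<Longrightarrow> \<exists>H. finite H \<and> H \<subseteq> aff \<and>
    (\<forall>x. (\<exists>u. \<forall>(f, \<beta>)\<in>L. 0 \<le> f x + (\<Sum>s\<in>S. \<beta> s * u s)) \<longleftrightarrow> (\<forall>f\<in>H. 0 \<le> f x))"
  using assms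
proof (induction S arbitrary: L rule: finite_induct)
  case empty
  then show ?case by (intro exI[of _ "fst ` L"]) auto
next
  case (insert s S)
  define L0 where "L0 = {(f, \<beta>)\<in>L. \<beta> s = 0}"
  define comb where "comb = (\<lambda>((f, \<beta>), (f', \<beta>')).
    (\<lambda>x :: nat \<Rightarrow> real. \<beta> s * f' x + (- \<beta>' s) * f x :: real, \<lambda>r. \<beta> s * \<beta>' r + (- \<beta>' s) * \<beta> r))"
  define L1 where "L1 = comb ` ({(f, \<beta>)\<in>L. 0 < \<beta> s} \<times> {(f, \<beta>)\<in>L. \<beta> s < 0})"
  have fin: "finite (L0 \<union> L1)"
    using insert.prems by (auto simp: L0_def L1_def intro!: finite_imageI finite_cartesian_product elim: finite_subset[rotated])
  have "fst ` L1 \<subseteq> aff"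
  proof -
    have "f \<in> aff" if "(f, \<beta>) \<in> L" for f \<beta> using insert.prems(2) that by force
    then show ?thesis unfolding L1_def comb_def by (auto intro!: aff_diff aff.scale)
  qed
  then have aff: "fst ` (L0 \<union> L1) \<subseteq> aff" using insert.prems by (auto simp: L0_def)
  obtain H where H: "finite H" "H \<subseteq> aff"
    "\<And>x. (\<exists>u. \<forall>(f, \<beta>)\<in>L0 \<union> L1. 0 \<le> f x + (\<Sum>s\<in>S. \<beta> s * u s)) \<longleftrightarrow> (\<forall>f\<in>H. 0 \<le> f x)"
    using insert.IH[OF fin aff] by blast
  have "(\<exists>u. \<forall>(f, \<beta>)\<in>L. 0 \<le> f x + (\<Sum>s\<in>insert s S. \<beta> s * u s)) \<longleftrightarrow>
      (\<exists>u. \<forall>(f, \<beta>)\<in>L0 \<union> L1. 0 \<le> f x + (\<Sum>s\<in>S. \<beta> s * u s))" for x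
  proof -
    have *: "(\<exists>t. \<forall>(f, \<beta>)\<in>L. 0 \<le> (f x + (\<Sum>r\<in>S. \<beta> r * u r)) + \<beta> s * t) \<longleftrightarrow>
        (\<forall>(f, \<beta>)\<in>L0 \<union> L1. 0 \<le> f x + (\<Sum>s\<in>S. \<beta> s * u s))" for u
    proof -
      define K where "K = (\<lambda>(f, \<beta>). (f x + (\<Sum>r\<in>S. \<beta> r * u r), \<beta> s)) ` L"
      have sum_comb: "b * (f' x + (\<Sum>r\<in>S. \<beta>' r * u r)) + (- b') * (f x + (\<Sum>r\<in>S. \<beta> r * u r)) =
          (b * f' x + (- b') * f x) + (\<Sum>r\<in>S. (b * \<beta>' r + (- b') * \<beta> r) * u r)"
        for b b' and f f' :: "(nat \<Rightarrow> real) \<Rightarrow> real" and \<beta> \<beta>' :: "'a \<Rightarrow> real"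
        by (simp only: distrib_left distrib_right sum.distrib sum_distrib_left mult.assoc add_ac)
      have "(\<exists>t. \<forall>(f, \<beta>)\<in>L. 0 \<le> (f x + (\<Sum>r\<in>S. \<beta> r * u r)) + \<beta> s * t)
          \<longleftrightarrow> (\<exists>t. \<forall>(a, b)\<in>K. 0 \<le> a + b * t)"
        by (simp add: K_def case_prod_unfold)
      also have "\<dots> \<longleftrightarrow> (\<forall>(f, \<beta>)\<in>L. \<beta> s = 0 \<longrightarrow> 0 \<le> f x + (\<Sum>r\<in>S. \<beta> r * u r)) \<and>
         (\<forall>(f, \<beta>)\<in>L. \<forall>(f', \<beta>')\<in>L. 0 < \<beta> s \<longrightarrow> \<beta>' s < 0 \<longrightarrow>
           0 \<le> (\<beta> s * f' x + (- \<beta>' s) * f x) + (\<Sum>r\<in>S. (\<beta> s * \<beta>' r + (- \<beta>' s) * \<beta> r) * u r))"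
      proof -
        have "finite K" using insert.prems by (simp add: K_def)
        show ?thesis unfolding eliminate_one[OF \<open>finite K\<close>] sum_comb[symmetric]
          by (simp add: K_def case_prod_unfold)
      qed
      also have "\<dots> \<longleftrightarrow> (\<forall>(f, \<beta>)\<in>L0 \<union> L1. 0 \<le> f x + (\<Sum>s\<in>S. \<beta> s * u s))"
        unfolding L0_def L1_def comb_def ball_Un by fastforce
      finally show ?thesis .
    qed
    have split: "(\<Sum>r\<in>insert s S. \<beta> r * u r) = \<beta> s * u s + (\<Sum>r\<in>S. \<beta> r * u r)" for \<beta> u :: "_ \<Rightarrow> real"
      using insert.hyps by simp
    have upd: "(\<Sum>r\<in>S. \<beta> r * (u(s := t)) r) = (\<Sum>r\<in>S. \<beta> r * u r)" for \<beta> u :: "_ \<Rightarrow> real" and t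
      using insert.hyps by (intro sum.cong) auto
    have "(\<exists>u. \<forall>(f, \<beta>)\<in>L. 0 \<le> f x + (\<Sum>s\<in>insert s S. \<beta> s * u s)) \<longleftrightarrow>
      (\<exists>u t. \<forall>(f, \<beta>)\<in>L. 0 \<le> (f x + (\<Sum>r\<in>S. \<beta> r * u r)) + \<beta> s * t)" (is "?A \<longleftrightarrow> ?B")
    proof
      assume ?A
      then obtain u where "\<forall>(f, \<beta>)\<in>L. 0 \<le> f x + (\<Sum>s\<in>insert s S. \<beta> s * u s)" by blast
      then show ?B unfolding split by (intro exI[of _ u] exI[of _ "u s"]) (auto simp: algebra_simps)
    next
      assume ?B
      then obtain u t where "\<forall>(f, \<beta>)\<in>L. 0 \<le> (f x + (\<Sum>r\<in>S. \<beta> r * u r)) + \<beta> s * t" by blast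
      then show ?A unfolding split using upd by (intro exI[of _ "u(s := t)"]) (auto simp: algebra_simps)
    qed
    then show ?thesis using * by blast
  qed
  then show ?case using H by (intro exI[of _ H]) simp
qed

lemma conv_hull_halfspaces:
  assumes S: "finite S" "S \<subseteq> Rd d"
  shows "\<exists>H. finite H \<and> H \<subseteq> aff \<and> (\<forall>x\<in>Rd d. x \<in> conv_hull S \<longleftrightarrow> (\<forall>f\<in>H. 0 \<le> f x))"
proof -
  \<comment> \<open>The barycentric weights are the unknowns: they are nonnegative, they sum to 1,
    and every coordinate below \<open>d\<close> is matched, each equation being written as two
    inequalities.\<close>
  define L where "L = (\<lambda>s. (\<lambda>x :: nat \<Rightarrow> real. 0 :: real, \<lambda>r. if r = s then 1 else 0 :: real)) ` S
    \<union> {(\<lambda>x. -1, \<lambda>r. 1), (\<lambda>x. 1, \<lambda>r. -1)}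
    \<union> (\<lambda>i. (\<lambda>x. x i, \<lambda>r. - r i)) ` {..<d} \<union> (\<lambda>i. (\<lambda>x. - x i, \<lambda>r. r i)) ` {..<d}"
  have fin: "finite L" using S by (simp add: L_def)
  have "fst ` L \<subseteq> aff" by (auto simp: L_def intro: aff.const aff.coord aff_uminus[OF aff.coord])
  from eliminate[OF S(1) fin this] obtain H where H: "finite H" "H \<subseteq> aff"
    "\<And>x. (\<exists>u. \<forall>(f, \<beta>)\<in>L. 0 \<le> f x + (\<Sum>s\<in>S. \<beta> s * u s)) \<longleftrightarrow> (\<forall>f\<in>H. 0 \<le> f x)"
    by blast
  have L: "(\<forall>(f, \<beta>)\<in>L. 0 \<le> f x + (\<Sum>s\<in>S. \<beta> s * u s)) \<longleftrightarrow>
      (\<forall>s\<in>S. 0 \<le> u s) \<and> sum u S = 1 \<and> (\<forall>i<d. x i = (\<Sum>s\<in>S. u s * s i))" for x u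
  proof -
    have 1: "(\<Sum>r\<in>S. (if r = s then 1 else 0) * u r) = (if s \<in> S then u s else 0)" for s
      using S by (simp add: if_distrib[of "\<lambda>a. a * _"] sum.delta cong: if_cong)
    have 2: "(\<forall>i<d. x i = (\<Sum>s\<in>S. u s * s i)) \<longleftrightarrow>
        (\<forall>i<d. 0 \<le> x i + (\<Sum>s\<in>S. - s i * u s)) \<and> (\<forall>i<d. 0 \<le> - x i + (\<Sum>s\<in>S. s i * u s))"
      by (force simp: sum_negf mult.commute)
    show ?thesis unfolding 2 unfolding L_def
      by (auto simp: ball_Un 1 sum_negf)
  qed
  have "x \<in> conv_hull S \<longleftrightarrow> (\<forall>f\<in>H. 0 \<le> f x)" if x: "x \<in> Rd d" for x
  proof -
    have "x = (\<lambda>i. \<Sum>s\<in>S. u s * s i) \<longleftrightarrow> (\<forall>i<d. x i = (\<Sum>s\<in>S. u s * s i))" for u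
    proof -
      have "x i = (\<Sum>s\<in>S. u s * s i)" if "\<not> i < d" for i
      proof -
        have "x i = 0" "\<forall>s\<in>S. u s * s i = 0" using S x that by (auto simp: Rd_def)
        then show ?thesis by (simp add: sum.neutral)
      qed
      then show ?thesis unfolding fun_eq_iff by auto
    qed
    then show ?thesis unfolding H(3)[symmetric] L conv_hull_def by auto
  qed
  then show ?thesis using H by blast
qed

section \<open>The sign preorder of an arrangement of hyperplanes\<close>

text \<open>The face order of the arrangement: a sign may change only from 0 to nonzero, so for
  affine \<open>H\<close> the point \<open>x\<close> lies in the closure of the cell of
  \<open>y\<close>. Cells are the classes of this preorder.\<close>

definition spec :: "((nat \<Rightarrow> real) \<Rightarrow> real) set \<Rightarrow> (nat \<Rightarrow> real) \<Rightarrow> (nat \<Rightarrow> real) \<Rightarrow> bool" where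
  "spec H x y \<longleftrightarrow> (\<forall>f\<in>H. f x \<noteq> 0 \<longrightarrow> sgn (f y) = sgn (f x))"

definition up_in :: "'a set \<Rightarrow> ('a \<Rightarrow> 'a \<Rightarrow> bool) \<Rightarrow> 'a set \<Rightarrow> bool" where
  "up_in W le U \<longleftrightarrow> U \<subseteq> W \<and> (\<forall>x\<in>U. \<forall>y\<in>W. le x y \<longrightarrow> y \<in> U)"

lemma spec_refl [simp]: "spec H x x"
  by (simp add: spec_def)

lemma spec_trans: "spec H x y \<Longrightarrow> spec H y z \<Longrightarrow> spec H x z"
  unfolding spec_def by (metis sgn_eq_0_iff)

lemma spec_mono: "H \<subseteq> H' \<Longrightarrow> spec H' x y \<Longrightarrow> spec H x y"
  by (auto simp: spec_def)

lemma up_in_mono: "H \<subseteq> H' \<Longrightarrow> up_in P (spec H) U \<Longrightarrow> up_in P (spec H') U"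
  unfolding up_in_def using spec_mono by blast

text \<open>Where \<open>f x = 0\<close>, the form is merely scaled by \<open>t\<close>; elsewhere
  both ends have the same strict sign. So the segment without its end \<open>x\<close> stays in the
  cell of \<open>y\<close>.\<close>

lemma spec_mix:
  assumes H: "H \<subseteq> aff" and xy: "spec H x y" and t: "0 < t" "t \<le> 1"
  shows "spec H x (mix t x y)" "spec H (mix t x y) y" "spec H y (mix t x y)"
proof -
  have "sgn (f (mix t x y)) = sgn (f y)" if f: "f \<in> H" for f
  proof -
    have m: "f (mix t x y) = (1 - t) * f x + t * f y" using aff_mix H f by blast
    consider "f x = 0" | "0 < f x" "0 < f y" | "f x < 0" "f y < 0"
      using xy f unfolding spec_def by (metis linorder_less_linear sgn_greater sgn_less)
    then show ?thesis
    proof cases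
      case 1
      then show ?thesis using m t by (simp add: sgn_mult)
    next
      case 2
      then have "0 < f (mix t x y)" unfolding m using t by (intro add_nonneg_pos) auto
      then show ?thesis using 2 by simp
    next
      case 3
      then have "f (mix t x y) < 0" unfolding m using t
        by (intro add_nonpos_neg) (auto simp: mult_nonneg_nonpos mult_pos_neg)
      then show ?thesis using 3 by simp
    qed
  qed
  then show "spec H x (mix t x y)" "spec H (mix t x y) y" "spec H y (mix t x y)"
    using xy by (auto simp: spec_def)
qed

text \<open>A nonzero sign is an open condition and \<open>H\<close> is finite. The parameter
  \<open>a\<close> is arbitrary because 0 serves for \<open>spec_near\<close>, and all of the unit
  interval for local constancy along a segment.\<close>

lemma eventually_spec:
  assumes H: "finite H" "H \<subseteq> aff"
  shows "\<forall>\<^sub>F t in nhds a. spec H (mix a x y) (mix t x y)"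
proof -
  have "\<forall>\<^sub>F t in nhds a. f (mix a x y) \<noteq> 0 \<longrightarrow> sgn (f (mix t x y)) = sgn (f (mix a x y))" if "f \<in> H" for f
  proof -
    define g where "g t = (1 - t) * f x + t * f y" for t
    have fg: "f (mix t x y) = g t" for t using aff_mix H that unfolding g_def by blast
    have lim: "(g \<longlongrightarrow> g a) (nhds a)"
      unfolding g_def by (intro tendsto_intros filterlim_ident)
    consider "g a = 0" | "0 < g a" | "g a < 0" by linarith
    then show ?thesis
    proof cases
      case 2
      then have "\<forall>\<^sub>F t in nhds a. 0 < g t" using order_tendstoD(1)[OF lim] by blast
      then show ?thesis by (rule eventually_mono) (use 2 in \<open>simp add: fg\<close>)
    next
      case 3
      then have "\<forall>\<^sub>F t in nhds a. g t < 0" using order_tendstoD(2)[OF lim] by blast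
      then show ?thesis by (rule eventually_mono) (use 3 in \<open>simp add: fg\<close>)
    qed (simp add: fg)
  qed
  then show ?thesis unfolding spec_def using H(1) by (simp add: eventually_ball_finite)
qed

lemma spec_near:
  assumes "finite H" "H \<subseteq> aff"
  shows "\<exists>t. 0 < t \<and> t \<le> 1 \<and> spec H x (mix t x y)"
proof -
  have "\<forall>\<^sub>F t in nhds 0. spec H x (mix t x y)" using eventually_spec[OF assms, of 0 x y] by simp
  then obtain e where e: "0 < e" "\<And>t. dist t 0 < e \<Longrightarrow> spec H x (mix t x y)"
    unfolding eventually_nhds_metric by blast
  show ?thesis using e by (intro exI[of _ "min (e / 2) 1"]) (auto simp: dist_norm)
qed

section \<open>Open subpolyhedra as upsets of sign preorders\<close>

lemma polyhedron_empty: "polyhedron {}"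
  unfolding polyhedron_def by (intro exI[of _ 0] exI[of _ "{}"]) auto

lemma polyhedron_Un: "polyhedron P \<Longrightarrow> polyhedron Q \<Longrightarrow> polyhedron (P \<union> Q)"
proof -
  assume "polyhedron P" "polyhedron Q"
  then obtain d F e G where "finite F" "\<forall>S\<in>F. finite S \<and> S \<subseteq> Rd d" "P = \<Union> (conv_hull ` F)"
    "finite G" "\<forall>S\<in>G. finite S \<and> S \<subseteq> Rd e" "Q = \<Union> (conv_hull ` G)"
    unfolding polyhedron_def by blast
  moreover have "S \<subseteq> Rd (max d e)" if "S \<subseteq> Rd d \<or> S \<subseteq> Rd e" for S
    using that Rd_mono[of d "max d e"] Rd_mono[of e "max d e"] by auto
  ultimately show ?thesis unfolding polyhedron_def
    by (intro exI[of _ "max d e"] exI[of _ "F \<union> G"]) (simp add: image_Un; blast)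
qed

lemma polyhedron_Union: "finite A \<Longrightarrow> (\<And>P. P \<in> A \<Longrightarrow> polyhedron P) \<Longrightarrow> polyhedron (\<Union>A)"
  by (induction A rule: finite_induct) (auto simp: polyhedron_empty polyhedron_Un)

lemma polyhedron_conv_hull: "finite S \<Longrightarrow> S \<subseteq> Rd d \<Longrightarrow> polyhedron (conv_hull S)"
  unfolding polyhedron_def by (intro exI[of _ d] exI[of _ "{S}"]) auto

lemma polyhedron_halfspace:
  assumes "polyhedron P" "f \<in> aff" shows "polyhedron (P \<inter> {x. 0 \<le> f x})"
proof -
  obtain d F where F: "finite F" "\<forall>S\<in>F. finite S \<and> S \<subseteq> Rd d" "P = \<Union> (conv_hull ` F)"
    using assms(1) unfolding polyhedron_def by blast
  have "polyhedron (conv_hull S \<inter> {x. 0 \<le> f x})" if "S \<in> F" for S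
    using conv_hull_cut[of S d f] F(2) that assms(2) polyhedron_conv_hull by fastforce
  then have "polyhedron (\<Union> ((\<lambda>S. conv_hull S \<inter> {x. 0 \<le> f x}) ` F))"
    using F(1) by (intro polyhedron_Union) auto
  moreover have "\<Union> ((\<lambda>S. conv_hull S \<inter> {x. 0 \<le> f x}) ` F) = P \<inter> {x. 0 \<le> f x}" using F(3) by auto
  ultimately show ?thesis by simp
qed

lemma polyhedron_halfspaces:
  assumes "finite K" "polyhedron P" "K \<subseteq> aff" shows "polyhedron (P \<inter> {x. \<forall>f\<in>K. 0 \<le> f x})"
  using assms
proof (induction K rule: finite_induct)
  case (insert f K)
  have "P \<inter> {x. \<forall>g\<in>insert f K. 0 \<le> g x} = P \<inter> {x. \<forall>f\<in>K. 0 \<le> f x} \<inter> {x. 0 \<le> f x}" by auto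
  then show ?case using insert polyhedron_halfspace by simp
qed simp

text \<open>The complement is closed downwards, hence is the union of the sets of points below its
  members. Each of these is cut out of \<open>P\<close> by weak inequalities, and only finitely many
  systems \<open>K z\<close> occur although \<open>z\<close> ranges over an infinite set.\<close>

lemma up_in_Sub_o:
  assumes P: "polyhedron P" and H: "finite H" "H \<subseteq> aff" and U: "up_in P (spec H) U"
  shows "U \<in> Sub_o P"
proof -
  \<comment> \<open>The signs of \<open>z\<close>, weakened: a form vanishing at \<open>z\<close>
    enters with both orientations and is thereby forced to vanish.\<close>
  define K where "K z = {f\<in>H. 0 \<le> f z} \<union> (\<lambda>f x. - f x) ` {f\<in>H. f z \<le> 0}" for z
  define cell where "cell L = P \<inter> {x. \<forall>f\<in>L. 0 \<le> f x}" for L :: "((nat \<Rightarrow> real) \<Rightarrow> real) set"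
  have cell: "cell (K z) = {y\<in>P. spec H y z}" for z
  proof -
    have "(0 \<le> f z \<longrightarrow> 0 \<le> f y) \<and> (f z \<le> 0 \<longrightarrow> 0 \<le> - f y) \<longleftrightarrow> (f y \<noteq> 0 \<longrightarrow> sgn (f z) = sgn (f y))"
      for f :: "(nat \<Rightarrow> real) \<Rightarrow> real" and y
      by (auto simp: sgn_if)
    note sign = this
    have "(\<forall>f\<in>K z. 0 \<le> f y) \<longleftrightarrow> (\<forall>f\<in>H. (0 \<le> f z \<longrightarrow> 0 \<le> f y) \<and> (f z \<le> 0 \<longrightarrow> 0 \<le> - f y))" for y
      unfolding K_def ball_Un by auto
    then have "(\<forall>f\<in>K z. 0 \<le> f y) \<longleftrightarrow> spec H y z" for y
      unfolding sign spec_def .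
    then show ?thesis by (auto simp: cell_def)
  qed
  have Kaff: "K z \<subseteq> aff" for z using H(2) by (auto simp: K_def intro: aff_uminus)
  have Ksub: "K z \<subseteq> H \<union> (\<lambda>f x. - f x) ` H" for z by (auto simp: K_def)
  have fin: "finite (K ` (P - U))"
    by (rule finite_subset[of _ "Pow (H \<union> (\<lambda>f x. - f x) ` H)"]) (use Ksub H(1) in auto)
  have "polyhedron (cell L)" if "L \<in> K ` (P - U)" for L
    unfolding cell_def using that Kaff H(1) P by (intro polyhedron_halfspaces) (auto simp: K_def)
  then have "polyhedron (\<Union> (cell ` K ` (P - U)))"
    using fin by (intro polyhedron_Union) auto
  moreover have "\<Union> (cell ` K ` (P - U)) = P - U"
    using U unfolding up_in_def by (auto simp: cell)
  moreover have "U = P - (P - U)" using U unfolding up_in_def by auto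
  ultimately show ?thesis unfolding Sub_o_def by (intro CollectI exI[of _ "P - U"]) auto
qed

text \<open>The removed polyhedron is a union of sets given by weak inequalities, and these are
  inherited downwards: if \<open>f x < 0\<close>, then also \<open>f y < 0\<close> for
  \<open>y\<close> above \<open>x\<close>.\<close>

lemma Sub_o_up_in:
  assumes P: "polyhedron P" and U: "U \<in> Sub_o P"
  shows "\<exists>H. finite H \<and> H \<subseteq> aff \<and> up_in P (spec H) U"
proof -
  obtain Q where Q: "polyhedron Q" "Q \<subseteq> P" "U = P - Q" using U by (auto simp: Sub_o_def)
  obtain d F where "finite F" "\<forall>S\<in>F. finite S \<and> S \<subseteq> Rd d" "P = \<Union> (conv_hull ` F)"
    using P unfolding polyhedron_def by blast
  then have PRd: "P \<subseteq> Rd d" using conv_hull_subset_Rd[of _ d] by (simp add: UN_least)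
  obtain e G where G: "finite G" "\<forall>S\<in>G. finite S \<and> S \<subseteq> Rd e" "Q = \<Union> (conv_hull ` G)"
    using Q(1) unfolding polyhedron_def by blast
  \<comment> \<open>A half-space description of a hull holds only inside one ambient
    \<open>Rd m\<close>, and \<open>P\<close> and \<open>Q\<close> may come with different
    dimensions.\<close>
  define m where "m = max d e"
  have mono: "Rd d \<subseteq> Rd m" "Rd e \<subseteq> Rd m" by (simp_all add: m_def Rd_mono)
  have sub: "P \<subseteq> Rd m" "\<forall>S\<in>G. S \<subseteq> Rd m"
    by (rule order_trans[OF PRd mono(1)]) (rule ballI, rule order_trans[OF _ mono(2)], simp add: G(2))
  have "\<forall>S\<in>G. \<exists>H. finite H \<and> H \<subseteq> aff \<and> (\<forall>x\<in>Rd m. x \<in> conv_hull S \<longleftrightarrow> (\<forall>f\<in>H. 0 \<le> f x))"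
    using conv_hull_halfspaces[of _ m] G(2) sub(2) by simp
  then obtain h where h: "\<And>S. S \<in> G \<Longrightarrow> finite (h S) \<and> h S \<subseteq> aff"
    "\<And>S x. S \<in> G \<Longrightarrow> x \<in> Rd m \<Longrightarrow> x \<in> conv_hull S \<longleftrightarrow> (\<forall>f\<in>h S. 0 \<le> f x)"
    by metis
  have "up_in P (spec (\<Union> (h ` G))) U"
    unfolding up_in_def
  proof (intro conjI ballI impI)
    show "U \<subseteq> P" using Q by auto
    fix x y assume x: "x \<in> U" and y: "y \<in> P" "spec (\<Union> (h ` G)) x y"
    have "y \<notin> conv_hull S" if S: "S \<in> G" for S
    proof
      assume "y \<in> conv_hull S"
      then have "\<forall>f\<in>h S. 0 \<le> f y" using h(2)[OF S] y(1) sub(1) by blast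
      moreover have "f y < 0" if "f \<in> h S" "f x < 0" for f
      proof -
        have "sgn (f y) = sgn (f x)" using y(2) S that unfolding spec_def by auto
        then show ?thesis using that(2) by (metis sgn_less)
      qed
      ultimately have "\<forall>f\<in>h S. 0 \<le> f x" by (meson not_le)
      then show False using h(2)[OF S] x Q sub(1) G(3) S by blast
    qed
    then show "y \<in> U" using y(1) Q(3) G(3) by auto
  qed
  then show ?thesis using h(1) G(1) by (intro exI[of _ "\<Union> (h ` G)"]) auto
qed

section \<open>Kripke forcing\<close>

primrec force :: "'a set \<Rightarrow> ('a \<Rightarrow> 'a \<Rightarrow> bool) \<Rightarrow> (nat \<Rightarrow> 'a set) \<Rightarrow> fm \<Rightarrow> 'a set" where
  "force W le v (Var n) = v n"
| "force W le v Bot = {}"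
| "force W le v (Conj a b) = force W le v a \<inter> force W le v b"
| "force W le v (Disj a b) = force W le v a \<union> force W le v b"
| "force W le v (Imp a b) = {x\<in>W. \<forall>y\<in>W. le x y \<longrightarrow> y \<in> force W le v a \<longrightarrow> y \<in> force W le v b}"

primrec vars :: "fm \<Rightarrow> nat set" where
  "vars (Var n) = {n}"
| "vars Bot = {}"
| "vars (Conj a b) = vars a \<union> vars b"
| "vars (Disj a b) = vars a \<union> vars b"
| "vars (Imp a b) = vars a \<union> vars b"

lemma finite_vars: "finite (vars \<phi>)"
  by (induction \<phi>) auto

lemma up_in_force:
  assumes "\<And>x y z. le x y \<Longrightarrow> le y z \<Longrightarrow> le x z"
  shows "(\<And>n. n \<in> vars \<phi> \<Longrightarrow> up_in W le (v n)) \<Longrightarrow> up_in W le (force W le v \<phi>)"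
proof (induction \<phi>)
  case (Imp a b)
  then show ?case unfolding up_in_def using assms by auto
qed (auto simp: up_in_def)

text \<open>Since P is convex, the segment from x to a point y above it stays in the cell of y
  while its initial part lies in any given open neighbourhood of x; hence the
  Heyting implication is computed as in the sign preorder.\<close>

lemma eval_eq_force:
  assumes P: "polyhedron P" "convex_set P" and H: "finite H" "H \<subseteq> aff"
  shows "(\<And>n. n \<in> vars \<phi> \<Longrightarrow> up_in P (spec H) (v n)) \<Longrightarrow> eval P v \<phi> = force P (spec H) v \<phi>"
proof (induction \<phi>)
  case (Imp a b)
  let ?A = "force P (spec H) v a" and ?B = "force P (spec H) v b"
  have up: "up_in P (spec H) ?A" "up_in P (spec H) ?B" "up_in P (spec H) (force P (spec H) v (Imp a b))"
    by (intro up_in_force[OF spec_trans] Imp.prems; simp)+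
  have IH: "eval P v a = ?A" "eval P v b = ?B"
    by (intro Imp.IH Imp.prems; simp)+
  have "x \<in> force P (spec H) v (Imp a b)" if U: "U \<in> Sub_o P" "U \<inter> ?A \<subseteq> ?B" "x \<in> U" for U x
  proof -
    obtain H' where H': "finite H'" "H' \<subseteq> aff" "up_in P (spec H') U"
      using Sub_o_up_in[OF P(1) U(1)] by blast
    have x: "x \<in> P" using U(3) H'(3) by (auto simp: up_in_def)
    have "y \<in> ?B" if y: "y \<in> P" "spec H x y" "y \<in> ?A" for y
    proof -
      obtain t where t: "0 < t" "t \<le> 1" "spec H' x (mix t x y)" using spec_near[OF H'(1,2)] by blast
      have z: "mix t x y \<in> P" using convex_mix[OF P(2) x y(1)] t by simp
      note m = spec_mix[OF H(2) y(2) t(1,2)]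
      have "mix t x y \<in> U" using H'(3) U(3) z t(3) by (auto simp: up_in_def)
      moreover have "mix t x y \<in> ?A" using up(1) y z m by (auto simp: up_in_def)
      ultimately have "mix t x y \<in> ?B" using U(2) by blast
      then show ?thesis using up(2) y(1) m by (auto simp: up_in_def)
    qed
    then show ?thesis using x by simp
  qed
  moreover have "force P (spec H) v (Imp a b) \<in> Sub_o P" using up_in_Sub_o[OF P(1) H up(3)] .
  moreover have "force P (spec H) v (Imp a b) \<inter> ?A \<subseteq> ?B" by auto
  ultimately show ?case unfolding eval.simps IH by blast
qed auto

lemma arrangement_exists:
  assumes P: "polyhedron P" and v: "\<And>n. v n \<in> Sub_o P" and N: "finite N"
  shows "\<exists>H. finite H \<and> H \<subseteq> aff \<and> (\<forall>n\<in>N. up_in P (spec H) (v n))"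
proof -
  obtain h where h: "\<And>n. finite (h n) \<and> h n \<subseteq> aff \<and> up_in P (spec (h n)) (v n)"
    using Sub_o_up_in[OF P v] by metis
  show ?thesis
    by (intro exI[of _ "\<Union> (h ` N)"] conjI ballI up_in_mono[of "h _" "\<Union> (h ` N)"]) (use h N in auto)
qed

section \<open>Jankov formulas\<close>

definition rooted_poset :: "nat set \<Rightarrow> (nat \<Rightarrow> nat \<Rightarrow> bool) \<Rightarrow> nat \<Rightarrow> bool" where
  "rooted_poset Q qle r \<longleftrightarrow> finite Q \<and> r \<in> Q \<and> (\<forall>x\<in>Q. qle r x \<and> qle x x)
    \<and> (\<forall>x\<in>Q. \<forall>y\<in>Q. qle x y \<longrightarrow> qle y x \<longrightarrow> x = y)
    \<and> (\<forall>x\<in>Q. \<forall>y\<in>Q. \<forall>z\<in>Q. qle x y \<longrightarrow> qle y z \<longrightarrow> qle x z)"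

lemma rooted_posetD:
  assumes "rooted_poset Q qle r"
  shows "x \<in> Q \<Longrightarrow> qle x x" "x \<in> Q \<Longrightarrow> y \<in> Q \<Longrightarrow> qle x y \<Longrightarrow> qle y x \<Longrightarrow> x = y"
    "x \<in> Q \<Longrightarrow> y \<in> Q \<Longrightarrow> z \<in> Q \<Longrightarrow> qle x y \<Longrightarrow> qle y z \<Longrightarrow> qle x z"
  using assms unfolding rooted_poset_def by blast+

definition pvar :: "nat set \<Rightarrow> fm" where "pvar U = Var (set_code U)"

definition diagram :: "nat set \<Rightarrow> (nat \<Rightarrow> nat \<Rightarrow> bool) \<Rightarrow> fm set" where
  "diagram Q qle = insert (Iff (pvar {}) Bot)
     (\<Union>A\<in>upsets Q qle. \<Union>B\<in>upsets Q qle.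
       {Iff (pvar (A \<inter> B)) (Conj (pvar A) (pvar B)),
        Iff (pvar (A \<union> B)) (Disj (pvar A) (pvar B)),
        Iff (pvar (up_imp Q qle A B)) (Imp (pvar A) (pvar B))})"

lemma code_set_code: "finite U \<Longrightarrow> code_set (set_code U) = U"
  using set_encode_inverse[of U]
  by (simp add: code_set_def set_code_def set_encode_def set_decode_def)

lemma jankov_unfold:
  assumes Q: "rooted_poset Q qle r"
  shows "\<exists>L. jankov Q qle = Imp (Conjs L) (pvar (Q - {r})) \<and> set L = diagram Q qle"
proof -
  have root: "poset_root Q qle = r"
    unfolding poset_root_def using Q by (intro the_equality) (auto simp: rooted_poset_def)
  define U where "U = set_code ` upsets Q qle"
  have finQ: "finite Q" using Q by (simp add: rooted_poset_def)
  have "upsets Q qle \<subseteq> Pow Q" by (auto simp: upsets_def)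
  then have finU: "finite U" using finQ by (auto simp: U_def intro: finite_subset)
  have dec: "code_set (set_code A) = A" if "A \<in> upsets Q qle" for A
    using that finQ by (intro code_set_code) (auto simp: upsets_def intro: finite_subset)
  define cl where "cl a b = (let A = code_set a; B = code_set b in
                 [Iff (Var (set_code (A \<inter> B))) (Conj (Var a) (Var b)),
                  Iff (Var (set_code (A \<union> B))) (Disj (Var a) (Var b)),
                  Iff (Var (set_code (up_imp Q qle A B))) (Imp (Var a) (Var b))])" for a b
  define L where "L = Iff (pvar {}) Bot # concat (map (\<lambda>a. concat (map (cl a) (sorted_list_of_set U))) (sorted_list_of_set U))"
  have "jankov Q qle = Imp (Conjs L) (pvar (Q - {r}))"
    unfolding jankov_def Let_def root L_def cl_def U_def pvar_def by simp
  moreover have "set L = diagram Q qle"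
  proof -
    have "set L = insert (Iff (pvar {}) Bot) (\<Union>a\<in>U. \<Union>b\<in>U. set (cl a b))"
      using finU by (simp add: L_def)
    also have "\<dots> = diagram Q qle"
      unfolding diagram_def U_def by (simp add: cl_def Let_def dec pvar_def)
    finally show ?thesis .
  qed
  ultimately show ?thesis by blast
qed

lemma upsets_up_imp:
  assumes Q: "rooted_poset Q qle r"
  shows "up_imp Q qle A B \<in> upsets Q qle"
  unfolding upsets_def
proof (intro CollectI conjI ballI impI)
  show "up_imp Q qle A B \<subseteq> Q" by (auto simp: up_imp_def)
  fix x y assume "x \<in> up_imp Q qle A B" "y \<in> Q" "qle x y"
  then show "y \<in> up_imp Q qle A B"
    using rooted_posetD(3)[OF Q, of x y] by (simp add: up_imp_def)
qed

text \<open>The implication from the cone of \<open>w\<close> to the punctured cone fails exactly at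
  the points below \<open>w\<close>; this is the source of the back condition of the
  p-morphism.\<close>

lemma upsets_cone:
  assumes Q: "rooted_poset Q qle r" and w: "w \<in> Q"
  shows "{x\<in>Q. qle w x} \<in> upsets Q qle" "{x\<in>Q. qle w x} - {w} \<in> upsets Q qle"
proof -
  have 1: "qle w y" if "x \<in> Q" "y \<in> Q" "qle w x" "qle x y" for x y
    using rooted_posetD(3)[OF Q w that(1,2)] that by simp
  have 2: "w = x" if "x \<in> Q" "qle w x" "qle x w" for x
    using rooted_posetD(2)[OF Q w] that by simp
  show "{x\<in>Q. qle w x} \<in> upsets Q qle"
    unfolding upsets_def by (auto intro: 1)
  have "y \<in> {x\<in>Q. qle w x} - {w}" if "x \<in> {x\<in>Q. qle w x} - {w}" "y \<in> Q" "qle x y" for x y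
    using that 1[of x y] 2[of x] by auto
  then show "{x\<in>Q. qle w x} - {w} \<in> upsets Q qle"
    unfolding upsets_def by blast
qed

lemma force_Iff:
  "x \<in> force W le v (subst s (Iff a b)) \<longleftrightarrow>
    x \<in> W \<and> (\<forall>y\<in>W. le x y \<longrightarrow> (y \<in> force W le v (subst s a) \<longleftrightarrow> y \<in> force W le v (subst s b)))"
  by (auto simp: Iff_def)

text \<open>At a point \<open>x0\<close> that forces the diagram but not the opremum, the
  substituted variables obey the Heyting operations of Up(Q) everywhere above \<open>x0\<close>. The
  upsets true at a point \<open>y\<close> then form a prime filter of a finite lattice, so they are
  the upsets containing one element \<open>w\<close>, and \<open>f y = w\<close>. Persistence gives
  monotonicity, the implication clauses give the lifting.\<close>

lemma jankov_refuted:
  fixes W :: "'a set" and le :: "'a \<Rightarrow> 'a \<Rightarrow> bool"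
  assumes Q: "rooted_poset Q qle r"
    and refl: "\<And>x. le x x" and trans: "\<And>x y z. le x y \<Longrightarrow> le y z \<Longrightarrow> le x z"
    and up: "\<And>V. V \<in> upsets Q qle \<Longrightarrow> up_in W le (force W le v (s (set_code V)))"
    and x: "x \<in> W" "x \<notin> force W le v (subst s (jankov Q qle))"
  obtains x0 f where "x0 \<in> W" "f x0 = r"
    "\<And>y. y \<in> W \<Longrightarrow> le x0 y \<Longrightarrow> f y \<in> Q"
    "\<And>y z. y \<in> W \<Longrightarrow> z \<in> W \<Longrightarrow> le x0 y \<Longrightarrow> le y z \<Longrightarrow> qle (f y) (f z)"
    "\<And>y w. y \<in> W \<Longrightarrow> le x0 y \<Longrightarrow> w \<in> Q \<Longrightarrow> qle (f y) w \<Longrightarrow> \<exists>z\<in>W. le y z \<and> f z = w"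
proof -
  define E where "E V = force W le v (s (set_code V))" for V
  have Ep: "force W le v (subst s (pvar V)) = E V" for V by (simp add: pvar_def E_def)
  note up = up[folded E_def]
  obtain L where L: "jankov Q qle = Imp (Conjs L) (pvar (Q - {r}))" "set L = diagram Q qle"
    using jankov_unfold[OF Q] by blast
  obtain x0 where x0: "x0 \<in> W" "x0 \<in> force W le v (subst s (Conjs L))" "x0 \<notin> E (Q - {r})"
    using x by (auto simp: L(1) Ep)
  have conj: "x0 \<in> force W le v (subst s a)" if "a \<in> set K" "x0 \<in> force W le v (subst s (Conjs K))" for a K
    using that by (induction K) (auto simp: Conjs_def)
  have "x0 \<in> force W le v (subst s a)" if "a \<in> diagram Q qle" for a
    using conj[of a L] that x0(2) L(2) by blast
  note D = this[unfolded diagram_def, simplified]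
  have emp: "y \<notin> E {}" if "y \<in> W" "le x0 y" for y
    using D[of "Iff (pvar {}) Bot"] that by (simp add: force_Iff Ep)
  have int: "y \<in> E (A \<inter> B) \<longleftrightarrow> y \<in> E A \<and> y \<in> E B"
    if "y \<in> W" "le x0 y" "A \<in> upsets Q qle" "B \<in> upsets Q qle" for y A B
    using D[of "Iff (pvar (A \<inter> B)) (Conj (pvar A) (pvar B))"] that by (auto simp: force_Iff Ep)
  have un: "y \<in> E (A \<union> B) \<longleftrightarrow> y \<in> E A \<or> y \<in> E B"
    if "y \<in> W" "le x0 y" "A \<in> upsets Q qle" "B \<in> upsets Q qle" for y A B
    using D[of "Iff (pvar (A \<union> B)) (Disj (pvar A) (pvar B))"] that by (auto simp: force_Iff Ep)
  have imp: "y \<in> E (up_imp Q qle A B) \<longleftrightarrow> (\<forall>z\<in>W. le y z \<longrightarrow> z \<in> E A \<longrightarrow> z \<in> E B)"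
    if "y \<in> W" "le x0 y" "A \<in> upsets Q qle" "B \<in> upsets Q qle" for y A B
    using D[of "Iff (pvar (up_imp Q qle A B)) (Imp (pvar A) (pvar B))"] that by (auto simp: force_Iff Ep)
  have upQ: "Q \<in> upsets Q qle" "{} \<in> upsets Q qle" by (auto simp: upsets_def)
  note cone = upsets_cone[OF Q] and qrefl = rooted_posetD(1)[OF Q]
  have upUn: "A \<union> B \<in> upsets Q qle" "A \<inter> B \<in> upsets Q qle"
    if "A \<in> upsets Q qle" "B \<in> upsets Q qle" for A B
    using that by (auto simp: upsets_def)
  have top: "y \<in> E Q" if "y \<in> W" "le x0 y" for y
  proof -
    have "up_imp Q qle Q Q = Q" by (auto simp: up_imp_def)
    then show ?thesis using imp[OF that upQ(1) upQ(1)] by simp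
  qed
  have ex: "\<exists>w\<in>Q. \<forall>V\<in>upsets Q qle. y \<in> E V \<longleftrightarrow> w \<in> V" if y: "y \<in> W" "le x0 y" for y
  proof -
    define F where "F = {V\<in>upsets Q qle. y \<in> E V}"
    have FQ: "Q \<in> F" using top[OF y] upQ by (simp add: F_def)
    \<comment> \<open>Least cardinality means least element here, because the upsets true at
      \<open>y\<close> are closed under intersection.\<close>
    define V where "V = arg_min card (\<lambda>V. V \<in> F)"
    have V: "V \<in> F" "\<And>V'. V' \<in> F \<Longrightarrow> card V \<le> card V'"
      using arg_min_nat_lemma[of "\<lambda>V. V \<in> F" Q card] FQ by (auto simp: V_def)
    have fin: "finite V" using V(1) Q by (auto simp: F_def upsets_def rooted_poset_def intro: finite_subset)
    have least: "V \<subseteq> V'" if "V' \<in> F" for V'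
    proof -
      have "V \<inter> V' \<in> F" using int[OF y] V(1) that upUn by (auto simp: F_def)
      then have "card V \<le> card (V \<inter> V')" by (rule V(2))
      then have "V \<inter> V' = V" using fin by (intro card_seteq) auto
      then show ?thesis by blast
    qed
    \<comment> \<open>The least true upset is the union of the cones of its elements, so primeness,
      iterated over a finite union, makes one of these cones true.\<close>
    have prime: "A \<subseteq> Q \<Longrightarrow> (\<Union>w\<in>A. {x\<in>Q. qle w x}) \<in> upsets Q qle \<and>
        (y \<in> E (\<Union>w\<in>A. {x\<in>Q. qle w x}) \<longrightarrow> (\<exists>w\<in>A. y \<in> E {x\<in>Q. qle w x}))" if "finite A" for A
      using that
    proof (induction A rule: finite_induct)
      case empty
      then show ?case using emp[OF y] upQ by simp
    next
      case (insert w A)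
      have wA: "w \<in> Q" "A \<subseteq> Q" using insert.prems by auto
      note c = cone(1)[OF wA(1)] conjunct1[OF insert.IH[OF wA(2)]]
      have "(\<Union>w\<in>insert w A. {x\<in>Q. qle w x}) = {x\<in>Q. qle w x} \<union> (\<Union>w\<in>A. {x\<in>Q. qle w x})" by simp
      then show ?case
        using un[OF y c] upUn(1)[OF c] conjunct2[OF insert.IH[OF wA(2)]] by (simp only: bex_simps) blast
    qed
    have VQ: "V \<subseteq> Q" using V(1) by (auto simp: F_def upsets_def)
    have "(\<Union>w\<in>V. {x\<in>Q. qle w x}) = V"
    proof
      show "(\<Union>w\<in>V. {x\<in>Q. qle w x}) \<subseteq> V" using V(1) by (auto simp: F_def upsets_def)
      show "V \<subseteq> (\<Union>w\<in>V. {x\<in>Q. qle w x})" using VQ rooted_posetD(1)[OF Q] by blast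
    qed
    then obtain w where w: "w \<in> V" "y \<in> E {x\<in>Q. qle w x}"
      using prime[OF fin VQ] V(1) by (auto simp: F_def)
    have wQ: "w \<in> Q" using w VQ by auto
    have "y \<in> E V'" if V': "V' \<in> upsets Q qle" "w \<in> V'" for V'
    proof -
      have "{x\<in>Q. qle w x} \<inter> V' = {x\<in>Q. qle w x}" using V' by (auto simp: upsets_def)
      then show ?thesis using int[OF y cone(1)[OF wQ] V'(1)] w(2) by simp
    qed
    then show ?thesis using wQ least w(1) by (auto simp: F_def)
  qed
  then obtain f where f: "\<And>y. y \<in> W \<Longrightarrow> le x0 y \<Longrightarrow> f y \<in> Q"
    "\<And>y V. y \<in> W \<Longrightarrow> le x0 y \<Longrightarrow> V \<in> upsets Q qle \<Longrightarrow> y \<in> E V \<longleftrightarrow> f y \<in> V"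
    by metis
  show ?thesis
  proof (rule that[of x0 f])
    show "x0 \<in> W" by fact
    have "Q - {r} \<in> upsets Q qle" using Q by (auto simp: rooted_poset_def upsets_def)
    then show "f x0 = r" using f[OF x0(1) refl] x0(3) by blast
    show "f y \<in> Q" if "y \<in> W" "le x0 y" for y using f that by blast
    show "qle (f y) (f z)" if yz: "y \<in> W" "z \<in> W" "le x0 y" "le y z" for y z
    proof -
      have fy: "f y \<in> Q" "qle (f y) (f y)" using f(1)[OF yz(1,3)] qrefl by simp_all
      note c = cone(1)[OF fy(1)]
      have "y \<in> E {x\<in>Q. qle (f y) x}" using f(2)[OF yz(1,3) c] fy by simp
      then have "z \<in> E {x\<in>Q. qle (f y) x}" using up[OF c] yz by (auto simp: up_in_def)
      then show ?thesis using f(2)[OF yz(2) trans[OF yz(3,4)] c] by simp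
    qed
    show "\<exists>z\<in>W. le y z \<and> f z = w" if y: "y \<in> W" "le x0 y" and w: "w \<in> Q" "qle (f y) w" for y w
    proof -
      let ?A = "{x\<in>Q. qle w x}"
      have i: "up_imp Q qle ?A (?A - {w}) \<in> upsets Q qle"
        by (rule upsets_up_imp[OF Q])
      have "f y \<notin> up_imp Q qle ?A (?A - {w})"
        using w qrefl[OF w(1)] by (auto simp: up_imp_def)
      then have "y \<notin> E (up_imp Q qle ?A (?A - {w}))" using f(2)[OF y i] by simp
      then obtain z where z: "z \<in> W" "le y z" "z \<in> E ?A" "z \<notin> E (?A - {w})"
        using imp[OF y cone(1)[OF w(1)] cone(2)[OF w(1)]] by blast
      have xz: "le x0 z" using trans y z by blast
      have "f z \<in> ?A" "f z \<notin> ?A - {w}" using f(2)[OF z(1) xz cone(1)[OF w(1)]] f(2)[OF z(1) xz cone(2)[OF w(1)]] z by auto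
      then show ?thesis using z by blast
    qed
  qed
qed

section \<open>Soundness\<close>

text \<open>One form at a time: if \<open>g\<close> vanishes at the current point, a small move
  towards a point of \<open>C\<close> where it does not vanish repairs this. The move is small
  enough to keep the nonzero signs of \<open>H\<close> and of the forms already treated.\<close>

lemma generic_point:
  assumes H: "finite H" "H \<subseteq> aff" and C: "convex_set C" "x \<in> C"
  shows "finite G \<Longrightarrow> G \<subseteq> aff \<Longrightarrow> (\<And>g. g \<in> G \<Longrightarrow> \<exists>u\<in>C. g u \<noteq> 0)
    \<Longrightarrow> \<exists>y\<in>C. spec H x y \<and> (\<forall>g\<in>G. g y \<noteq> 0)"
proof (induction G rule: finite_induct)
  case (insert g G)
  then obtain y where y: "y \<in> C" "spec H x y" "\<forall>g\<in>G. g y \<noteq> 0" by auto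
  show ?case
  proof (cases "g y = 0")
    case True
    obtain u where u: "u \<in> C" "g u \<noteq> 0" using insert.prems by auto
    have "finite (H \<union> G)" "H \<union> G \<subseteq> aff" using H insert by auto
    then obtain t where t: "0 < t" "t \<le> 1" "spec (H \<union> G) y (mix t y u)" using spec_near by blast
    have "mix t y u \<in> C" using convex_mix[OF C(1) y(1) u(1)] t by simp
    moreover have "spec H x (mix t y u)" using spec_trans[OF y(2) spec_mono[OF _ t(3)]] by simp
    moreover have "g (mix t y u) \<noteq> 0" using aff_mix[of g t y u] insert.prems(1) u(2) t(1) True by simp
    moreover have "\<forall>g\<in>G. g (mix t y u) \<noteq> 0"
      using y(3) t(3) unfolding spec_def by (metis UnI2 sgn_eq_0_iff)
    ultimately show ?thesis by blast
  qed (use y in auto)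
qed (use C in \<open>auto intro!: bexI[of _ x]\<close>)

text \<open>A generic segment meets no two independent hyperplanes in the same point, so
  at most three cells lie above any of its points, whereas the root of Q sees four points.\<close>

lemma no_separating_pmorphism:
  assumes Q: "rooted_poset Q qle r"
    and P: "convex_set P" and H: "finite H" "H \<subseteq> aff"
    and x0: "x0 \<in> P" "f x0 = r"
    and fQ: "\<And>y. y \<in> P \<Longrightarrow> spec H x0 y \<Longrightarrow> f y \<in> Q"
    and mono: "\<And>y z. y \<in> P \<Longrightarrow> z \<in> P \<Longrightarrow> spec H x0 y \<Longrightarrow> spec H y z \<Longrightarrow> qle (f y) (f z)"
    and lift: "\<And>y w. y \<in> P \<Longrightarrow> spec H x0 y \<Longrightarrow> w \<in> Q \<Longrightarrow> qle (f y) w \<Longrightarrow> \<exists>z\<in>P. spec H y z \<and> f z = w"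
    and w: "w1 \<in> Q" "w2 \<in> Q" "w3 \<in> Q" "w1 \<noteq> w2" "w1 \<noteq> w3" "w2 \<noteq> w3" "r \<notin> {w1, w2, w3}"
    and D: "Q - {r} = D1 \<union> D2" "D1 \<inter> D2 = {}" "d1 \<in> D1" "d2 \<in> D2"
      "\<And>x y. x \<in> D1 \<Longrightarrow> y \<in> Q \<Longrightarrow> qle x y \<Longrightarrow> y \<in> D1"
      "\<And>x y. x \<in> D2 \<Longrightarrow> y \<in> Q \<Longrightarrow> qle x y \<Longrightarrow> y \<in> D2"
  shows False
proof -
  define C where "C = {y\<in>P. spec H x0 y}"
  have C: "y \<in> C \<Longrightarrow> f y \<in> Q" "y \<in> C \<Longrightarrow> z \<in> C \<Longrightarrow> spec H y z \<Longrightarrow> qle (f y) (f z)"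
    "y \<in> C \<Longrightarrow> w \<in> Q \<Longrightarrow> qle (f y) w \<Longrightarrow> \<exists>z\<in>C. spec H y z \<and> f z = w" for y z w
    using fQ mono lift by (auto simp: C_def) (meson spec_trans)
  have convC: "convex_set C"
    unfolding convex_set_def
  proof (intro ballI allI impI)
    fix x y and t :: real
    assume xy: "x \<in> C" "y \<in> C" and t: "0 \<le> t \<and> t \<le> 1"
    have "spec H x0 (mix t x y)"
      unfolding spec_def
    proof (intro ballI impI)
      fix g assume g: "g \<in> H" "g x0 \<noteq> 0"
      have s: "sgn (g x) = sgn (g x0)" "sgn (g y) = sgn (g x0)" using xy g by (auto simp: C_def spec_def)
      have m: "g (mix t x y) = (1 - t) * g x + t * g y" using aff_mix g H by blast
      show "sgn (g (mix t x y)) = sgn (g x0)"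
      proof (cases "0 < g x0")
        case True
        then have "0 < g x" "0 < g y" using s by (metis sgn_greater)+
        then have "0 < g (mix t x y)" unfolding m using t
          by (cases "t = 0") (auto intro: add_nonneg_pos)
        then show ?thesis using True by simp
      next
        case False
        then have "g x0 < 0" using g by simp
        moreover have "g x < 0" "g y < 0" using s calculation by (metis sgn_less)+
        moreover have "g (mix t x y) < 0" unfolding m using t calculation(2,3)
          by (cases "t = 0") (auto intro!: add_nonpos_neg simp: mult_nonneg_nonpos mult_pos_neg)
        ultimately show ?thesis by simp
      qed
    qed
    then show "(\<lambda>i. (1 - t) * x i + t * y i) \<in> C"
      using xy t P unfolding C_def convex_set_def mix_def by blast
  qed
  have x0C: "x0 \<in> C" using x0 by (simp add: C_def)
  have rw: "qle r w" if "w \<in> Q" for w using that Q by (auto simp: rooted_poset_def)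
  have anti: "f y = f z" if "y \<in> C" "z \<in> C" "spec H y z" "spec H z y" for y z
    using rooted_posetD(2)[OF Q] C(1,2) that by simp
  have dQ: "d1 \<in> Q" "d2 \<in> Q" using D by auto
  obtain p0 q0 where p0: "p0 \<in> C" "f p0 = d1" and q0: "q0 \<in> C" "f q0 = d2"
    using C(3)[OF x0C dQ(1)] C(3)[OF x0C dQ(2)] rw[OF dQ(1)] rw[OF dQ(2)] x0(2) by blast
  \<comment> \<open>A determinant that vanishes as soon as both forms of \<open>k\<close> are 0 at a
    common point of the segment from \<open>p\<close> to \<open>q\<close>. The set \<open>K\<close>
    consists of the pairs that are linearly independent on \<open>C\<close>.\<close>
  define \<Delta> where "\<Delta> k p q = fst k p * snd k q - fst k q * snd k p"
    for k :: "((nat \<Rightarrow> real) \<Rightarrow> real) \<times> ((nat \<Rightarrow> real) \<Rightarrow> real)" and p q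
  define K where "K = {k \<in> H \<times> H. \<exists>p\<in>C. \<exists>q\<in>C. \<Delta> k p q \<noteq> 0}"
  have finK: "finite K" using H by (simp add: K_def)
  \<comment> \<open>The determinant is affine in each end separately, so genericity is reached one
    end at a time: \<open>q\<close> avoids the zeros belonging to the auxiliary end
    \<open>a k\<close>, then \<open>p\<close> avoids the zeros belonging to this
    \<open>q\<close>.\<close>
  have "\<forall>k\<in>K. \<exists>a. a \<in> C \<and> (\<exists>q\<in>C. \<Delta> k a q \<noteq> 0)"
    unfolding K_def by blast
  from bchoice[OF this] obtain a where a: "\<And>k. k \<in> K \<Longrightarrow> a k \<in> C \<and> (\<exists>q\<in>C. \<Delta> k (a k) q \<noteq> 0)"
    by blast
  have aff1: "(\<lambda>q. \<Delta> k p q) \<in> aff" and aff2: "(\<lambda>p. \<Delta> k p q) \<in> aff" if "k \<in> K" for k p q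
  proof -
    have k: "fst k \<in> aff" "snd k \<in> aff" using that H by (auto simp: K_def)
    show "(\<lambda>q. \<Delta> k p q) \<in> aff" unfolding \<Delta>_def
      using aff_diff[OF aff.scale[OF k(2), of "fst k p"] aff.scale[OF k(1), of "snd k p"]]
      by (simp add: mult.commute)
    show "(\<lambda>p. \<Delta> k p q) \<in> aff" unfolding \<Delta>_def
      using aff_diff[OF aff.scale[OF k(1), of "snd k q"] aff.scale[OF k(2), of "fst k q"]]
      by (simp add: mult.commute)
  qed
  have "\<exists>q\<in>C. spec H q0 q \<and> (\<forall>g\<in>(\<lambda>k. \<Delta> k (a k)) ` K. g q \<noteq> 0)"
    by (rule generic_point[OF H convC q0(1)]) (use finK aff1 a in auto)
  then obtain q where q: "q \<in> C" "spec H q0 q" "\<And>k. k \<in> K \<Longrightarrow> \<Delta> k (a k) q \<noteq> 0" by auto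
  have "\<exists>p\<in>C. spec H p0 p \<and> (\<forall>g\<in>(\<lambda>k p. \<Delta> k p q) ` K. g p \<noteq> 0)"
  proof (rule generic_point[OF H convC p0(1)])
    fix g assume "g \<in> (\<lambda>k p. \<Delta> k p q) ` K"
    then obtain k where "k \<in> K" "g = (\<lambda>p. \<Delta> k p q)" by blast
    then show "\<exists>u\<in>C. g u \<noteq> 0" using a[of k] q(3)[of k] by blast
  qed (use finK aff2 in auto)
  then obtain p where p: "p \<in> C" "spec H p0 p" "\<And>k. k \<in> K \<Longrightarrow> \<Delta> k p q \<noteq> 0" by auto
  have fp: "f p \<in> D1" using D(3,5) C(1)[OF p(1)] C(2)[OF p0(1) p(1,2)] p0(2) by blast
  have fq: "f q \<in> D2" using D(4,6) C(1)[OF q(1)] C(2)[OF q0(1) q(1,2)] q0(2) by blast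
  have segC: "mix t p q \<in> C" if "t \<in> {0..1}" for t using convex_mix[OF convC p(1) q(1)] that by simp
  have nr: "f (mix t p q) \<noteq> r" if t: "t \<in> {0..1}" for t
  proof
    define z where "z = mix t p q"
    assume "f (mix t p q) = r"
    then have z: "f z = r" "z \<in> C" using segC t by (auto simp: z_def)
    \<comment> \<open>Any two forms vanishing at \<open>z\<close> are dependent on \<open>C\<close>,
      since an independent pair has nonzero determinant at the generic ends \<open>p\<close> and
      \<open>q\<close>.\<close>
    have depend: "\<Delta> (g, h) p' q' = 0" if gh: "g \<in> H" "h \<in> H" "g z = 0" "h z = 0" "p' \<in> C" "q' \<in> C" for g h p' q'
    proof (rule ccontr)
      assume "\<not> ?thesis"
      then have "(g, h) \<in> K" using gh by (auto simp: K_def)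
      then have n: "\<Delta> (g, h) p q \<noteq> 0" by (rule p(3))
      have "g z = (1 - t) * g p + t * g q" "h z = (1 - t) * h p + t * h q"
        unfolding z_def using aff_mix gh H by blast+
      then have e: "(1 - t) * g p = - (t * g q)" "(1 - t) * h p = - (t * h q)" using gh by auto
      have "(1 - t) * \<Delta> (g, h) p q = 0"
      proof -
        have "(1 - t) * \<Delta> (g, h) p q = ((1 - t) * g p) * h q - g q * ((1 - t) * h p)" by (simp add: \<Delta>_def algebra_simps)
        also have "\<dots> = (- (t * g q)) * h q - g q * (- (t * h q))" by (simp only: e)
        finally show ?thesis by (simp add: algebra_simps)
      qed
      moreover have "t * \<Delta> (g, h) p q = 0"
      proof -
        have "t * \<Delta> (g, h) p q = g p * (t * h q) - h p * (t * g q)" by (simp add: \<Delta>_def algebra_simps)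
        also have "\<dots> = g p * (- ((1 - t) * h p)) - h p * (- ((1 - t) * g p))" by (simp only: e minus_minus)
        finally show ?thesis by (simp add: algebra_simps)
      qed
      ultimately show False using n by (cases "t = 0") auto
    qed
    define L where "L = {g\<in>H. g z = 0}"
    obtain y1 y2 y3 where y: "y1 \<in> C" "spec H z y1" "f y1 = w1" "y2 \<in> C" "spec H z y2" "f y2 = w2"
      "y3 \<in> C" "spec H z y3" "f y3 = w3"
      using C(3)[OF z(2)] rw z(1) w(1,2,3) by metis
    have same: "f y = f y'" if "y \<in> C" "y' \<in> C" "spec H z y" "spec H z y'" "\<And>g. g \<in> L \<Longrightarrow> sgn (g y) = sgn (g y')" for y y'
    proof -
      have "sgn (g y) = sgn (g y')" if "g \<in> H" for g
        using that \<open>spec H z y\<close> \<open>spec H z y'\<close> \<open>\<And>g. g \<in> L \<Longrightarrow> sgn (g y) = sgn (g y')\<close>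
        unfolding L_def spec_def by (cases "g z = 0") auto
      then show ?thesis using that by (intro anti) (auto simp: spec_def)
    qed
    \<comment> \<open>A single form \<open>g\<close>, not identically 0 on \<open>C\<close>,
      determines all the others vanishing at \<open>z\<close>. Above \<open>z\<close> the value of
      \<open>f\<close> thus depends only on the sign of \<open>g\<close>; sign 0 gives the root,
      which leaves two signs for three values.\<close>
    obtain g u where g: "g \<in> L" "u \<in> C" "g u \<noteq> 0"
    proof (rule ccontr)
      assume "\<not> thesis"
      then have "\<And>g u. g \<in> L \<Longrightarrow> u \<in> C \<Longrightarrow> g u = 0" using that by blast
      then have "g y1 = g y2" if "g \<in> L" for g using that y(1,4) by metis
      then have "f y1 = f y2" by (metis same[OF y(1,4,2,5)])
      then show False using y w by simp
    qed
    have sg: "f y = f y'" if yy: "y \<in> C" "y' \<in> C" "spec H z y" "spec H z y'" "sgn (g y) = sgn (g y')" for y y'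
    proof (rule same[OF yy(1-4)])
      fix h assume h: "h \<in> L"
      have "h y'' = (h u / g u) * g y''" if "y'' \<in> C" for y''
        using depend[of g h u y''] g h that by (simp add: L_def \<Delta>_def field_simps)
      then show "sgn (h y) = sgn (h y')" using yy by (simp add: sgn_mult)
    qed
    have zz: "g z = 0" using g by (simp add: L_def)
    have n0: "g y \<noteq> 0" if "y \<in> C" "spec H z y" "f y \<noteq> r" for y
      using sg[of y z] that z zz by auto
    have "g y1 \<noteq> 0" "g y2 \<noteq> 0" "g y3 \<noteq> 0" using n0 y w by auto
    then have "sgn (g y1) = sgn (g y2) \<or> sgn (g y1) = sgn (g y3) \<or> sgn (g y2) = sgn (g y3)"
      by (auto simp: sgn_if)
    then show False using sg y w by metis
  qed
  have side: "f (mix t p q) \<in> D1 \<or> f (mix t p q) \<in> D2" if "t \<in> {0..1}" for t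
    using C(1)[OF segC[OF that]] nr[OF that] D(1) by blast
  \<comment> \<open>Near each point of the segment one only moves upwards in the preorder, and
    \<open>D1\<close> and \<open>D2\<close> are upsets, so membership in \<open>D1\<close> is
    locally constant; yet the ends lie on different sides.\<close>
  have "(f (mix 0 p q) \<in> D1) = (f (mix 1 p q) \<in> D1)"
  proof (rule connected_local_const[of "{0..1::real}" 0 1 "\<lambda>t. f (mix t p q) \<in> D1"])
    show "\<forall>a\<in>{0..1}. \<forall>\<^sub>F b in at a within {0..1}. (f (mix a p q) \<in> D1) = (f (mix b p q) \<in> D1)"
    proof
      fix a :: real assume a: "a \<in> {0..1}"
      have "\<forall>\<^sub>F b in at a within {0..1}. spec H (mix a p q) (mix b p q) \<and> b \<in> {0..1}"
        using eventually_spec[OF H, of a p q]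
        by (auto simp: eventually_at_filter elim: eventually_mono)
      then show "\<forall>\<^sub>F b in at a within {0..1}. (f (mix a p q) \<in> D1) = (f (mix b p q) \<in> D1)"
      proof (rule eventually_mono)
        fix b assume b: "spec H (mix a p q) (mix b p q) \<and> b \<in> {0..1}"
        then have "qle (f (mix a p q)) (f (mix b p q))" "f (mix b p q) \<in> Q" using C segC a by auto
        then show "(f (mix a p q) \<in> D1) = (f (mix b p q) \<in> D1)"
          using D(2,5,6) side[OF a] by blast
      qed
    qed
  qed auto
  then show False using fp fq D(2) by auto
qed

section \<open>Validity of the two formulas and of the axioms on convex polyhedra\<close>

lemma rooted_fork3: "rooted_poset {0,1,2,3} fork3_le 0"
  by (auto simp: rooted_poset_def fork3_le_def)

lemma rooted_scott: "rooted_poset {0,1,2,3} scott_le 0"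
  by (auto simp: rooted_poset_def scott_le_def)

text \<open>Treats both frames at once: what convexity excludes is a root with three further points
  that fall into two disjoint nonempty upsets.\<close>

lemma jankov_valid:
  assumes P: "polyhedron P" "convex_set P" and v: "\<And>n. v n \<in> Sub_o P"
    and Q: "rooted_poset {0,1,2,3} qle 0"
    and D: "{1,2,3} = D1 \<union> D2" "D1 \<inter> D2 = {}" "d1 \<in> D1" "d2 \<in> D2"
      "\<And>x y. x \<in> D1 \<Longrightarrow> y \<in> {0,1,2,3} \<Longrightarrow> qle x y \<Longrightarrow> y \<in> D1"
      "\<And>x y. x \<in> D2 \<Longrightarrow> y \<in> {0,1,2,3} \<Longrightarrow> qle x y \<Longrightarrow> y \<in> D2"
  shows "eval P v (subst s (jankov {0,1,2,3} qle)) = P"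
proof -
  let ?\<phi> = "subst s (jankov {0,1,2,3} qle)"
  \<comment> \<open>The arrangement must also make the substituted formulas
    \<open>s (set_code V)\<close> persistent.\<close>
  define N where "N = vars ?\<phi> \<union> (\<Union>V\<in>upsets {0,1,2,3} qle. vars (s (set_code V)))"
  have "upsets {0,1,2,3} qle \<subseteq> Pow {0,1,2,3}" by (auto simp: upsets_def)
  then have "finite (upsets {0,1,2,3} qle)" by (rule finite_subset) auto
  then have "finite N" by (simp add: N_def finite_vars)
  from arrangement_exists[where v = v, OF P(1) v this]
  obtain H where H: "finite H" "H \<subseteq> aff" and up: "\<And>n. n \<in> N \<Longrightarrow> up_in P (spec H) (v n)"
    by blast
  have "x \<in> force P (spec H) v ?\<phi>" if x: "x \<in> P" for x
  proof (rule ccontr)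
    assume n: "x \<notin> force P (spec H) v ?\<phi>"
    have upV: "up_in P (spec H) (force P (spec H) v (s (set_code V)))" if "V \<in> upsets {0,1,2,3} qle" for V
      using up that by (intro up_in_force[OF spec_trans]) (auto simp: N_def)
    show False
    proof (rule jankov_refuted[where le = "spec H", OF Q spec_refl spec_trans upV x n])
      fix x0 f
      assume f: "x0 \<in> P" "f x0 = 0"
        "\<And>y. y \<in> P \<Longrightarrow> spec H x0 y \<Longrightarrow> f y \<in> {0,1,2,3}"
        "\<And>y z. y \<in> P \<Longrightarrow> z \<in> P \<Longrightarrow> spec H x0 y \<Longrightarrow> spec H y z \<Longrightarrow> qle (f y) (f z)"
        "\<And>y w. y \<in> P \<Longrightarrow> spec H x0 y \<Longrightarrow> w \<in> {0,1,2,3} \<Longrightarrow> qle (f y) w \<Longrightarrow> \<exists>z\<in>P. spec H y z \<and> f z = w"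
      show False
        by (rule no_separating_pmorphism[OF Q P(2) H f, of 1 2 3 D1 D2 d1 d2])
          (assumption | rule D | simp add: D(1)[symmetric])+
    qed
  qed
  moreover have "eval P v ?\<phi> = force P (spec H) v ?\<phi>"
    by (rule eval_eq_force[OF P H up]) (simp add: N_def)
  moreover have "up_in P (spec H) (force P (spec H) v ?\<phi>)"
    by (rule up_in_force[OF spec_trans]) (auto simp: N_def intro: up)
  ultimately show ?thesis by (auto simp: up_in_def)
qed

lemma force_axioms:
  assumes refl: "\<And>x. le x x" and trans: "\<And>x y z. le x y \<Longrightarrow> le y z \<Longrightarrow> le x z"
    and up: "up_in W le (force W le v a)" "up_in W le (force W le v b)" "up_in W le (force W le v c)"
  shows "W \<subseteq> force W le v (Imp a (Imp b a))"
    "W \<subseteq> force W le v (Imp (Imp a (Imp b c)) (Imp (Imp a b) (Imp a c)))"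
    "W \<subseteq> force W le v (Imp (Conj a b) a)"
    "W \<subseteq> force W le v (Imp (Conj a b) b)"
    "W \<subseteq> force W le v (Imp a (Imp b (Conj a b)))"
    "W \<subseteq> force W le v (Imp a (Disj a b))"
    "W \<subseteq> force W le v (Imp b (Disj a b))"
    "W \<subseteq> force W le v (Imp (Imp a c) (Imp (Imp b c) (Imp (Disj a b) c)))"
    "W \<subseteq> force W le v (Imp Bot a)"
proof -
  define A B C where "A = force W le v a" "B = force W le v b" "C = force W le v c"
  have up: "y \<in> A" if "x \<in> A" "y \<in> W" "le x y" for x y using up(1) that by (auto simp: A_B_C_def up_in_def)
  moreover have "y \<in> B" if "x \<in> B" "y \<in> W" "le x y" for x y using assms(4) that by (auto simp: A_B_C_def up_in_def)
  moreover have "y \<in> C" if "x \<in> C" "y \<in> W" "le x y" for x y using assms(5) that by (auto simp: A_B_C_def up_in_def)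
  ultimately show "W \<subseteq> force W le v (Imp a (Imp b a))"
    "W \<subseteq> force W le v (Imp (Imp a (Imp b c)) (Imp (Imp a b) (Imp a c)))"
    "W \<subseteq> force W le v (Imp (Conj a b) a)"
    "W \<subseteq> force W le v (Imp (Conj a b) b)"
    "W \<subseteq> force W le v (Imp a (Imp b (Conj a b)))"
    "W \<subseteq> force W le v (Imp a (Disj a b))"
    "W \<subseteq> force W le v (Imp b (Disj a b))"
    "W \<subseteq> force W le v (Imp (Imp a c) (Imp (Imp b c) (Imp (Disj a b) c)))"
    "W \<subseteq> force W le v (Imp Bot a)"
    unfolding force.simps A_B_C_def[symmetric] by (simp_all add: subset_iff) (metis refl trans)+
qed

lemma eval_axioms:
  assumes P: "polyhedron P" "convex_set P" and v: "\<And>n. v n \<in> Sub_o P"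
    and \<phi>: "\<phi> \<in> {Imp a (Imp b a), Imp (Imp a (Imp b c)) (Imp (Imp a b) (Imp a c)),
      Imp (Conj a b) a, Imp (Conj a b) b, Imp a (Imp b (Conj a b)), Imp a (Disj a b), Imp b (Disj a b),
      Imp (Imp a c) (Imp (Imp b c) (Imp (Disj a b) c)), Imp Bot a}"
  shows "eval P v \<phi> = P"
proof -
  have "finite (vars a \<union> vars b \<union> vars c)" by (simp add: finite_vars)
  from arrangement_exists[where v = v, OF P(1) v this]
  obtain H where H: "finite H" "H \<subseteq> aff"
    and up: "\<And>n. n \<in> vars a \<union> vars b \<union> vars c \<Longrightarrow> up_in P (spec H) (v n)"
    by blast
  have abc: "up_in P (spec H) (force P (spec H) v \<psi>)" if "vars \<psi> \<subseteq> vars a \<union> vars b \<union> vars c" for \<psi>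
    by (rule up_in_force[OF spec_trans up]) (use that in blast)+
  have "up_in P (spec H) (force P (spec H) v a)" "up_in P (spec H) (force P (spec H) v b)"
    "up_in P (spec H) (force P (spec H) v c)"
    by (rule abc; blast)+
  note ax = force_axioms[of "spec H" P v a b c, OF spec_refl spec_trans this]
  from \<phi> have "P \<subseteq> force P (spec H) v \<phi>"
    by (elim insertE emptyE) (simp_all only: ax)
  moreover have sub: "vars \<phi> \<subseteq> vars a \<union> vars b \<union> vars c" using \<phi> by auto
  moreover have "eval P v \<phi> = force P (spec H) v \<phi>"
    using eval_eq_force[OF P H] up sub by blast
  ultimately show ?thesis using abc[OF sub] by (auto simp: up_in_def)
qed

lemma eval_subset: "(\<And>n. v n \<in> Sub_o P) \<Longrightarrow> eval P v \<phi> \<subseteq> P"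
  by (induction \<phi>) (auto simp: Sub_o_def)

lemma PL_sound:
  assumes P: "polyhedron P" "convex_set P" and v: "\<And>n. v n \<in> Sub_o P"
  shows "\<phi> \<in> PL \<Longrightarrow> eval P v \<phi> = P"
proof (induction rule: PL.induct)
  case (fork3 s)
  show ?case unfolding chi_fork3_def
    by (rule jankov_valid[where v = v, OF P v rooted_fork3, of "{1}" "{2,3}" 1 2]) (auto simp: fork3_le_def)
next
  case (scott s)
  show ?case unfolding chi_scott_def
    by (rule jankov_valid[where v = v, OF P v rooted_scott, of "{1,2}" "{3}" 1 3]) (auto simp: scott_le_def)
next
  case (mp a b)
  then have U: "\<Union> {U \<in> Sub_o P. U \<inter> P \<subseteq> eval P v b} = P" by simp
  have "x \<in> eval P v b" if "x \<in> P" for x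
  proof -
    from U that obtain U where "x \<in> U" "U \<inter> P \<subseteq> eval P v b" by blast
    then show ?thesis using that by blast
  qed
  then show ?case using eval_subset[of v P b, OF v] by blast
qed (rule eval_axioms[where v = v, OF P v], blast)+

section \<open>Prime theories\<close>

definition thy :: "fm set \<Rightarrow> bool" where
  "thy T \<longleftrightarrow> PL \<subseteq> T \<and> (\<forall>a b. a \<in> T \<longrightarrow> Imp a b \<in> T \<longrightarrow> b \<in> T)"

definition prime_thy :: "fm set \<Rightarrow> bool" where
  "prime_thy T \<longleftrightarrow> thy T \<and> Bot \<notin> T \<and> (\<forall>a b. Disj a b \<in> T \<longrightarrow> a \<in> T \<or> b \<in> T)"

definition max_thy :: "fm set \<Rightarrow> bool" where
  "max_thy A \<longleftrightarrow> prime_thy A \<and> (\<forall>Z. thy Z \<longrightarrow> Bot \<notin> Z \<longrightarrow> A \<subseteq> Z \<longrightarrow> Z = A)"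

abbreviation Neg :: "fm \<Rightarrow> fm" where "Neg a \<equiv> Imp a Bot"

lemma PL_imp_refl: "Imp a a \<in> PL"
  using PL.mp[OF PL.ax1 PL.mp[OF PL.ax1 PL.ax2]] .

lemma thy_PL: "thy PL"
  by (auto simp: thy_def intro: PL.mp)

lemma thy_mp: "thy T \<Longrightarrow> Imp a b \<in> T \<Longrightarrow> a \<in> T \<Longrightarrow> b \<in> T"
  unfolding thy_def by blast

lemma thy_PL_subset: "thy T \<Longrightarrow> PL \<subseteq> T"
  unfolding thy_def by (rule conjunct1)

lemma thy_ax: "thy T \<Longrightarrow> a \<in> PL \<Longrightarrow> a \<in> T"
  using thy_PL_subset by blast

text \<open>Deduction theorem: \<open>{b. Imp a b \<in> T}\<close> is the theory generated by
  \<open>T\<close> and \<open>a\<close>.\<close>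

lemma thy_extend:
  assumes T: "thy T"
  shows "thy {b. Imp a b \<in> T}" "T \<subseteq> {b. Imp a b \<in> T}" "a \<in> {b. Imp a b \<in> T}"
proof -
  show sub: "T \<subseteq> {b. Imp a b \<in> T}"
    by (intro subsetI CollectI) (rule thy_mp[OF T thy_ax[OF T PL.ax1]])
  show "a \<in> {b. Imp a b \<in> T}" using thy_ax[OF T PL_imp_refl] by simp
  show "thy {b. Imp a b \<in> T}"
    unfolding thy_def mem_Collect_eq
  proof (intro conjI allI impI)
    show "PL \<subseteq> {b. Imp a b \<in> T}" by (rule order_trans[OF thy_PL_subset[OF T] sub])
    show "Imp a c \<in> T" if "Imp a b \<in> T" "Imp a (Imp b c) \<in> T" for b c
      using thy_mp[OF T thy_mp[OF T thy_ax[OF T PL.ax2] that(2)] that(1)] .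
  qed
qed

lemma thy_Union:
  assumes "\<C> \<noteq> {}" "subset.chain UNIV \<C>" "\<And>T. T \<in> \<C> \<Longrightarrow> thy T"
  shows "thy (\<Union>\<C>)"
  unfolding thy_def
proof (intro conjI allI impI)
  obtain T where "T \<in> \<C>" using assms(1) by blast
  then show "PL \<subseteq> \<Union>\<C>" using thy_PL_subset[OF assms(3)] by blast
  fix a b assume "a \<in> \<Union>\<C>" "Imp a b \<in> \<Union>\<C>"
  then obtain T T' where T: "T \<in> \<C>" "a \<in> T" "T' \<in> \<C>" "Imp a b \<in> T'" by blast
  then have "T \<subseteq> T' \<or> T' \<subseteq> T" using assms(2) by (auto simp: subset.chain_def)
  then show "b \<in> \<Union>\<C>"
  proof
    assume "T \<subseteq> T'"
    then have "b \<in> T'" using thy_mp[OF assms(3)[OF T(3)] T(4)] T(2) by blast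
    then show ?thesis using T(3) by blast
  next
    assume "T' \<subseteq> T"
    from thy_mp[OF assms(3)[OF T(1)] subsetD[OF this T(4)] T(2)] have "b \<in> T" .
    then show ?thesis using T(1) by blast
  qed
qed

text \<open>Lindenbaum's lemma by Zorn. A formula outside a maximal \<open>Y\<close> implies
  \<open>b\<close> in \<open>Y\<close>, so proof by cases makes \<open>Y\<close> prime. Maximality
  is part of the conclusion because the case \<open>b = Bot\<close> has to produce maximal
  theories.\<close>

lemma thy_maximal_avoiding:
  assumes T: "thy T" and b: "b \<notin> T"
  obtains Y where "prime_thy Y" "T \<subseteq> Y" "b \<notin> Y" "\<And>Z. thy Z \<Longrightarrow> b \<notin> Z \<Longrightarrow> Y \<subseteq> Z \<Longrightarrow> Z = Y"
proof -
  let ?A = "{Z. thy Z \<and> T \<subseteq> Z \<and> b \<notin> Z}"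
  have "\<exists>M\<in>?A. \<forall>X\<in>?A. M \<subseteq> X \<longrightarrow> X = M"
  proof (rule subset_Zorn_nonempty)
    show "?A \<noteq> {}" using T b by blast
    fix \<C> assume "\<C> \<noteq> {}" and c: "subset.chain ?A \<C>"
    have A: "Z \<in> ?A" if "Z \<in> \<C>" for Z using that c unfolding subset.chain_def by blast
    have "subset.chain UNIV \<C>" using c by (simp add: subset.chain_def)
    then have "thy (\<Union>\<C>)" using \<open>\<C> \<noteq> {}\<close> A by (intro thy_Union) simp_all
    moreover have "T \<subseteq> \<Union>\<C>" "b \<notin> \<Union>\<C>" using \<open>\<C> \<noteq> {}\<close> A by blast+
    ultimately show "\<Union>\<C> \<in> ?A" by simp
  qed
  then obtain Y where "Y \<in> ?A" and max: "\<forall>X\<in>?A. Y \<subseteq> X \<longrightarrow> X = Y" by (rule bexE)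
  then have Y: "thy Y" "T \<subseteq> Y" "b \<notin> Y" by simp_all
  have Y4: "Z = Y" if "thy Z" "b \<notin> Z" "Y \<subseteq> Z" for Z
    using max that order_trans[OF Y(2) that(3)] by simp
  have in_b: "Imp c b \<in> Y" if "c \<notin> Y" for c
  proof (rule ccontr)
    assume "Imp c b \<notin> Y"
    then have "{d. Imp c d \<in> Y} = Y"
      using thy_extend(1,2)[OF Y(1), of c] by (intro Y4) simp_all
    then show False using thy_extend(3)[OF Y(1), of c] that by blast
  qed
  have "c \<in> Y \<or> d \<in> Y" if cd: "Disj c d \<in> Y" for c d
  proof (rule ccontr)
    assume "\<not> (c \<in> Y \<or> d \<in> Y)"
    then have cb: "Imp c b \<in> Y" and db: "Imp d b \<in> Y" using in_b by blast+
    have "b \<in> Y"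
      by (rule thy_mp[OF Y(1) thy_mp[OF Y(1) thy_mp[OF Y(1) thy_ax[OF Y(1) PL.ax8] cb] db] cd])
    then show False using Y(3) by simp
  qed
  moreover have "Bot \<notin> Y"
  proof
    assume "Bot \<in> Y"
    from thy_mp[OF Y(1) thy_ax[OF Y(1) PL.ax9] this] have "b \<in> Y" .
    then show False using Y(3) by simp
  qed
  ultimately have "prime_thy Y" using Y(1) by (simp add: prime_thy_def)
  then show ?thesis by (rule that[OF _ Y(2,3) Y4])
qed

lemma prime_thyD: "prime_thy T \<Longrightarrow> thy T" "prime_thy T \<Longrightarrow> Bot \<notin> T"
  by (simp_all add: prime_thy_def)

lemma max_prime: "max_thy A \<Longrightarrow> prime_thy A"
  by (simp add: max_thy_def)

lemma max_thy_exists: "thy T \<Longrightarrow> Bot \<notin> T \<Longrightarrow> \<exists>A. max_thy A \<and> T \<subseteq> A"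
  by (rule thy_maximal_avoiding[of T Bot]) (simp_all add: max_thy_def, blast)

lemma mem_Conj:
  assumes "prime_thy T" shows "Conj a b \<in> T \<longleftrightarrow> a \<in> T \<and> b \<in> T"
proof -
  have T: "thy T" using assms by (rule prime_thyD)
  show ?thesis
    using thy_mp[OF T thy_ax[OF T PL.ax3[of a b]]] thy_mp[OF T thy_ax[OF T PL.ax4[of a b]]]
      thy_mp[OF T thy_mp[OF T thy_ax[OF T PL.ax5[of a b]]]] by blast
qed

lemma mem_Disj:
  assumes "prime_thy T" shows "Disj a b \<in> T \<longleftrightarrow> a \<in> T \<or> b \<in> T"
proof -
  have T: "thy T" using assms by (rule prime_thyD)
  show ?thesis
    using thy_mp[OF T thy_ax[OF T PL.ax6[of a b]]] thy_mp[OF T thy_ax[OF T PL.ax7[of b a]]]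
      conjunct2[OF conjunct2[OF assms[unfolded prime_thy_def]]] by blast
qed

lemma mem_Imp:
  assumes T: "prime_thy T" shows "Imp a b \<in> T \<longleftrightarrow> (\<forall>Y. prime_thy Y \<longrightarrow> T \<subseteq> Y \<longrightarrow> a \<in> Y \<longrightarrow> b \<in> Y)"
proof
  assume "Imp a b \<in> T"
  then show "\<forall>Y. prime_thy Y \<longrightarrow> T \<subseteq> Y \<longrightarrow> a \<in> Y \<longrightarrow> b \<in> Y"
    using thy_mp[OF prime_thyD(1), of _ a b] by blast
next
  assume R: "\<forall>Y. prime_thy Y \<longrightarrow> T \<subseteq> Y \<longrightarrow> a \<in> Y \<longrightarrow> b \<in> Y"
  note e = thy_extend[OF prime_thyD(1)[OF T], of a]
  show "Imp a b \<in> T"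
  proof (rule ccontr)
    assume "Imp a b \<notin> T"
    then have "b \<notin> {b. Imp a b \<in> T}" by simp
    then obtain Y where "prime_thy Y" "{b. Imp a b \<in> T} \<subseteq> Y" "b \<notin> Y"
      using thy_maximal_avoiding[OF e(1)] by metis
    then show False using R e(2,3) by blast
  qed
qed

lemma mem_Iff:
  assumes "prime_thy T"
  shows "Iff a b \<in> T \<longleftrightarrow> (\<forall>Y. prime_thy Y \<longrightarrow> T \<subseteq> Y \<longrightarrow> (a \<in> Y \<longleftrightarrow> b \<in> Y))"
  unfolding Iff_def mem_Conj[OF assms] mem_Imp[OF assms] by blast

lemma mem_max_Neg:
  assumes A: "max_thy A" shows "Neg a \<in> A \<longleftrightarrow> a \<notin> A"
proof
  note T = prime_thyD[OF max_prime[OF A]]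
  show "Neg a \<in> A \<Longrightarrow> a \<notin> A" using T(2) thy_mp[OF T(1), of a Bot] by blast
  assume "a \<notin> A"
  show "Neg a \<in> A"
  proof (rule ccontr)
    assume "Neg a \<notin> A"
    then have "{d. Imp a d \<in> A} = A"
      using A thy_extend(1,2)[OF T(1), of a] unfolding max_thy_def by blast
    then show False using thy_extend(3)[OF T(1), of a] \<open>a \<notin> A\<close> by blast
  qed
qed

text \<open>Prime theories extend to maximal ones, and these behave classically, so double negation
  speaks of the maximal theories only. This is what makes conditions on the maximal types above a
  theory definable.\<close>

lemma mem_Neg_Neg:
  assumes X: "prime_thy X" shows "Neg (Neg a) \<in> X \<longleftrightarrow> (\<forall>A. max_thy A \<longrightarrow> X \<subseteq> A \<longrightarrow> a \<in> A)"
proof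
  assume "Neg (Neg a) \<in> X"
  then show "\<forall>A. max_thy A \<longrightarrow> X \<subseteq> A \<longrightarrow> a \<in> A" using mem_max_Neg by blast
next
  assume R: "\<forall>A. max_thy A \<longrightarrow> X \<subseteq> A \<longrightarrow> a \<in> A"
  have "Bot \<in> Y" if Y: "prime_thy Y" "X \<subseteq> Y" "Neg a \<in> Y" for Y
  proof -
    obtain A where A: "max_thy A" "Y \<subseteq> A" using max_thy_exists prime_thyD Y(1) by blast
    then have "a \<in> A" "Neg a \<in> A" using R Y by auto
    then show ?thesis using mem_max_Neg A by blast
  qed
  then show "Neg (Neg a) \<in> X" unfolding mem_Imp[OF X] by blast
qed

lemma finite_disjunction:
  "finite I \<Longrightarrow> \<exists>d. \<forall>Y. prime_thy Y \<longrightarrow> (d \<in> Y \<longleftrightarrow> (\<exists>i\<in>I. \<beta> i \<in> Y))"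
proof (induction I rule: finite_induct)
  case empty
  show ?case by (rule exI[of _ Bot]) (simp add: prime_thyD(2))
next
  case (insert i I)
  then obtain d where "\<forall>Y. prime_thy Y \<longrightarrow> (d \<in> Y \<longleftrightarrow> (\<exists>i\<in>I. \<beta> i \<in> Y))" by blast
  then show ?case by (intro exI[of _ "Disj (\<beta> i) d"]) (auto simp: mem_Disj)
qed

lemma Top_in_thy: "thy T \<Longrightarrow> Top \<in> T"
  unfolding Top_def by (rule thy_ax[OF _ PL_imp_refl])

lemma finite_conjunction:
  "finite I \<Longrightarrow> \<exists>d. \<forall>Y. prime_thy Y \<longrightarrow> (d \<in> Y \<longleftrightarrow> (\<forall>i\<in>I. \<beta> i \<in> Y))"
proof (induction I rule: finite_induct)
  case empty
  show ?case by (rule exI[of _ Top]) (simp add: prime_thyD(1) Top_in_thy)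
next
  case (insert i I)
  then obtain d where "\<forall>Y. prime_thy Y \<longrightarrow> (d \<in> Y \<longleftrightarrow> (\<forall>i\<in>I. \<beta> i \<in> Y))" by blast
  then show ?case by (intro exI[of _ "Conj (\<beta> i) d"]) (auto simp: mem_Conj)
qed

text \<open>Here \<beta> w defines the principal upset of w.\<close>

lemma jankov_excludes:
  assumes Q: "rooted_poset Q qle r" and Z: "prime_thy Z"
    and ax: "\<And>s. subst s (jankov Q qle) \<in> PL"
    and g: "\<And>Y. prime_thy Y \<Longrightarrow> Z \<subseteq> Y \<Longrightarrow> g Y \<in> Q" "g Z = r"
    and \<beta>: "\<And>Y w. prime_thy Y \<Longrightarrow> Z \<subseteq> Y \<Longrightarrow> w \<in> Q \<Longrightarrow> \<beta> w \<in> Y \<longleftrightarrow> qle w (g Y)"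
    and lift: "\<And>Y w. prime_thy Y \<Longrightarrow> Z \<subseteq> Y \<Longrightarrow> w \<in> Q \<Longrightarrow> qle (g Y) w \<Longrightarrow> \<exists>Y'. prime_thy Y' \<and> Y \<subseteq> Y' \<and> g Y' = w"
  shows False
proof -
  have finQ: "finite Q" using Q by (simp add: rooted_poset_def)
  have fin: "finite V" if "V \<in> upsets Q qle" for V
    using that finQ by (auto simp: upsets_def intro: finite_subset)
  have "\<exists>d. \<forall>Y. prime_thy Y \<longrightarrow> (d \<in> Y \<longleftrightarrow> (\<exists>w\<in>V. \<beta> w \<in> Y))" if "finite V" for V
    using finite_disjunction[OF that] .
  then have "\<forall>V\<in>{V. finite V}. \<exists>d. \<forall>Y. prime_thy Y \<longrightarrow> (d \<in> Y \<longleftrightarrow> (\<exists>w\<in>V. \<beta> w \<in> Y))" by blast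
  from bchoice[OF this] obtain e where
    "\<forall>V\<in>{V. finite V}. \<forall>Y. prime_thy Y \<longrightarrow> (e V \<in> Y \<longleftrightarrow> (\<exists>w\<in>V. \<beta> w \<in> Y))" by (rule exE)
  then have e: "e V \<in> Y \<longleftrightarrow> (\<exists>w\<in>V. \<beta> w \<in> Y)" if "finite V" "prime_thy Y" for V Y
    using that by simp
  \<comment> \<open>The variable of an upset \<open>V\<close> becomes the disjunction of the
    formulas \<open>\<beta> w\<close> for \<open>w\<close> in \<open>V\<close>, which belongs to
    \<open>Y\<close> iff \<open>g Y\<close> lies in \<open>V\<close>.\<close>
  define s where "s n = e (code_set n)" for n
  have sV: "subst s (pvar V) \<in> Y \<longleftrightarrow> g Y \<in> V" if V: "V \<in> upsets Q qle" and Y: "prime_thy Y" "Z \<subseteq> Y" for V Y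
  proof -
    have "subst s (pvar V) = e V" using code_set_code[OF fin[OF V]] by (simp add: pvar_def s_def)
    moreover have "V \<subseteq> Q" using V by (auto simp: upsets_def)
    then have "(\<exists>w\<in>V. \<beta> w \<in> Y) \<longleftrightarrow> (\<exists>w\<in>V. qle w (g Y))" using \<beta>[OF Y] by blast
    moreover have "(\<exists>w\<in>V. qle w (g Y)) \<longleftrightarrow> g Y \<in> V"
      using V g(1)[OF Y] rooted_posetD(1)[OF Q] by (auto simp: upsets_def)
    ultimately show ?thesis using e[OF fin[OF V] Y(1)] by simp
  qed
  have mono: "qle (g Y) (g Y')" if "prime_thy Y" "prime_thy Y'" "Z \<subseteq> Y" "Y \<subseteq> Y'" for Y Y'
  proof -
    have "\<beta> (g Y) \<in> Y" using \<beta>[OF that(1,3) g(1)[OF that(1,3)]] rooted_posetD(1)[OF Q g(1)[OF that(1,3)]] by simp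
    then show ?thesis using \<beta>[OF that(2) _ g(1)[OF that(1,3)]] that by auto
  qed
  obtain L where L: "jankov Q qle = Imp (Conjs L) (pvar (Q - {r}))" "set L = diagram Q qle"
    using jankov_unfold[OF Q] by blast
  have "subst s a \<in> Z" if "a \<in> diagram Q qle" for a
    using that unfolding diagram_def
  proof (elim insertE UN_E emptyE)
    assume a: "a = Iff (pvar {}) Bot"
    have E: "{} \<in> upsets Q qle" by (simp add: upsets_def)
    have "subst s a = Iff (subst s (pvar {})) Bot" by (simp add: a Iff_def)
    then show ?thesis using sV[OF E] prime_thyD(2) by (simp add: mem_Iff[OF Z])
  next
    fix A B assume A: "A \<in> upsets Q qle" and B: "B \<in> upsets Q qle"
    have AB: "A \<inter> B \<in> upsets Q qle" "A \<union> B \<in> upsets Q qle" using A B by (auto simp: upsets_def)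
    { assume a: "a = Iff (pvar (A \<inter> B)) (Conj (pvar A) (pvar B))"
      have "subst s a = Iff (subst s (pvar (A \<inter> B))) (Conj (subst s (pvar A)) (subst s (pvar B)))"
        by (simp add: a Iff_def)
      then show ?thesis using sV[OF A] sV[OF B] sV[OF AB(1)] by (auto simp: mem_Iff[OF Z] mem_Conj) }
    { assume a: "a = Iff (pvar (A \<union> B)) (Disj (pvar A) (pvar B))"
      have "subst s a = Iff (subst s (pvar (A \<union> B))) (Disj (subst s (pvar A)) (subst s (pvar B)))"
        by (simp add: a Iff_def)
      then show ?thesis using sV[OF A] sV[OF B] sV[OF AB(2)] by (auto simp: mem_Iff[OF Z] mem_Disj) }
    { assume a: "a = Iff (pvar (up_imp Q qle A B)) (Imp (pvar A) (pvar B))"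
      have "subst s (pvar (up_imp Q qle A B)) \<in> Y \<longleftrightarrow> Imp (subst s (pvar A)) (subst s (pvar B)) \<in> Y"
        if Y: "prime_thy Y" "Z \<subseteq> Y" for Y
      proof -
        have "Imp (subst s (pvar A)) (subst s (pvar B)) \<in> Y \<longleftrightarrow>
            (\<forall>Y'. prime_thy Y' \<longrightarrow> Y \<subseteq> Y' \<longrightarrow> g Y' \<in> A \<longrightarrow> g Y' \<in> B)"
          unfolding mem_Imp[OF Y(1)] using sV[OF A] sV[OF B] Y(2) by (meson order_trans)
        also have "\<dots> \<longleftrightarrow> g Y \<in> up_imp Q qle A B"
        proof
          assume l: "\<forall>Y'. prime_thy Y' \<longrightarrow> Y \<subseteq> Y' \<longrightarrow> g Y' \<in> A \<longrightarrow> g Y' \<in> B"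
          show "g Y \<in> up_imp Q qle A B"
            unfolding up_imp_def using g(1)[OF Y] l lift[OF Y] by blast
        next
          assume u: "g Y \<in> up_imp Q qle A B"
          show "\<forall>Y'. prime_thy Y' \<longrightarrow> Y \<subseteq> Y' \<longrightarrow> g Y' \<in> A \<longrightarrow> g Y' \<in> B"
          proof (intro allI impI)
            fix Y' assume Y': "prime_thy Y'" "Y \<subseteq> Y'" "g Y' \<in> A"
            have "qle (g Y) (g Y')" "g Y' \<in> Q"
              using mono[OF Y(1) Y'(1) Y(2) Y'(2)] g(1)[OF Y'(1)] Y Y' by auto
            then show "g Y' \<in> B" using u Y'(3) unfolding up_imp_def by blast
          qed
        qed
        also have "\<dots> \<longleftrightarrow> subst s (pvar (up_imp Q qle A B)) \<in> Y"
          using sV[OF upsets_up_imp[OF Q] Y] by simp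
        finally show ?thesis by simp
      qed
      moreover have "subst s a = Iff (subst s (pvar (up_imp Q qle A B))) (Imp (subst s (pvar A)) (subst s (pvar B)))"
        by (simp add: a Iff_def)
      ultimately show ?thesis by (simp add: mem_Iff[OF Z]) }
  qed
  then have "\<forall>a\<in>set L. subst s a \<in> Z" using L(2) by simp
  then have "subst s (Conjs L) \<in> Z"
    using Top_in_thy[OF prime_thyD(1)[OF Z]]
    by (induction L) (auto simp: Conjs_def mem_Conj[OF Z] Top_def)
  moreover have "Imp (subst s (Conjs L)) (subst s (pvar (Q - {r}))) \<in> Z"
    using thy_ax[OF prime_thyD(1)[OF Z] ax[of s]] by (simp add: L(1))
  ultimately have "subst s (pvar (Q - {r})) \<in> Z" using thy_mp[OF prime_thyD(1)[OF Z]] by blast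
  moreover have "Q - {r} \<in> upsets Q qle"
  proof -
    have "y \<noteq> r" if "x \<in> Q" "x \<noteq> r" "qle x y" for x y
      using rooted_posetD(2)[OF Q, of x r] that Q unfolding rooted_poset_def by blast
    then show ?thesis unfolding upsets_def by blast
  qed
  ultimately show False using sV[of "Q - {r}" Z] Z g(2) by simp
qed

section \<open>Types over a finite set of formulas\<close>

definition subcl :: "fm set \<Rightarrow> bool" where
  "subcl S \<longleftrightarrow> (\<forall>a b. (Imp a b \<in> S \<or> Conj a b \<in> S \<or> Disj a b \<in> S) \<longrightarrow> a \<in> S \<and> b \<in> S)"

text \<open>The finite stand-in for the maximal points above \<open>X\<close>.\<close>

definition mtypes :: "fm set \<Rightarrow> fm set \<Rightarrow> fm set set" where
  "mtypes S X = {A \<inter> S | A. max_thy A \<and> X \<subseteq> A}"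

text \<open>For prime \<open>Y\<close> and \<open>m \<subseteq> S\<close> this is stronger than
  having trace \<open>m\<close>: thanks to the negations it persists to extensions, fixes the trace
  of all of them, and for finite \<open>S\<close> is expressed by a formula.\<close>

definition decides :: "fm set \<Rightarrow> fm set \<Rightarrow> fm set \<Rightarrow> bool" where
  "decides S Y m \<longleftrightarrow> m \<subseteq> Y \<and> (\<forall>\<sigma>\<in>S - m. Neg \<sigma> \<in> Y)"

lemma mtypes_antimono: "X \<subseteq> Y \<Longrightarrow> mtypes S Y \<subseteq> mtypes S X"
  unfolding mtypes_def by blast

lemma mtypes_nonempty: "prime_thy Y \<Longrightarrow> mtypes S Y \<noteq> {}"
  using max_thy_exists[of Y] prime_thyD unfolding mtypes_def by blast

lemma mtypes_Pow: "mtypes S Y \<subseteq> Pow S"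
  unfolding mtypes_def by blast

lemma max_thy_eq: "max_thy A \<Longrightarrow> prime_thy Y \<Longrightarrow> A \<subseteq> Y \<Longrightarrow> Y = A"
  unfolding max_thy_def using prime_thyD by blast

lemma mtypes_max: "max_thy A \<Longrightarrow> mtypes S A = {A \<inter> S}"
  unfolding mtypes_def using max_thy_eq max_prime by blast

lemma decides_mono: "decides S Y m \<Longrightarrow> Y \<subseteq> Y' \<Longrightarrow> decides S Y' m"
  unfolding decides_def by blast

lemma decides_type:
  assumes "decides S Y m" "prime_thy Y" "m \<subseteq> S" shows "Y \<inter> S = m"
proof -
  have "\<sigma> \<notin> Y" if "\<sigma> \<in> S - m" for \<sigma>
    using assms(1) that thy_mp[OF prime_thyD(1)[OF assms(2)], of \<sigma> Bot] prime_thyD(2)[OF assms(2)]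
    unfolding decides_def by blast
  then show ?thesis using assms(1,3) unfolding decides_def by blast
qed

lemma decides_max: "max_thy A \<Longrightarrow> decides S A (A \<inter> S)"
  unfolding decides_def using mem_max_Neg by blast

lemma decides_mtypes:
  assumes "decides S Y m" "prime_thy Y" "m \<subseteq> S" shows "mtypes S Y = {m}"
proof -
  have "A \<inter> S = m" if "max_thy A" "Y \<subseteq> A" for A
    using decides_type[OF decides_mono[OF assms(1) that(2)] max_prime[OF that(1)] assms(3)] .
  then have "mtypes S Y \<subseteq> {m}" unfolding mtypes_def by blast
  then show ?thesis using mtypes_nonempty[OF assms(2)] by blast
qed

lemma deciding_formula:
  assumes S: "finite S" and U: "U \<subseteq> Pow S"
  shows "\<exists>d. \<forall>Y. prime_thy Y \<longrightarrow> (d \<in> Y \<longleftrightarrow> (\<exists>m\<in>U. decides S Y m))"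
proof -
  have "\<exists>k. \<forall>Y. prime_thy Y \<longrightarrow> (k \<in> Y \<longleftrightarrow> decides S Y m)" if m: "m \<subseteq> S" for m
  proof -
    obtain k l where "\<forall>Y. prime_thy Y \<longrightarrow> (k \<in> Y \<longleftrightarrow> (\<forall>\<sigma>\<in>m. \<sigma> \<in> Y))"
      "\<forall>Y. prime_thy Y \<longrightarrow> (l \<in> Y \<longleftrightarrow> (\<forall>\<sigma>\<in>S - m. Neg \<sigma> \<in> Y))"
      using finite_conjunction[of m "\<lambda>\<sigma>. \<sigma>"] finite_conjunction[of "S - m" Neg] S m finite_subset by blast
    then have "\<forall>Y. prime_thy Y \<longrightarrow> (Conj k l \<in> Y \<longleftrightarrow> decides S Y m)"
      by (auto simp: mem_Conj decides_def)
    then show ?thesis by blast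
  qed
  then have "\<forall>m\<in>U. \<exists>k. \<forall>Y. prime_thy Y \<longrightarrow> (k \<in> Y \<longleftrightarrow> decides S Y m)" using U by blast
  from bchoice[OF this] obtain k where
    k: "\<forall>m\<in>U. \<forall>Y. prime_thy Y \<longrightarrow> (k m \<in> Y \<longleftrightarrow> decides S Y m)" by (rule exE)
  have "finite U" using S U by (meson finite_Pow_iff finite_subset)
  from finite_disjunction[OF this, of k] show ?thesis using k by simp
qed

text \<open>A maximal theory decides its own trace and no other type, so under a double negation
  deciding a type of \<open>U\<close> becomes a condition on the maximal types alone.\<close>

lemma mem_Neg_Neg_deciding:
  assumes d: "\<forall>Y. prime_thy Y \<longrightarrow> (d \<in> Y \<longleftrightarrow> (\<exists>m\<in>U. decides S Y m))" and U: "U \<subseteq> Pow S" and Y: "prime_thy Y"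
  shows "Neg (Neg d) \<in> Y \<longleftrightarrow> mtypes S Y \<subseteq> U"
proof -
  have "d \<in> A \<longleftrightarrow> A \<inter> S \<in> U" if A: "max_thy A" for A
  proof -
    have "m = A \<inter> S" if "m \<in> U" "decides S A m" for m
      using decides_type[OF that(2) max_prime[OF A]] U that(1) by blast
    then show ?thesis using d max_prime[OF A] decides_max[OF A, of S] by blast
  qed
  then show ?thesis unfolding mem_Neg_Neg[OF Y] mtypes_def by blast
qed

lemma prime_thy_Union:
  assumes "\<C> \<noteq> {}" "subset.chain UNIV \<C>" "\<And>T. T \<in> \<C> \<Longrightarrow> prime_thy T"
  shows "prime_thy (\<Union>\<C>)"
proof -
  have "thy (\<Union>\<C>)" using thy_Union[OF assms(1,2)] assms(3) prime_thyD(1) by blast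
  moreover have "Bot \<notin> \<Union>\<C>" using assms(3) prime_thyD(2) by blast
  moreover have "a \<in> \<Union>\<C> \<or> b \<in> \<Union>\<C>" if "Disj a b \<in> \<Union>\<C>" for a b
    using that assms(3) mem_Disj by blast
  ultimately show ?thesis by (simp add: prime_thy_def)
qed

text \<open>The only use of the two axioms of PL: a theory Z that is maximal among those
  separating M1 from M2 has all its proper extensions in one of two classes, so by the
  Scott axiom these extensions are decided, and by the 3-fork axiom there are only two of them.\<close>

lemma fork_exists:
  assumes S: "finite S" and X: "prime_thy X"
    and M: "mtypes S X = M1 \<union> M2" "M1 \<inter> M2 = {}" "M1 \<noteq> {}" "M2 \<noteq> {}"
    and sep: "\<And>Y. prime_thy Y \<Longrightarrow> X \<subseteq> Y \<Longrightarrow> Y \<inter> S \<noteq> X \<inter> S \<Longrightarrow> mtypes S Y \<subseteq> M1 \<or> mtypes S Y \<subseteq> M2"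
  obtains Z m1 m2 where "prime_thy Z" "X \<subseteq> Z" "Z \<inter> S = X \<inter> S" "m1 \<in> M1" "m2 \<in> M2" "mtypes S Z = {m1, m2}"
    "\<And>Y. prime_thy Y \<Longrightarrow> Z \<subseteq> Y \<Longrightarrow> Y \<noteq> Z \<Longrightarrow> Y \<inter> S \<in> {m1, m2}"
proof -
  have PowM: "M1 \<subseteq> Pow S" "M2 \<subseteq> Pow S" using M(1) mtypes_Pow[of S X] by blast+
  have "\<forall>U\<in>Pow (Pow S). \<exists>d. \<forall>Y. prime_thy Y \<longrightarrow> (d \<in> Y \<longleftrightarrow> (\<exists>m\<in>U. decides S Y m))"
    using deciding_formula[OF S] by simp
  from bchoice[OF this] obtain th where
    "\<forall>U\<in>Pow (Pow S). \<forall>Y. prime_thy Y \<longrightarrow> (th U \<in> Y \<longleftrightarrow> (\<exists>m\<in>U. decides S Y m))" by (rule exE)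
  then have thU: "\<forall>Y. prime_thy Y \<longrightarrow> (th U \<in> Y \<longleftrightarrow> (\<exists>m\<in>U. decides S Y m))" if "U \<subseteq> Pow S" for U
    using that by simp
  then have th: "th U \<in> Y \<longleftrightarrow> (\<exists>m\<in>U. decides S Y m)" if "U \<subseteq> Pow S" "prime_thy Y" for U Y
    using that by simp
  define psi where "psi U = Neg (Neg (th U))" for U
  have psi: "psi U \<in> Y \<longleftrightarrow> mtypes S Y \<subseteq> U" if "U \<subseteq> Pow S" "prime_thy Y" for U Y
    unfolding psi_def by (rule mem_Neg_Neg_deciding[OF thU[OF that(1)] that])
  \<comment> \<open>Candidates see types of both \<open>M1\<close> and \<open>M2\<close>. Saying
    this by the absence of two formulas makes the condition pass to unions of chains.\<close>
  let ?A = "{Z. prime_thy Z \<and> X \<subseteq> Z \<and> Z \<inter> S = X \<inter> S \<and> psi M1 \<notin> Z \<and> psi M2 \<notin> Z}"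
  have "\<exists>Z\<in>?A. \<forall>Y\<in>?A. Z \<subseteq> Y \<longrightarrow> Y = Z"
  proof (rule subset_Zorn_nonempty)
    have "psi M1 \<notin> X" "psi M2 \<notin> X" using psi[OF PowM(1) X] psi[OF PowM(2) X] M by blast+
    then show "?A \<noteq> {}" using X by blast
    fix \<C> assume ne: "\<C> \<noteq> {}" and c: "subset.chain ?A \<C>"
    have A: "Z \<in> ?A" if "Z \<in> \<C>" for Z using that c unfolding subset.chain_def by blast
    have "subset.chain UNIV \<C>" using c by (simp add: subset.chain_def)
    then have "prime_thy (\<Union>\<C>)" using ne A by (intro prime_thy_Union) simp_all
    moreover have "X \<subseteq> \<Union>\<C>" "psi M1 \<notin> \<Union>\<C>" "psi M2 \<notin> \<Union>\<C>" using ne A by blast+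
    moreover have "\<Union>\<C> \<inter> S = X \<inter> S" using ne A by blast
    ultimately show "\<Union>\<C> \<in> ?A" by simp
  qed
  then obtain Z where ZA: "Z \<in> ?A" and "\<forall>Y\<in>?A. Z \<subseteq> Y \<longrightarrow> Y = Z" by (rule bexE)
  then have max: "Y = Z" if "Y \<in> ?A" "Z \<subseteq> Y" for Y using that by blast
  have Z: "prime_thy Z" "X \<subseteq> Z" "Z \<inter> S = X \<inter> S" "psi M1 \<notin> Z" "psi M2 \<notin> Z" using ZA by simp_all
  \<comment> \<open>A proper extension with another trace is covered by \<open>sep\<close>; one with
    the same trace that saw both sides would be a candidate, against maximality.\<close>
  have above: "mtypes S Y \<subseteq> M1 \<or> mtypes S Y \<subseteq> M2" if Y: "prime_thy Y" "Z \<subseteq> Y" "Y \<noteq> Z" for Y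
  proof (rule ccontr)
    assume n: "\<not> ?thesis"
    have XY: "X \<subseteq> Y" using Z(2) Y(2) by (rule order_trans)
    then have "Y \<inter> S = X \<inter> S" using sep[OF Y(1)] n by blast
    moreover have "psi M1 \<notin> Y" "psi M2 \<notin> Y" using psi[OF PowM(1) Y(1)] psi[OF PowM(2) Y(1)] n by blast+
    ultimately show False using max[of Y] Y XY by simp
  qed
  have ZM: "mtypes S Z \<subseteq> M1 \<union> M2" using mtypes_antimono[OF Z(2)] M(1) by blast
  \<comment> \<open>Scott axiom. An undecided extension \<open>Y0\<close> on the side
    \<open>P\<close> would play \<open>u1\<close>, the theories deciding a type of \<open>P\<close>
    play \<open>u2\<close>, the side \<open>Q\<close> collapses to \<open>v\<close>, and
    \<open>Z\<close> is the root. The formulas \<open>psi P\<close>, \<open>th P\<close> and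
    \<open>psi Q\<close> define the principal upsets of \<open>u1\<close>, \<open>u2\<close> and
    \<open>v\<close>.\<close>
  have decided: "\<exists>m\<in>P. decides S Y0 m"
    if PQ: "P \<union> Q = M1 \<union> M2" "P \<inter> Q = {}" "psi P \<notin> Z" "psi Q \<notin> Z" "P \<subseteq> Pow S" "Q \<subseteq> Pow S"
      and above: "\<And>Y. prime_thy Y \<Longrightarrow> Z \<subseteq> Y \<Longrightarrow> Y \<noteq> Z \<Longrightarrow> mtypes S Y \<subseteq> P \<or> mtypes S Y \<subseteq> Q"
      and Y0: "prime_thy Y0" "Z \<subseteq> Y0" "Y0 \<noteq> Z" "mtypes S Y0 \<subseteq> P" for P Q Y0
  proof (rule ccontr)
    assume n: "\<not> ?thesis"
    define g where "g Y = (if Y = Z then 0 else if psi Q \<in> Y then 3 else if th P \<in> Y then 2 else 1 :: nat)" for Y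
    define \<beta> where "\<beta> w = (if w = 0 then Top else if w = 1 then psi P else if w = 2 then th P else psi Q)" for w :: nat
    have thpsi: "psi P \<in> Y" if Y: "th P \<in> Y" "prime_thy Y" for Y
    proof -
      obtain m where m: "m \<in> P" "decides S Y m" using th[OF PQ(5) Y(2)] Y(1) by blast
      then have "m \<subseteq> S" using PQ(5) by blast
      from decides_mtypes[OF m(2) Y(2) this] have "mtypes S Y \<subseteq> P" using m(1) by simp
      then show ?thesis using psi[OF PQ(5) Y(2)] by simp
    qed
    have disj: "\<not> (psi P \<in> Y \<and> psi Q \<in> Y)" if "prime_thy Y" for Y
      using psi[OF PQ(5) that] psi[OF PQ(6) that] mtypes_nonempty[OF that, of S] PQ(2) by blast
    have either: "psi P \<in> Y \<or> psi Q \<in> Y" if "prime_thy Y" "Z \<subseteq> Y" "Y \<noteq> Z" for Y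
      using psi[OF PQ(5) that(1)] psi[OF PQ(6) that(1)] above[OF that] by blast
    have thZ: "th P \<notin> Z" using thpsi[OF _ Z(1)] PQ(3) by blast
    have toP: "\<exists>A. prime_thy A \<and> Y \<subseteq> A \<and> g A = 2" if Y: "prime_thy Y" "Z \<subseteq> Y" "psi P \<in> Y" for Y
    proof -
      obtain A where A: "max_thy A" "Y \<subseteq> A" using max_thy_exists[OF prime_thyD[OF Y(1)]] by blast
      have "A \<inter> S \<in> P" using A psi[OF PQ(5) Y(1)] Y(3) unfolding mtypes_def by blast
      then have "th P \<in> A" using th[OF PQ(5) max_prime[OF A(1)]] decides_max[OF A(1), of S] by blast
      moreover have "psi Q \<notin> A" using disj[OF max_prime[OF A(1)]] Y(3) A(2) by blast
      ultimately show ?thesis using A max_prime[OF A(1)] thZ by (intro exI[of _ A]) (auto simp: g_def)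
    qed
    have Y0P: "psi P \<in> Y0" "th P \<notin> Y0"
      using psi[OF PQ(5) Y0(1)] th[OF PQ(5) Y0(1)] Y0(4) n by blast+
    have to3: "\<exists>A. prime_thy A \<and> Z \<subseteq> A \<and> g A = 3"
    proof -
      have "\<not> mtypes S Z \<subseteq> P" using psi[OF PQ(5) Z(1)] PQ(3) by blast
      then obtain A where A: "max_thy A" "Z \<subseteq> A" "A \<inter> S \<notin> P" unfolding mtypes_def by blast
      then have "A \<inter> S \<in> Q" using ZM PQ(1) unfolding mtypes_def by blast
      then have "psi Q \<in> A" using psi[OF PQ(6) max_prime[OF A(1)]] mtypes_max[OF A(1), of S] by simp
      then show ?thesis using A max_prime[OF A(1)] PQ(4) by (intro exI[of _ A]) (auto simp: g_def)
    qed
    show False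
    proof (rule jankov_excludes[OF rooted_scott Z(1), where g = g and \<beta> = \<beta>])
      show "subst s (jankov {0,1,2,3} scott_le) \<in> PL" for s
        using PL.scott[of s] by (simp add: chi_scott_def)
      show "g Y \<in> {0,1,2,3}" for Y by (simp add: g_def)
      show "g Z = 0" by (simp add: g_def)
      fix Y w assume Y: "prime_thy Y" "Z \<subseteq> Y" and w: "w \<in> {0,1,2,3::nat}"
      have top: "Top \<in> Y" using Top_in_thy prime_thyD(1)[OF Y(1)] by blast
      show "\<beta> w \<in> Y \<longleftrightarrow> scott_le w (g Y)"
        using w top thpsi[OF _ Y(1)] disj[OF Y(1)] either[OF Y] thZ PQ(3,4)
        by (auto simp: g_def \<beta>_def scott_le_def)
      assume le: "scott_le (g Y) w"
      consider "w = g Y" | "g Y = 0" "w \<noteq> 0" | "g Y = 1" "w = 2"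
        using le unfolding scott_le_def by (cases "w = g Y") auto
      then show "\<exists>Y'. prime_thy Y' \<and> Y \<subseteq> Y' \<and> g Y' = w"
      proof cases
        case 1
        then show ?thesis using Y by blast
      next
        case 2
        then have "Y = Z" by (simp add: g_def split: if_splits)
        moreover have "g Y0 = 1" using Y0 Y0P disj[OF Y0(1)] by (simp add: g_def)
        moreover obtain A where "prime_thy A" "Y0 \<subseteq> A" "g A = 2" using toP[OF Y0(1,2) Y0P(1)] by blast
        moreover have "Z \<subseteq> A" using Y0(2) \<open>Y0 \<subseteq> A\<close> by (rule order_trans)
        moreover have "w = 1 \<or> w = 2 \<or> w = 3" using w 2 by simp
        ultimately show ?thesis using to3 Y0(1,2) by blast
      next
        case 3
        then have "Y \<noteq> Z" "psi Q \<notin> Y" by (simp_all add: g_def split: if_splits)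
        then have "psi P \<in> Y" using either[OF Y] by blast
        then show ?thesis using toP[OF Y] 3 by blast
      qed
    qed
  qed
  have dec: "\<exists>m\<in>mtypes S Z. decides S Y m" if Y: "prime_thy Y" "Z \<subseteq> Y" "Y \<noteq> Z" for Y
  proof -
    have "\<exists>m\<in>M1 \<union> M2. decides S Y m"
      using above[OF Y]
    proof
      assume "mtypes S Y \<subseteq> M1"
      with decided[of M1 M2 Y, OF refl M(2) Z(4,5) PowM above Y] show ?thesis by blast
    next
      assume "mtypes S Y \<subseteq> M2"
      with decided[of M2 M1 Y, OF _ _ Z(5,4) PowM(2,1) _ Y] M(2) above
      show ?thesis by (metis Int_commute Un_commute UnI2)
    qed
    then obtain m where m: "m \<in> M1 \<union> M2" "decides S Y m" by blast
    then have "m \<subseteq> S" using PowM by blast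
    from decides_mtypes[OF m(2) Y(1) this] have "mtypes S Y = {m}" .
    then have "m \<in> mtypes S Z" using mtypes_antimono[OF Y(2), of S] by blast
    then show ?thesis using m by blast
  qed
  obtain m1 m2 where m: "m1 \<in> mtypes S Z" "m1 \<in> M1" "m2 \<in> mtypes S Z" "m2 \<in> M2"
    using psi[OF PowM(1) Z(1)] psi[OF PowM(2) Z(1)] Z(4,5) ZM by blast
  have ne: "m1 \<noteq> m2" using m M(2) by blast
  have two: "mtypes S Z = {m1, m2}"
  proof (rule ccontr)
    assume n: "mtypes S Z \<noteq> {m1, m2}"
    \<comment> \<open>3-fork axiom. Every proper extension of \<open>Z\<close> decides a type by
      now, so \<open>m1\<close>, \<open>m2\<close> and any remaining types, lumped together in
      \<open>R\<close>, would be three prongs.\<close>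
    define R where "R = mtypes S Z - {m1, m2}"
    have R: "R \<noteq> {}" "R \<subseteq> Pow S" using n m mtypes_Pow[of S Z] unfolding R_def by blast+
    have Pow: "{m1} \<subseteq> Pow S" "{m2} \<subseteq> Pow S" using m PowM by blast+
    define g where "g Y = (if Y = Z then 0 else if th {m1} \<in> Y then 1 else if th {m2} \<in> Y then 2 else 3 :: nat)" for Y
    define \<beta> where "\<beta> w = (if w = 0 then Top else if w = 1 then th {m1} else if w = 2 then th {m2} else th R)" for w :: nat
    have uniq: "m = m'" if "decides S Y m" "decides S Y m'" "m \<in> mtypes S Z" "m' \<in> mtypes S Z" "prime_thy Y" for m m' Y
    proof -
      have "m \<subseteq> S" "m' \<subseteq> S" using that(3,4) mtypes_Pow[of S Z] by blast+
      then show ?thesis using decides_type[OF that(1,5)] decides_type[OF that(2,5)] by simp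
    qed
    have nZ: "\<not> decides S Z m'" if "m' \<in> mtypes S Z" for m'
    proof
      assume "decides S Z m'"
      moreover have "m' \<subseteq> S" using that mtypes_Pow[of S Z] by blast
      ultimately have "mtypes S Z = {m'}" using decides_mtypes[OF _ Z(1)] by simp
      then show False using m ne by simp
    qed
    have t1: "th {m1} \<in> Y \<longleftrightarrow> decides S Y m1" and t2: "th {m2} \<in> Y \<longleftrightarrow> decides S Y m2"
      and t3: "th R \<in> Y \<longleftrightarrow> (\<exists>m\<in>R. decides S Y m)" if "prime_thy Y" for Y
      using th[OF Pow(1) that] th[OF Pow(2) that] th[OF R(2) that] by simp_all
    have reach: "\<exists>A. prime_thy A \<and> Z \<subseteq> A \<and> A \<noteq> Z \<and> decides S A m'" if "m' \<in> mtypes S Z" for m'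
    proof -
      obtain A where A: "max_thy A" "Z \<subseteq> A" "m' = A \<inter> S" using \<open>m' \<in> mtypes S Z\<close> unfolding mtypes_def by blast
      then show ?thesis using decides_max[OF A(1), of S] max_prime[OF A(1)] nZ[OF that] by blast
    qed
    show False
    proof (rule jankov_excludes[OF rooted_fork3 Z(1), where g = g and \<beta> = \<beta>])
      show "subst s (jankov {0,1,2,3} fork3_le) \<in> PL" for s
        using PL.fork3[of s] by (simp add: chi_fork3_def)
      show "g Y \<in> {0,1,2,3}" for Y by (simp add: g_def)
      show "g Z = 0" by (simp add: g_def)
      have excl: "\<not> (decides S Y m1 \<and> decides S Y m2)" "\<not> (decides S Y m1 \<and> (\<exists>m\<in>R. decides S Y m))"
        "\<not> (decides S Y m2 \<and> (\<exists>m\<in>R. decides S Y m))" if "prime_thy Y" for Y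
        using uniq[OF _ _ _ _ that] m(1,3) ne unfolding R_def by blast+
      have some: "decides S Y m1 \<or> decides S Y m2 \<or> (\<exists>m\<in>R. decides S Y m)"
        if "prime_thy Y" "Z \<subseteq> Y" "Y \<noteq> Z" for Y
        using dec[OF that] unfolding R_def by blast
      have none: "\<not> decides S Z m1" "\<not> decides S Z m2" "\<not> (\<exists>m\<in>R. decides S Z m)"
        using nZ m(1,3) unfolding R_def by blast+
      fix Y w assume Y: "prime_thy Y" "Z \<subseteq> Y" and w: "w \<in> {0,1,2,3::nat}"
      have top: "Top \<in> Y" using Top_in_thy prime_thyD(1)[OF Y(1)] by blast
      define d1 d2 d3 where d: "d1 = decides S Y m1" "d2 = decides S Y m2" "d3 = (\<exists>m\<in>R. decides S Y m)"
      have gY: "g Y = (if Y = Z then 0 else if d1 then 1 else if d2 then 2 else 3)"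
        by (simp add: g_def t1[OF Y(1)] t2[OF Y(1)] d)
      have \<beta>Y: "\<beta> 0 \<in> Y" "\<beta> 1 \<in> Y \<longleftrightarrow> d1" "\<beta> 2 \<in> Y \<longleftrightarrow> d2" "\<beta> 3 \<in> Y \<longleftrightarrow> d3"
        by (simp_all add: \<beta>_def top t1[OF Y(1)] t2[OF Y(1)] t3[OF Y(1)] d)
      have ds: "\<not> (d1 \<and> d2)" "\<not> (d1 \<and> d3)" "\<not> (d2 \<and> d3)" "Y \<noteq> Z \<Longrightarrow> d1 \<or> d2 \<or> d3"
        "Y = Z \<Longrightarrow> \<not> d1 \<and> \<not> d2 \<and> \<not> d3"
        using excl[OF Y(1)] some[OF Y] none unfolding d by blast+
      consider "w = 0" | "w = 1" | "w = 2" | "w = 3" using w by blast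
      then show "\<beta> w \<in> Y \<longleftrightarrow> fork3_le w (g Y)"
        by cases (use \<beta>Y ds in \<open>auto simp: gY fork3_le_def\<close>)
      assume le: "fork3_le (g Y) w"
      show "\<exists>Y'. prime_thy Y' \<and> Y \<subseteq> Y' \<and> g Y' = w"
      proof (cases "w = g Y")
        case True
        then show ?thesis using Y by blast
      next
        case False
        then have "g Y = 0" using le by (simp add: fork3_le_def)
        then have YZ: "Y = Z" by (simp add: g_def split: if_splits)
        obtain m' where m': "m' \<in> mtypes S Z" "w = (if m' = m1 then 1 else if m' = m2 then 2 else 3)"
        proof -
          have "w = 1 \<or> w = 2 \<or> w = 3" using w False \<open>g Y = 0\<close> by auto
          moreover obtain m3 where "m3 \<in> R" using R by blast
          ultimately show ?thesis using that[of m1] that[of m2] that[of m3] m(1,3) ne unfolding R_def by auto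
        qed
        obtain A where A: "prime_thy A" "Z \<subseteq> A" "A \<noteq> Z" "decides S A m'" using reach[OF m'(1)] by blast
        have "decides S A m1 \<longleftrightarrow> m' = m1" "decides S A m2 \<longleftrightarrow> m' = m2"
          using uniq[OF A(4) _ m'(1) _ A(1)] A(4) m(1,3) by blast+
        then have "g A = w" using A(3) m'(2) by (simp add: g_def t1[OF A(1)] t2[OF A(1)])
        then show ?thesis using A YZ by blast
      qed
    qed
  qed
  show ?thesis
  proof (rule that[OF Z(1,2,3) m(2,4) two])
    fix Y assume Y: "prime_thy Y" "Z \<subseteq> Y" "Y \<noteq> Z"
    obtain m' where m': "m' \<in> mtypes S Z" "decides S Y m'" using dec[OF Y] by blast
    then have "m' \<subseteq> S" using mtypes_Pow[of S Z] by blast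
    from decides_type[OF m'(2) Y(1) this] show "Y \<inter> S \<in> {m1, m2}" using m'(1) two by simp
  qed
qed

section \<open>Labelled sawed forests\<close>

text \<open>A planar forest of uniform depth n whose leaves are the walls between consecutive regions,
  stored as the list of its walls from left to right. Column entry j of a wall labels its ancestor at
  depth j; a wall and its left neighbour have the same ancestor at depth j iff j is less than the gap
  of the wall.\<close>

datatype wall = Wall (gap: nat) (lft: "fm set") (col: "nat \<Rightarrow> fm set") (rgt: "fm set")

definition refutes :: "fm set \<Rightarrow> fm \<Rightarrow> fm \<Rightarrow> bool" where
  "refutes t a b \<longleftrightarrow> a \<in> t \<and> b \<notin> t"

text \<open>The gap of a wall looks to its left, so the gaps between two walls start after the left
  one and include that of the right one. Both walls then pass through the same node of depth
  \<open>j\<close>.\<close>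

definition block :: "wall list \<Rightarrow> nat \<Rightarrow> nat \<Rightarrow> nat \<Rightarrow> bool" where
  "block ws j i i' \<longleftrightarrow> (\<forall>k. min i i' < k \<longrightarrow> k \<le> max i i' \<longrightarrow> j < gap (ws ! k))"

text \<open>Above a node of depth \<open>j\<close> lie the later column entries of all walls through
  it and the regions beside these walls, so this is the forcing clause for a failing
  implication.\<close>

definition witnessed :: "nat \<Rightarrow> wall list \<Rightarrow> nat \<Rightarrow> nat \<Rightarrow> fm \<Rightarrow> fm \<Rightarrow> bool" where
  "witnessed n ws i j a b \<longleftrightarrow> (\<exists>i'<length ws. block ws j i i' \<and>
     (refutes (lft (ws ! i')) a b \<or> refutes (rgt (ws ! i')) a b \<or>
      (\<exists>j'. j \<le> j' \<and> j' \<le> n \<and> refutes (col (ws ! i') j') a b)))"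

definition mtyp :: "fm set \<Rightarrow> fm set \<Rightarrow> bool" where
  "mtyp S t \<longleftrightarrow> (\<exists>A. max_thy A \<and> t = A \<inter> S)"

definition ptyp :: "fm set \<Rightarrow> fm set \<Rightarrow> bool" where
  "ptyp S t \<longleftrightarrow> (\<exists>A. prime_thy A \<and> t = A \<inter> S)"

text \<open>Labels grow along a column and end below both regions; this is what makes the labelling
  of the simplex monotone.\<close>

definition wall_ok :: "fm set \<Rightarrow> nat \<Rightarrow> wall \<Rightarrow> bool" where
  "wall_ok S n w \<longleftrightarrow> gap w \<le> n \<and> mtyp S (lft w) \<and> mtyp S (rgt w) \<and> (\<forall>j\<le>n. ptyp S (col w j)) \<and>
     (\<forall>j<n. col w j \<subseteq> col w (Suc j)) \<and> col w n \<subseteq> lft w \<inter> rgt w"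

definition adjacent :: "wall \<Rightarrow> wall \<Rightarrow> bool" where
  "adjacent w w' \<longleftrightarrow> rgt w = lft w' \<and> (\<forall>j<gap w'. col w' j = col w j)"

definition forest :: "fm set \<Rightarrow> nat \<Rightarrow> wall list \<Rightarrow> bool" where
  "forest S n ws \<longleftrightarrow> ws \<noteq> [] \<and> gap (ws ! 0) = 0 \<and> (\<forall>w\<in>set ws. wall_ok S n w) \<and>
     (\<forall>i. Suc i < length ws \<longrightarrow> adjacent (ws ! i) (ws ! Suc i)) \<and>
     (\<forall>i<length ws. \<forall>j\<le>n. \<forall>a b. Imp a b \<in> S \<longrightarrow> Imp a b \<notin> col (ws ! i) j \<longrightarrow> witnessed n ws i j a b)"

lemma block_append:
  "i < length us \<Longrightarrow> i' < length us \<Longrightarrow> block us j i i' \<Longrightarrow> block (us @ vs) j i i'"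
  unfolding block_def by (auto simp: nth_append max_def)

lemma block_append_right:
  assumes "block vs j i i'" shows "block (us @ vs) j (length us + i) (length us + i')"
  unfolding block_def
proof (intro allI impI)
  fix k assume k: "min (length us + i) (length us + i') < k" "k \<le> max (length us + i) (length us + i')"
  then obtain l where "k = length us + l" by (metis le_Suc_ex min_add_distrib_right nat_add_left_cancel_le le_add1 less_imp_le order_trans)
  then show "j < gap ((us @ vs) ! k)" using assms k unfolding block_def by (simp add: nth_append min_def max_def split: if_splits)
qed

lemma witnessed_append:
  "i < length us \<Longrightarrow> witnessed n us i j a b \<Longrightarrow> witnessed n (us @ vs) i j a b"
proof -
  assume i: "i < length us" and "witnessed n us i j a b"
  then obtain i' where i': "i' < length us" "block us j i i'"
    "refutes (lft (us ! i')) a b \<or> refutes (rgt (us ! i')) a b \<or>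
      (\<exists>j'. j \<le> j' \<and> j' \<le> n \<and> refutes (col (us ! i') j') a b)" unfolding witnessed_def by blast
  then show ?thesis unfolding witnessed_def
    by (intro exI[of _ i']) (auto simp: nth_append block_append[OF i])
qed

lemma witnessed_append_right:
  "witnessed n vs i j a b \<Longrightarrow> witnessed n (us @ vs) (length us + i) j a b"
proof -
  assume "witnessed n vs i j a b"
  then obtain i' where i': "i' < length vs" "block vs j i i'"
    "refutes (lft (vs ! i')) a b \<or> refutes (rgt (vs ! i')) a b \<or>
      (\<exists>j'. j \<le> j' \<and> j' \<le> n \<and> refutes (col (vs ! i') j') a b)" unfolding witnessed_def by blast
  then show ?thesis unfolding witnessed_def
    by (intro exI[of _ "length us + i'"]) (auto simp: block_append_right)
qed

text \<open>The right part begins with gap 0, so no node is shared across the seam: only the region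
  there must agree, and witnesses stay in their own half.\<close>

lemma forest_append:
  assumes us: "forest S n us" and vs: "forest S n vs" and m: "rgt (last us) = lft (hd vs)"
  shows "forest S n (us @ vs)"
  unfolding forest_def
proof (intro conjI ballI allI impI)
  have ne: "us \<noteq> []" "vs \<noteq> []" using us vs by (auto simp: forest_def)
  show "us @ vs \<noteq> []" using ne by simp
  show "gap ((us @ vs) ! 0) = 0" using us by (simp add: forest_def nth_append)
  show "wall_ok S n w" if "w \<in> set (us @ vs)" for w using that us vs unfolding forest_def by auto
  fix i
  show "adjacent ((us @ vs) ! i) ((us @ vs) ! Suc i)" if i: "Suc i < length (us @ vs)"
  proof -
    consider "Suc i < length us" | "Suc i = length us" | k where "i = length us + k"
      by (metis le_Suc_ex less_Suc_eq_le not_less_eq linorder_neqE_nat)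
    then show ?thesis
    proof cases
      case 1
      then show ?thesis using us by (simp add: forest_def nth_append)
    next
      case 2
      then have "(us @ vs) ! i = last us" "(us @ vs) ! Suc i = hd vs"
        using ne by (simp_all add: nth_append last_conv_nth hd_conv_nth flip: 2)
      moreover have "gap (hd vs) = 0" using vs ne by (simp add: forest_def hd_conv_nth)
      ultimately show ?thesis using m by (simp add: adjacent_def)
    next
      case 3
      then have "Suc k < length vs" using i by simp
      then have "adjacent (vs ! k) (vs ! Suc k)" using vs by (simp add: forest_def)
      then show ?thesis using 3 by (simp add: nth_append)
    qed
  qed
  fix j a b assume i: "i < length (us @ vs)" "j \<le> n" "Imp a b \<in> S" "Imp a b \<notin> col ((us @ vs) ! i) j"
  show "witnessed n (us @ vs) i j a b"
  proof (cases "i < length us")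
    case True
    then have "witnessed n us i j a b" using us i by (simp add: forest_def nth_append)
    then show ?thesis by (rule witnessed_append[OF True])
  next
    case False
    then obtain k where k: "i = length us + k" by (metis le_Suc_ex not_le)
    then have "witnessed n vs k j a b" using vs i by (simp add: forest_def nth_append)
    then show ?thesis unfolding k by (rule witnessed_append_right)
  qed
qed

definition raise :: "fm set \<Rightarrow> nat \<Rightarrow> wall \<Rightarrow> wall" where
  "raise t g w = Wall g (lft w) (case_nat t (col w)) (rgt w)"

text \<open>Grafts all trees onto a new root \<open>t\<close>. Depths and gaps grow by one, so the
  gaps 0 between trees become 1, the shared root; the first wall has no left neighbour and keeps gap
  0.\<close>

definition rootify :: "fm set \<Rightarrow> wall list \<Rightarrow> wall list" where
  "rootify t ws = map (\<lambda>i. raise t (if i = 0 then 0 else Suc (gap (ws ! i))) (ws ! i)) [0..<length ws]"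

lemma rootify_nth:
  "i < length ws \<Longrightarrow> rootify t ws ! i = raise t (if i = 0 then 0 else Suc (gap (ws ! i))) (ws ! i)"
  by (simp add: rootify_def)

lemma length_rootify [simp]: "length (rootify t ws) = length ws"
  by (simp add: rootify_def)

lemma raise_sel [simp]:
  "gap (raise t g w) = g" "lft (raise t g w) = lft w" "rgt (raise t g w) = rgt w"
  "col (raise t g w) 0 = t" "col (raise t g w) (Suc j) = col w j"
  by (simp_all add: raise_def)

lemma block_rootify:
  assumes "i < length ws" "i' < length ws"
  shows "block (rootify t ws) 0 i i'" "block ws j i i' \<Longrightarrow> block (rootify t ws) (Suc j) i i'"
  using assms unfolding block_def by (auto simp: rootify_nth max_def min_def split: if_splits)

text \<open>Old nodes keep their witnesses one level deeper. The new root lies below every wall, so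
  a refutation at the root of any of the trees serves it.\<close>

lemma forest_rootify:
  assumes ws: "forest S n ws" and t: "ptyp S t" "\<And>w. w \<in> set ws \<Longrightarrow> t \<subseteq> col w 0"
    and wit: "\<And>a b. Imp a b \<in> S \<Longrightarrow> Imp a b \<notin> t \<Longrightarrow> refutes t a b \<or> (\<exists>w\<in>set ws. refutes (col w 0) a b)"
  shows "forest S (Suc n) (rootify t ws)"
  unfolding forest_def
proof (intro conjI ballI allI impI)
  have ne: "ws \<noteq> []" using ws by (auto simp: forest_def)
  show "rootify t ws \<noteq> []" using ne by (simp add: rootify_def)
  show "gap (rootify t ws ! 0) = 0" using ne by (simp add: rootify_nth)
  show "wall_ok S (Suc n) w" if w: "w \<in> set (rootify t ws)" for w
  proof -
    obtain l where l: "l < length ws" "w = raise t (if l = 0 then 0 else Suc (gap (ws ! l))) (ws ! l)"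
      using w unfolding rootify_def by auto
    define v g where vg: "v = ws ! l" "g = (if l = 0 then 0 else Suc (gap v))"
    have v: "v \<in> set ws" "w = raise t g v" "g \<le> Suc (gap v)" using l by (auto simp: vg)
    have ok: "wall_ok S n v" using ws v(1) by (simp add: forest_def)
    have "ptyp S (col w j)" if "j \<le> Suc n" for j
      using that t(1) ok v(2) by (cases j) (auto simp: wall_ok_def)
    moreover have "col w j \<subseteq> col w (Suc j)" if "j < Suc n" for j
      using that t(2)[OF v(1)] ok v(2) by (cases j) (auto simp: wall_ok_def)
    ultimately show ?thesis using ok v unfolding wall_ok_def by auto
  qed
  fix i
  show "adjacent (rootify t ws ! i) (rootify t ws ! Suc i)" if i: "Suc i < length (rootify t ws)"
  proof -
    have "adjacent (ws ! i) (ws ! Suc i)" using ws i by (simp add: forest_def)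
    then have "rgt (ws ! i) = lft (ws ! Suc i)" "\<And>j. j < gap (ws ! Suc i) \<Longrightarrow> col (ws ! Suc i) j = col (ws ! i) j"
      by (auto simp: adjacent_def)
    then have "col (raise t g' (ws ! Suc i)) j = col (raise t g (ws ! i)) j" if "j < Suc (gap (ws ! Suc i))" for j g g'
      using that by (cases j) auto
    then show ?thesis using i \<open>rgt (ws ! i) = _\<close> by (simp add: rootify_nth adjacent_def)
  qed
  fix j a b assume i: "i < length (rootify t ws)" and j: "j \<le> Suc n"
    and ab: "Imp a b \<in> S" "Imp a b \<notin> col (rootify t ws ! i) j"
  have li: "i < length ws" using i by simp
  show "witnessed (Suc n) (rootify t ws) i j a b"
  proof (cases j)
    case 0
    then have "Imp a b \<notin> t" using ab li by (simp add: rootify_nth)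
    from wit[OF ab(1) this] show ?thesis
    proof
      assume "refutes t a b"
      then show ?thesis using i block_rootify(1)[OF li li] 0 unfolding witnessed_def
        by (intro exI[of _ i]) (auto simp: rootify_nth intro!: exI[of _ 0])
    next
      assume "\<exists>w\<in>set ws. refutes (col w 0) a b"
      then obtain i' where i': "i' < length ws" "refutes (col (ws ! i') 0) a b" by (metis in_set_conv_nth)
      then show ?thesis using block_rootify(1)[OF li i'(1)] 0 unfolding witnessed_def
        by (intro exI[of _ i']) (auto simp: rootify_nth intro!: exI[of _ "Suc 0"])
    qed
  next
    case (Suc k)
    then have "witnessed n ws i k a b" using ws ab j li by (simp add: rootify_nth forest_def)
    then obtain i' where i': "i' < length ws" "block ws k i i'"
      "refutes (lft (ws ! i')) a b \<or> refutes (rgt (ws ! i')) a b \<or>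
        (\<exists>j'. k \<le> j' \<and> j' \<le> n \<and> refutes (col (ws ! i') j') a b)" unfolding witnessed_def by blast
    have "(\<exists>j'. j \<le> j' \<and> j' \<le> Suc n \<and> refutes (col (rootify t ws ! i') j') a b)"
      if "k \<le> j'" "j' \<le> n" "refutes (col (ws ! i') j') a b" for j'
      using that Suc i'(1) by (intro exI[of _ "Suc j'"]) (simp add: rootify_nth)
    then show ?thesis using i' block_rootify(2)[OF li i'(1,2)] Suc unfolding witnessed_def
      by (intro exI[of _ i']) (auto simp: rootify_nth)
  qed
qed

text \<open>A column may repeat its label, so one wall fits every depth. Forks and trivial paths are
  padded to the uniform depth in this way.\<close>

lemma forest_single:
  assumes "ptyp S t" "mtyp S a" "mtyp S b" "t \<subseteq> a" "t \<subseteq> b"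
    and "\<And>c d. Imp c d \<in> S \<Longrightarrow> Imp c d \<notin> t \<Longrightarrow> refutes t c d \<or> refutes a c d \<or> refutes b c d"
  shows "forest S n [Wall 0 a (\<lambda>_. t) b]"
proof -
  have "witnessed n [Wall 0 a (\<lambda>_. t) b] 0 j c d" if "j \<le> n" "Imp c d \<in> S" "Imp c d \<notin> t" for j c d
    using assms(6)[OF that(2,3)] that(1) unfolding witnessed_def by (auto simp: block_def)
  then show ?thesis using assms(1-5) unfolding forest_def by (auto simp: wall_ok_def)
qed

text \<open>The objects concatenated when maximal types are connected; the bound by \<open>t\<close>
  is what later allows \<open>rootify\<close> to put \<open>t\<close> beneath them.\<close>

definition path :: "fm set \<Rightarrow> nat \<Rightarrow> fm set \<Rightarrow> fm set \<Rightarrow> fm set \<Rightarrow> wall list \<Rightarrow> bool" where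
  "path S n t a b ws \<longleftrightarrow> forest S n ws \<and> lft (hd ws) = a \<and> rgt (last ws) = b \<and> (\<forall>w\<in>set ws. t \<subseteq> col w 0)"

lemma path_append: "path S n t a b us \<Longrightarrow> path S n t b c vs \<Longrightarrow> path S n t a c (us @ vs)"
proof -
  assume u: "path S n t a b us" and v: "path S n t b c vs"
  then have "us \<noteq> []" "vs \<noteq> []" by (auto simp: path_def forest_def)
  then show ?thesis using u v forest_append[of S n us vs] unfolding path_def by auto
qed

lemma mtyp_typ: "mtyp S t \<Longrightarrow> ptyp S t"
  unfolding mtyp_def ptyp_def using max_prime by blast

lemma mtypes_mtyp: "a \<in> mtypes S X \<Longrightarrow> mtyp S a"
  unfolding mtypes_def mtyp_def by blast

lemma mtypes_above: "a \<in> mtypes S X \<Longrightarrow> X \<inter> S \<subseteq> a"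
  unfolding mtypes_def by blast

text \<open>Nothing lies properly above a maximal theory, so an implication missing from it is
  refuted on the spot. Hence regions carry no witness condition in \<open>forest\<close>.\<close>

lemma mtyp_refutes:
  assumes S: "subcl S" and t: "mtyp S t" and ab: "Imp a b \<in> S" "Imp a b \<notin> t"
  shows "refutes t a b"
proof -
  obtain A where A: "max_thy A" "t = A \<inter> S" using t unfolding mtyp_def by blast
  then have "Imp a b \<notin> A" using ab by blast
  then obtain Y where "prime_thy Y" "A \<subseteq> Y" "a \<in> Y" "b \<notin> Y" using mem_Imp[OF max_prime[OF A(1)]] by blast
  then have "a \<in> A" "b \<notin> A" using max_thy_eq[OF A(1)] by blast+
  then show ?thesis using S A(2) ab(1) unfolding subcl_def refutes_def by blast
qed

text \<open>Induction on a bound for the number of formulas of \<open>S\<close> outside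
  \<open>X\<close>. Theories with a larger trace supply subtrees, forks supply the missing
  connections, and a path from \<open>a\<close> to \<open>b\<close> with detours through refuting
  subtrees is finally given the root \<open>X \<inter> S\<close>. Both end types are prescribed so
  that trees can be glued.\<close>

lemma tree_exists:
  assumes S: "finite S" "subcl S"
  shows "prime_thy X \<Longrightarrow> card (S - X) \<le> n \<Longrightarrow> a \<in> mtypes S X \<Longrightarrow> b \<in> mtypes S X \<Longrightarrow>
    \<exists>ws. path S n (X \<inter> S) a b ws \<and> (\<forall>w\<in>set ws. col w 0 = X \<inter> S) \<and> (\<forall>i. 0 < i \<longrightarrow> i < length ws \<longrightarrow> 0 < gap (ws ! i))"
proof (induction n arbitrary: X a b)
  case 0
  have "S \<subseteq> X" using 0(2) S(1) by simp
  then have XS: "X \<inter> S = S" by blast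
  have "a \<subseteq> S" "b \<subseteq> S" using 0(3,4) mtypes_Pow by blast+
  moreover have "S \<subseteq> a" "S \<subseteq> b" using mtypes_above[OF 0(3)] mtypes_above[OF 0(4)] XS by simp_all
  ultimately have ab: "a = S" "b = S" by blast+
  have "mtyp S S" using mtypes_mtyp[OF 0(3)] ab by simp
  then have "forest S 0 [Wall 0 S (\<lambda>_. S) S]" by (intro forest_single mtyp_typ) auto
  then show ?case unfolding XS ab by (intro exI[of _ "[Wall 0 S (\<lambda>_. S) S]"]) (simp add: path_def)
next
  case (Suc n)
  define t where "t = X \<inter> S"
  have tree: "\<exists>ws. path S n t c d ws \<and> (\<forall>w\<in>set ws. col w 0 = Y \<inter> S)"
    if Y: "prime_thy Y" "X \<subseteq> Y" "Y \<inter> S \<noteq> t" and cd: "c \<in> mtypes S Y" "d \<in> mtypes S Y" for Y c d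
  proof -
    have "S - Y \<subset> S - X" using Y(2,3) unfolding t_def by blast
    then have "card (S - Y) < card (S - X)" using S(1) by (intro psubset_card_mono) auto
    then have "card (S - Y) \<le> n" using Suc.prems(2) by simp
    from Suc.IH[OF Y(1) this cd] obtain ws where
      ws: "path S n (Y \<inter> S) c d ws" "\<forall>w\<in>set ws. col w 0 = Y \<inter> S" by blast
    have "t \<subseteq> Y \<inter> S" using Y(2) unfolding t_def by blast
    then have "path S n t c d ws" using ws unfolding path_def by blast
    then show ?thesis using ws(2) by blast
  qed
  have self: "\<exists>ws. path S n t c c ws" if c: "c \<in> mtypes S X" for c
  proof -
    have m: "mtyp S c" using mtypes_mtyp[OF c] .
    have "forest S n [Wall 0 c (\<lambda>_. c) c]"
      by (intro forest_single mtyp_typ m) (use mtyp_refutes[OF S(2) m] in auto)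
    then show ?thesis using mtypes_above[OF c]
      by (intro exI[of _ "[Wall 0 c (\<lambda>_. c) c]"]) (simp add: path_def t_def)
  qed
  \<comment> \<open>Let \<open>M1\<close> be the types reachable from \<open>c\<close>. If
    \<open>d\<close> is not among them, trees of larger theories never cross from \<open>M1\<close>
    to the rest, which is the hypothesis of \<open>fork_exists\<close>; but the fork obtained there
    is a wall that does cross.\<close>
  have conn: "\<exists>ws. path S n t c d ws" if c: "c \<in> mtypes S X" and d: "d \<in> mtypes S X" for c d
  proof (rule ccontr)
    assume n: "\<not> ?thesis"
    define M1 where "M1 = {m\<in>mtypes S X. \<exists>ws. path S n t c m ws}"
    define M2 where "M2 = mtypes S X - M1"
    have c1: "c \<in> M1" using c self by (simp add: M1_def)
    have d2: "d \<in> M2" using d n by (simp add: M1_def M2_def)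
    have M: "mtypes S X = M1 \<union> M2" "M1 \<inter> M2 = {}" "M1 \<noteq> {}" "M2 \<noteq> {}"
      using c1 d2 by (auto simp: M1_def M2_def)
    have step: "m' \<in> M1" if "m \<in> M1" "path S n t m m' ws" "m' \<in> mtypes S X" for m m' ws
      using that path_append unfolding M1_def by blast
    have sep: "mtypes S Y \<subseteq> M1 \<or> mtypes S Y \<subseteq> M2"
      if Y: "prime_thy Y" "X \<subseteq> Y" "Y \<inter> S \<noteq> X \<inter> S" for Y
    proof -
      have YX: "mtypes S Y \<subseteq> mtypes S X" using mtypes_antimono[OF Y(2)] .
      have "m' \<in> M1" if "m \<in> mtypes S Y" "m \<in> M1" "m' \<in> mtypes S Y" for m m'
        using tree[OF Y(1,2) _ that(1,3)] Y(3) step[OF that(2)] that(3) YX unfolding t_def by blast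
      then show ?thesis using YX unfolding M2_def by blast
    qed
    obtain Z m1 m2 where Z: "prime_thy Z" "X \<subseteq> Z" "Z \<inter> S = X \<inter> S" "m1 \<in> M1" "m2 \<in> M2" "mtypes S Z = {m1, m2}"
      and Zup: "\<And>Y. prime_thy Y \<Longrightarrow> Z \<subseteq> Y \<Longrightarrow> Y \<noteq> Z \<Longrightarrow> Y \<inter> S \<in> {m1, m2}"
      using fork_exists[OF S(1) Suc.prems(1) M sep] by blast
    have mt: "m1 \<in> mtypes S X" "m2 \<in> mtypes S X" using Z(4,5) M(1) by blast+
    \<comment> \<open>Since \<open>Z\<close> has trace \<open>t\<close> and its proper extensions
      have trace \<open>m1\<close> or \<open>m2\<close>, the single wall sees all the traces that
      \<open>Z\<close> sees.\<close>
    have "refutes t a b \<or> refutes m1 a b \<or> refutes m2 a b" if ab: "Imp a b \<in> S" "Imp a b \<notin> t" for a b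
    proof -
      have "Imp a b \<notin> Z" using ab Z(3) unfolding t_def by blast
      then obtain Y where Y: "prime_thy Y" "Z \<subseteq> Y" "a \<in> Y" "b \<notin> Y" using mem_Imp[OF Z(1)] by blast
      have "refutes (Y \<inter> S) a b" using Y ab(1) S(2) unfolding refutes_def subcl_def by blast
      moreover have "Y \<inter> S = t \<or> Y \<inter> S = m1 \<or> Y \<inter> S = m2" using Zup[OF Y(1,2)] Z(3) unfolding t_def by blast
      ultimately show ?thesis by auto
    qed
    moreover have "ptyp S t" using Suc.prems(1) unfolding ptyp_def t_def by blast
    ultimately have "forest S n [Wall 0 m1 (\<lambda>_. t) m2]"
      using mtypes_mtyp[OF mt(1)] mtypes_mtyp[OF mt(2)] mtypes_above[OF mt(1)] mtypes_above[OF mt(2)]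
      unfolding t_def by (intro forest_single)
    then have "path S n t m1 m2 [Wall 0 m1 (\<lambda>_. t) m2]" by (simp add: path_def)
    from step[OF Z(4) this mt(2)] show False using Z(5) M(2) by blast
  qed
  \<comment> \<open>Each detour leaves from the end \<open>b\<close>, walks to a type
    \<open>m\<close> above the refuting theory \<open>Y\<close>, crosses the tree of
    \<open>Y\<close> from \<open>m\<close> to \<open>m\<close>, and returns to \<open>b\<close>, so
    both ends of the path stay fixed.\<close>
  have collect: "\<exists>ws. path S n t a b ws \<and> (\<forall>(c, d)\<in>R. \<exists>w\<in>set ws. refutes (col w 0) c d)"
    if "finite R" "\<forall>(c, d)\<in>R. \<exists>Y. prime_thy Y \<and> X \<subseteq> Y \<and> Y \<inter> S \<noteq> t \<and> refutes (Y \<inter> S) c d" for R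
    using that
  proof (induction R rule: finite_induct)
    case empty
    show ?case using conn[OF Suc.prems(3,4)] by blast
  next
    case (insert r R)
    obtain c d where r: "r = (c, d)" by (cases r)
    have "\<forall>(c, d)\<in>R. \<exists>Y. prime_thy Y \<and> X \<subseteq> Y \<and> Y \<inter> S \<noteq> t \<and> refutes (Y \<inter> S) c d"
      using insert.prems by simp
    from insert.IH[OF this] obtain ws where
      ws: "path S n t a b ws" "\<forall>(c, d)\<in>R. \<exists>w\<in>set ws. refutes (col w 0) c d" by (elim exE conjE)
    have "\<exists>Y. prime_thy Y \<and> X \<subseteq> Y \<and> Y \<inter> S \<noteq> t \<and> refutes (Y \<inter> S) c d"
      using insert.prems r by simp
    then obtain Y where Y: "prime_thy Y" "X \<subseteq> Y" "Y \<inter> S \<noteq> t" "refutes (Y \<inter> S) c d"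
      by (elim exE conjE)
    obtain m where m: "m \<in> mtypes S Y" using mtypes_nonempty[OF Y(1), of S] by blast
    then have mX: "m \<in> mtypes S X" using mtypes_antimono[OF Y(2)] by blast
    obtain us where us: "path S n t m m us" "\<forall>w\<in>set us. col w 0 = Y \<inter> S" using tree[OF Y(1-3) m m] by blast
    obtain vs where vs: "path S n t b m vs" using conn[OF Suc.prems(4) mX] by blast
    obtain vs' where vs': "path S n t m b vs'" using conn[OF mX Suc.prems(4)] by blast
    have "path S n t a b (ws @ vs @ us @ vs')"
      using path_append[OF ws(1) path_append[OF vs path_append[OF us(1) vs']]] .
    moreover have "us \<noteq> []" using us(1) by (auto simp: path_def forest_def)
    then have "\<exists>w\<in>set us. refutes (col w 0) c d" using us(2) Y(4) by (metis list.set_intros(1) neq_Nil_conv)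
    ultimately show ?case using ws(2) r by (intro exI[of _ "ws @ vs @ us @ vs'"]) auto
  qed
  \<comment> \<open>The implications that call for a detour: as \<open>t\<close> itself does not
    refute them, a refuting theory has a trace different from \<open>t\<close>.\<close>
  define R where "R = {(c, d). Imp c d \<in> S \<and> Imp c d \<notin> t \<and> \<not> refutes t c d}"
  have "R \<subseteq> S \<times> S" using S(2) unfolding R_def subcl_def by blast
  then have finR: "finite R" using S(1) by (meson finite_SigmaI finite_subset)
  have need: "\<exists>Y. prime_thy Y \<and> X \<subseteq> Y \<and> Y \<inter> S \<noteq> t \<and> refutes (Y \<inter> S) c d" if cd: "(c, d) \<in> R" for c d
  proof -
    have "Imp c d \<notin> X" using cd by (auto simp: R_def t_def)
    then obtain Y where Y: "prime_thy Y" "X \<subseteq> Y" "c \<in> Y" "d \<notin> Y" using mem_Imp[OF Suc.prems(1)] by blast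
    have "refutes (Y \<inter> S) c d" using Y cd S(2) unfolding refutes_def subcl_def R_def by blast
    moreover have "Y \<inter> S \<noteq> t" using calculation cd by (auto simp: R_def)
    ultimately show ?thesis using Y by blast
  qed
  have "\<forall>(c, d)\<in>R. \<exists>Y. prime_thy Y \<and> X \<subseteq> Y \<and> Y \<inter> S \<noteq> t \<and> refutes (Y \<inter> S) c d"
    using need by (simp add: case_prod_unfold)
  from collect[OF finR this] obtain ws where
    ws: "path S n t a b ws" "\<forall>(c, d)\<in>R. \<exists>w\<in>set ws. refutes (col w 0) c d" by (elim exE conjE)
  have f: "forest S n ws" and ne: "ws \<noteq> []" and sub: "\<And>w. w \<in> set ws \<Longrightarrow> t \<subseteq> col w 0"
    using ws(1) by (auto simp: path_def forest_def)
  have "ptyp S t" using Suc.prems(1) unfolding ptyp_def t_def by blast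
  then have "forest S (Suc n) (rootify t ws)"
    by (rule forest_rootify[OF f _ sub]) (use ws(2) in \<open>auto simp: R_def\<close>)
  moreover have "col w 0 = t" if "w \<in> set (rootify t ws)" for w
    using that by (auto simp: rootify_def)
  moreover have "rootify t ws \<noteq> []" using ne by (simp add: rootify_def)
  then have "lft (hd (rootify t ws)) = a" "rgt (last (rootify t ws)) = b"
    using ws(1) ne by (simp_all add: path_def hd_conv_nth last_conv_nth rootify_nth)
  moreover have "0 < gap (rootify t ws ! i)" if "0 < i" "i < length (rootify t ws)" for i
    using that by (simp add: rootify_nth)
  ultimately show ?case unfolding t_def[symmetric] path_def
    by (intro exI[of _ "rootify t ws"]) simp
qed

section \<open>Realising sawed trees in a simplex\<close>

text \<open>Coordinate 0 is transverse to the walls. Wall i is the hyperplane where coordinate 0 equals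
  the sum of the nonnegative forms width (gap 0), ..., width (gap i); neighbouring walls therefore meet
  exactly where the width of the gap between them vanishes, that is, at points of level less than the gap.
  The truncated subtraction in the width makes gap 0 as wide as gap 1.\<close>

definition width :: "nat \<Rightarrow> nat \<Rightarrow> (nat \<Rightarrow> real) \<Rightarrow> real" where
  "width n d z = (\<Sum>i\<in>{d - 1..<n}. z (Suc i))"

definition pos :: "nat \<Rightarrow> wall list \<Rightarrow> nat \<Rightarrow> (nat \<Rightarrow> real) \<Rightarrow> real" where
  "pos n ws i z = (\<Sum>k\<le>i. width n (gap (ws ! k)) z)"

text \<open>The index of the last nonzero coordinate among 1 to \<open>n\<close>, or 0 if all
  vanish: the depth of the forest that the point realises.\<close>

definition level :: "nat \<Rightarrow> (nat \<Rightarrow> real) \<Rightarrow> nat" where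
  "level n z = (LEAST j. \<forall>i. j \<le> i \<longrightarrow> i < n \<longrightarrow> z (Suc i) = 0)"

definition simplex :: "nat \<Rightarrow> (nat \<Rightarrow> real) set" where
  "simplex n = {z. (\<forall>i. 0 \<le> z i) \<and> (\<forall>i>n. z i = 0) \<and> (\<Sum>i\<le>n. z i) \<le> 1}"

lemma simplex_conv_hull:
  "simplex n = conv_hull (insert (\<lambda>_. 0) ((\<lambda>k i. if i = k then 1 else 0) ` {..n}))"
proof -
  define e where "e = (\<lambda>(k::nat) (i::nat). if i = k then 1 else 0 :: real)"
  let ?S = "insert (\<lambda>_. 0) (e ` {..n})"
  have inj: "inj_on e {..n}" unfolding e_def inj_on_def by (metis zero_neq_one)
  have "(\<lambda>_. 0) \<noteq> e k" for k unfolding e_def by (metis zero_neq_one)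
  then have ze: "(\<lambda>_. 0) \<notin> e ` {..n}" by blast
  have sum: "(\<Sum>s\<in>?S. u s * g s) = u (\<lambda>_. 0) * g (\<lambda>_. 0) + (\<Sum>k\<le>n. u (e k) * g (e k))" for u g :: "(nat \<Rightarrow> real) \<Rightarrow> real"
    using ze inj by (simp add: sum.reindex)
  have coord: "(\<Sum>k\<le>n. a k * e k i) = (if i \<le> n then a i else 0)" for a i
    unfolding e_def by (auto simp: if_distrib[of "\<lambda>x. _ * x"] sum.delta cong: if_cong)
  have "simplex n = conv_hull ?S"
  proof (intro equalityI subsetI)
    fix z assume z: "z \<in> simplex n"
    define u where "u s = (if s = (\<lambda>_. 0) then 1 - (\<Sum>i\<le>n. z i) else z (inv_into {..n} e s))" for s
    have ue: "u (e k) = z k" if "k \<le> n" for k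
    proof -
      have "e k \<noteq> (\<lambda>_. 0)" using ze that by (metis atMost_iff image_eqI)
      then show ?thesis using that inj by (simp add: u_def)
    qed
    have "\<forall>s\<in>?S. 0 \<le> u s" using z ue by (auto simp: u_def simplex_def)
    moreover have "(\<Sum>s\<in>?S. u s) = 1"
      using sum[of u "\<lambda>_. 1"] ue by (simp add: u_def[of "\<lambda>_. 0"])
    moreover have "z = (\<lambda>i. \<Sum>s\<in>?S. u s * s i)"
    proof
      fix i
      have "(\<Sum>s\<in>?S. u s * s i) = (\<Sum>k\<le>n. z k * e k i)" using sum[of u "\<lambda>s. s i"] ue by simp
      then show "z i = (\<Sum>s\<in>?S. u s * s i)" using z by (simp add: coord simplex_def)
    qed
    ultimately show "z \<in> conv_hull ?S" unfolding conv_hull_def by blast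
  next
    fix z assume "z \<in> conv_hull ?S"
    then obtain u where u: "\<forall>s\<in>?S. 0 \<le> u s" "(\<Sum>s\<in>?S. u s) = 1" "z = (\<lambda>i. \<Sum>s\<in>?S. u s * s i)"
      unfolding conv_hull_def by blast
    have zi: "z i = (if i \<le> n then u (e i) else 0)" for i
      using sum[of u "\<lambda>s. s i"] coord[of "\<lambda>k. u (e k)"] by (simp add: u(3))
    have "u (\<lambda>_. 0) + (\<Sum>k\<le>n. u (e k)) = 1" using sum[of u "\<lambda>_. 1"] u(2) by simp
    then show "z \<in> simplex n" using u(1) by (auto simp: simplex_def zi)
  qed
  then show ?thesis by (simp add: e_def)
qed

lemma polyhedron_simplex: "polyhedron (simplex n)"
  unfolding simplex_conv_hull by (rule polyhedron_conv_hull[of _ "Suc n"]) (auto simp: Rd_def)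

lemma convex_simplex: "convex_set (simplex n)"
  unfolding simplex_conv_hull by (rule convex_conv_hull)

lemma width_aff: "width n d \<in> aff"
  unfolding width_def[abs_def] by (intro aff_sum) (auto intro: aff.coord)

lemma pos_aff: "pos n ws i \<in> aff"
  unfolding pos_def[abs_def] by (intro aff_sum width_aff) auto

lemma width_nonneg: "z \<in> simplex n \<Longrightarrow> 0 \<le> width n d z"
  unfolding width_def simplex_def by (auto intro: sum_nonneg)

lemma level_le: "level n z \<le> n"
  unfolding level_def by (rule Least_le) simp

lemma level_zero: "level n z \<le> i \<Longrightarrow> i < n \<Longrightarrow> z (Suc i) = 0"
proof -
  have "\<forall>i. level n z \<le> i \<longrightarrow> i < n \<longrightarrow> z (Suc i) = 0"
    unfolding level_def by (rule LeastI[of _ n]) simp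
  then show "level n z \<le> i \<Longrightarrow> i < n \<Longrightarrow> z (Suc i) = 0" by blast
qed

lemma level_least: "(\<And>i. j \<le> i \<Longrightarrow> i < n \<Longrightarrow> z (Suc i) = 0) \<Longrightarrow> level n z \<le> j"
  unfolding level_def by (rule Least_le) simp

text \<open>For positive \<open>d\<close> the width is the sum of the coordinates \<open>d\<close>
  to \<open>n\<close>, which are nonnegative on the simplex.\<close>

lemma width_zero:
  assumes z: "z \<in> simplex n" and d: "0 < d" shows "width n d z = 0 \<longleftrightarrow> level n z < d"
proof -
  have "width n d z = 0 \<longleftrightarrow> (\<forall>i\<in>{d - 1..<n}. z (Suc i) = 0)"
    unfolding width_def using z by (intro sum_nonneg_eq_0_iff) (auto simp: simplex_def)
  also have "\<dots> \<longleftrightarrow> level n z \<le> d - 1"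
  proof
    assume "\<forall>i\<in>{d - 1..<n}. z (Suc i) = 0"
    then show "level n z \<le> d - 1" by (intro level_least) simp
  next
    assume "level n z \<le> d - 1"
    then show "\<forall>i\<in>{d - 1..<n}. z (Suc i) = 0" using level_zero[of n z] by simp
  qed
  also have "\<dots> \<longleftrightarrow> level n z < d" using d by auto
  finally show ?thesis .
qed

lemma pos_split: "i \<le> k \<Longrightarrow> pos n ws k z = pos n ws i z + (\<Sum>m\<in>{i<..k}. width n (gap (ws ! m)) z)"
proof -
  assume ik: "i \<le> k"
  have "(\<Sum>m\<in>{..i} \<union> {i<..k}. width n (gap (ws ! m)) z) = pos n ws i z + (\<Sum>m\<in>{i<..k}. width n (gap (ws ! m)) z)"
    unfolding pos_def by (rule sum.union_disjoint) auto
  then show ?thesis by (simp only: pos_def ivl_disj_un_one(3)[OF ik])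
qed

text \<open>By \<open>connected\<close> all walls share one root, so every gap between walls is
  positive and \<open>width_zero\<close> applies to it; \<open>0 < n\<close> leaves room to the left
  of the first wall.\<close>

locale sawed_tree =
  fixes S :: "fm set" and n :: nat and ws :: "wall list"
  assumes S: "subcl S" and n: "0 < n" and forest: "forest S n ws"
    and connected: "\<And>i. 0 < i \<Longrightarrow> i < length ws \<Longrightarrow> 0 < gap (ws ! i)"
begin

lemma ne: "ws \<noteq> []" and gap0: "gap (ws ! 0) = 0"
  and ok: "\<And>i. i < length ws \<Longrightarrow> wall_ok S n (ws ! i)"
  and adj: "\<And>i. Suc i < length ws \<Longrightarrow> adjacent (ws ! i) (ws ! Suc i)"
  using forest unfolding forest_def by auto

lemma wit: "i < length ws \<Longrightarrow> j \<le> n \<Longrightarrow> Imp a b \<in> S \<Longrightarrow> Imp a b \<notin> col (ws ! i) j \<Longrightarrow> witnessed n ws i j a b"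
  using forest unfolding forest_def by blast

lemma pos_mono: "z \<in> simplex n \<Longrightarrow> i \<le> k \<Longrightarrow> pos n ws i z \<le> pos n ws k z"
  by (simp add: pos_split[of i k] sum_nonneg width_nonneg)

lemma col_mono:
  assumes "i < length ws" "j \<le> k" "k \<le> n" shows "col (ws ! i) j \<subseteq> col (ws ! i) k"
  using assms(2,3)
proof (induction k rule: dec_induct)
  case (step k)
  then show ?case using ok[OF assms(1)] unfolding wall_ok_def by (meson Suc_leD Suc_le_lessD order_trans)
qed simp

lemma col_block: "i \<le> k \<Longrightarrow> k < length ws \<Longrightarrow> block ws j i k \<Longrightarrow> col (ws ! k) j = col (ws ! i) j"
proof (induction k rule: dec_induct)
  case (step k)
  have "block ws j i k" using step.prems(2) step.hyps unfolding block_def by (auto simp: max_def min_def)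
  moreover have "j < gap (ws ! Suc k)" using step.prems(2) step.hyps unfolding block_def by (auto simp: max_def min_def)
  ultimately show ?case using step adj[of k] unfolding adjacent_def by simp
qed simp

lemma block_sym: "block ws j i k \<longleftrightarrow> block ws j k i"
  unfolding block_def by (simp add: min.commute max.commute)

text \<open>The distance of two walls is the sum of the widths between them, and a sum of
  nonnegative terms vanishes iff each term does.\<close>

lemma pos_eq:
  assumes z: "z \<in> simplex n" and ik: "i \<le> k" "k < length ws"
  shows "pos n ws i z = pos n ws k z \<longleftrightarrow> block ws (level n z) i k"
proof -
  have "pos n ws i z = pos n ws k z \<longleftrightarrow> (\<Sum>m\<in>{i<..k}. width n (gap (ws ! m)) z) = 0"
    using pos_split[OF ik(1), of n ws z] by auto
  also have "\<dots> \<longleftrightarrow> (\<forall>m\<in>{i<..k}. width n (gap (ws ! m)) z = 0)"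
    by (intro sum_nonneg_eq_0_iff) (auto simp: width_nonneg[OF z])
  also have "\<dots> \<longleftrightarrow> (\<forall>m\<in>{i<..k}. level n z < gap (ws ! m))"
  proof (rule ball_cong[OF refl])
    fix m assume "m \<in> {i<..k}"
    then have "0 < gap (ws ! m)" using connected[of m] ik by simp
    from width_zero[OF z this] show "width n (gap (ws ! m)) z = 0 \<longleftrightarrow> level n z < gap (ws ! m)" .
  qed
  also have "\<dots> \<longleftrightarrow> block ws (level n z) i k" using ik by (auto simp: block_def min_def max_def)
  finally show ?thesis .
qed

section \<open>Labelling the points of the simplex\<close>

definition on :: "(nat \<Rightarrow> real) \<Rightarrow> nat \<Rightarrow> bool" where
  "on z i \<longleftrightarrow> i < length ws \<and> z 0 = pos n ws i z"

definition passed :: "(nat \<Rightarrow> real) \<Rightarrow> nat" where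
  "passed z = card {i. i < length ws \<and> pos n ws i z < z 0}"

definition region :: "nat \<Rightarrow> fm set" where
  "region r = (if r = 0 then lft (ws ! 0) else rgt (ws ! (r - 1)))"

text \<open>If walls run through \<open>z\<close>, then \<open>passed z\<close> is the leftmost of
  them; otherwise it is the number of the region containing \<open>z\<close>, region
  \<open>r\<close> lying between walls \<open>r - 1\<close> and \<open>r\<close>.\<close>

definition lab :: "(nat \<Rightarrow> real) \<Rightarrow> fm set" where
  "lab z = (if \<exists>i. on z i then col (ws ! passed z) (level n z) else region (passed z))"

text \<open>The coordinates 1 to \<open>n\<close> determine the level and the differences the
  position relative to the walls, hence together the label.\<close>

definition forms :: "((nat \<Rightarrow> real) \<Rightarrow> real) set" where
  "forms = (\<lambda>i z. z (Suc i)) ` {..<n} \<union> (\<lambda>i z. z 0 - pos n ws i z) ` {..<length ws}"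

lemma forms_aff: "finite forms" "forms \<subseteq> aff"
  unfolding forms_def by (auto intro: aff.coord aff_diff pos_aff)

lemma passed_iff:
  assumes z: "z \<in> simplex n" and i: "i < length ws"
  shows "pos n ws i z < z 0 \<longleftrightarrow> i < passed z"
proof -
  let ?A = "{i. i < length ws \<and> pos n ws i z < z 0}"
  have fin: "finite ?A" by simp
  show ?thesis
  proof
    assume "pos n ws i z < z 0"
    then have "{..i} \<subseteq> ?A" using pos_mono[OF z] i by (auto intro: le_less_trans)
    then have "card {..i} \<le> card ?A" by (intro card_mono fin)
    then show "i < passed z" by (simp add: passed_def)
  next
    assume p: "i < passed z"
    show "pos n ws i z < z 0"
    proof (rule ccontr)
      assume "\<not> ?thesis"
      then have "\<not> i \<le> k" if "k \<in> ?A" for k using pos_mono[OF z, of i k] that by auto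
      then have "?A \<subseteq> {..<i}" by (auto simp: not_le)
      then have "card ?A \<le> card {..<i}" by (intro card_mono) auto
      then show False using p by (simp add: passed_def)
    qed
  qed
qed

lemma passed_le: "passed z \<le> length ws"
  unfolding passed_def using card_mono[of "{..<length ws}" "{i. i < length ws \<and> pos n ws i z < z 0}"] by auto

lemma on_passed:
  assumes z: "z \<in> simplex n" and i: "on z i" shows "on z (passed z)" "passed z \<le> i"
proof -
  have l: "i < length ws" "z 0 = pos n ws i z" using i by (auto simp: on_def)
  show p: "passed z \<le> i" using passed_iff[OF z l(1)] l(2) by simp
  have "\<not> pos n ws (passed z) z < z 0" using passed_iff[OF z, of "passed z"] p l by simp
  moreover have "pos n ws (passed z) z \<le> z 0" using pos_mono[OF z p] l by simp
  ultimately show "on z (passed z)" using p l by (simp add: on_def)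
qed

lemma on_block:
  assumes z: "z \<in> simplex n" and i: "on z i" and k: "k < length ws"
  shows "on z k \<longleftrightarrow> block ws (level n z) i k"
proof (cases "i \<le> k")
  case True
  then show ?thesis using pos_eq[OF z True k] i k by (auto simp: on_def)
next
  case False
  then have "k \<le> i" by simp
  then show ?thesis using pos_eq[OF z, of k i] i k block_sym by (auto simp: on_def)
qed

text \<open>The walls through \<open>z\<close> form one block at the level of \<open>z\<close>, so
  their columns agree there and any of them may be used.\<close>

lemma lab_on:
  assumes z: "z \<in> simplex n" and i: "on z i" shows "lab z = col (ws ! i) (level n z)"
proof -
  note p = on_passed[OF z i]
  have l: "i < length ws" using i by (simp add: on_def)
  have "block ws (level n z) (passed z) i" using on_block[OF z p(1) l] i by simp
  from col_block[OF p(2) l this] show ?thesis using i by (auto simp: lab_def)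
qed

lemma lab_region:
  assumes r: "r \<le> length ws" "\<And>k. k < r \<Longrightarrow> pos n ws k z < z 0" "\<And>k. r \<le> k \<Longrightarrow> k < length ws \<Longrightarrow> z 0 < pos n ws k z"
  shows "lab z = region r"
proof -
  have "{i. i < length ws \<and> pos n ws i z < z 0} = {..<r}"
    using r by (auto simp: not_less[symmetric]) (meson less_asym not_less)
  then have "passed z = r" by (simp add: passed_def)
  moreover have "\<not> on z i" for i using r(2,3)[of i] by (cases "i < r") (auto simp: on_def)
  ultimately show ?thesis by (simp add: lab_def)
qed

lemma region_lft: "r < length ws \<Longrightarrow> region r = lft (ws ! r)"
  using adj[of "r - 1"] by (cases r) (auto simp: region_def adjacent_def)

lemma region_mtyp: "r \<le> length ws \<Longrightarrow> mtyp S (region r)"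
  using ok[of 0] ok[of "r - 1"] ne by (cases r) (auto simp: region_def wall_ok_def)

lemma lab_ptyp: "z \<in> simplex n \<Longrightarrow> ptyp S (lab z)"
proof (cases "\<exists>i. on z i")
  case True
  assume z: "z \<in> simplex n"
  obtain i where i: "on z i" using True by blast
  then show ?thesis using ok[of i] level_le[of n z] unfolding lab_on[OF z i] by (auto simp: on_def wall_ok_def)
next
  case False
  then show ?thesis using mtyp_typ[OF region_mtyp[OF passed_le]] by (simp add: lab_def)
qed

lemma col_region:
  assumes i: "i < length ws" and j: "j \<le> n"
  shows "col (ws ! i) j \<subseteq> region i" "col (ws ! i) j \<subseteq> region (Suc i)"
  using col_mono[OF i j order_refl] ok[OF i] region_lft[OF i] unfolding wall_ok_def
  by (auto simp: region_def[of "Suc i"])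

lemma spec_forms:
  assumes "spec forms z z'"
  shows "i < n \<Longrightarrow> z (Suc i) \<noteq> 0 \<Longrightarrow> sgn (z' (Suc i)) = sgn (z (Suc i))"
    "i < length ws \<Longrightarrow> z 0 < pos n ws i z \<Longrightarrow> z' 0 < pos n ws i z'"
    "i < length ws \<Longrightarrow> pos n ws i z < z 0 \<Longrightarrow> pos n ws i z' < z' 0"
proof -
  show "i < n \<Longrightarrow> z (Suc i) \<noteq> 0 \<Longrightarrow> sgn (z' (Suc i)) = sgn (z (Suc i))"
    using bspec[OF assms[unfolded spec_def], of "\<lambda>z. z (Suc i)"] by (auto simp: forms_def)
  have w: "sgn (z' 0 - pos n ws i z') = sgn (z 0 - pos n ws i z)" if "i < length ws" "z 0 - pos n ws i z \<noteq> 0"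
    using bspec[OF assms[unfolded spec_def], of "\<lambda>z. z 0 - pos n ws i z"] that by (auto simp: forms_def)
  show "i < length ws \<Longrightarrow> z 0 < pos n ws i z \<Longrightarrow> z' 0 < pos n ws i z'"
    using w by (auto simp: sgn_if split: if_splits)
  show "i < length ws \<Longrightarrow> pos n ws i z < z 0 \<Longrightarrow> pos n ws i z' < z' 0"
    using w by (auto simp: sgn_if split: if_splits)
qed

lemma level_spec: "spec forms z z' \<Longrightarrow> level n z \<le> level n z'"
proof (rule level_least)
  fix i assume s: "spec forms z z'" and i: "level n z' \<le> i" "i < n"
  then have "z' (Suc i) = 0" by (intro level_zero)
  then show "z (Suc i) = 0" using spec_forms(1)[OF s i(2)] by (metis sgn_eq_0_iff)
qed

text \<open>Strict inequalities persist upwards: walls through \<open>z'\<close> already run through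
  \<open>z\<close>, and the level does not drop. So the label climbs a column, passes from a column
  to a region bordering a wall through \<open>z\<close>, or stays.\<close>

lemma lab_mono:
  assumes z: "z \<in> simplex n" "z' \<in> simplex n" and s: "spec forms z z'"
  shows "lab z \<subseteq> lab z'"
proof (cases "\<exists>i. on z' i")
  case True
  then obtain i where i: "on z' i" by blast
  then have l: "i < length ws" by (simp add: on_def)
  have "on z i" using i spec_forms(2,3)[OF s l] unfolding on_def by (metis linorder_neqE_linordered_idom less_irrefl)
  then show ?thesis
    unfolding lab_on[OF z(2) i] lab_on[OF z(1) \<open>on z i\<close>] by (intro col_mono l level_spec[OF s] level_le)
next
  case n': False
  let ?r = "passed z" and ?r' = "passed z'"
  have rr: "?r \<le> ?r'"
  proof (rule ccontr)
    assume "\<not> ?thesis"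
    then have l: "?r' < ?r" "?r' < length ws" using passed_le[of z] by auto
    have "pos n ws ?r' z' < z' 0" using spec_forms(3)[OF s l(2)] passed_iff[OF z(1) l(2)] l(1) by blast
    then show False using passed_iff[OF z(2) l(2)] by simp
  qed
  have lab': "lab z' = region ?r'" using n' by (simp add: lab_def)
  \<comment> \<open>If the last wall passed by \<open>z'\<close> lay strictly to the right of
    \<open>z\<close>, it would lie strictly to the right of \<open>z'\<close> too. As
    \<open>z\<close> has not passed it either, it runs through \<open>z\<close>.\<close>
  have notabove: "\<not> z 0 < pos n ws (?r' - 1) z" if "?r < ?r'"
  proof
    assume a: "z 0 < pos n ws (?r' - 1) z"
    have l: "?r' - 1 < length ws" "?r' - 1 < ?r'" using that passed_le[of z'] by auto
    then have "z' 0 < pos n ws (?r' - 1) z'" using spec_forms(2)[OF s l(1) a] by simp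
    moreover have "pos n ws (?r' - 1) z' < z' 0" using passed_iff[OF z(2) l(1)] l(2) by simp
    ultimately show False by simp
  qed
  show ?thesis
  proof (cases "\<exists>i. on z i")
    case True
    then obtain i where "on z i" by blast
    note p = on_passed(1)[OF z(1) this]
    then have lr: "?r < length ws" by (simp add: on_def)
    show ?thesis
    proof (cases "?r = ?r'")
      case True
      then show ?thesis using col_region(1)[OF lr level_le] lab' lab_on[OF z(1) p] by simp
    next
      case False
      then have r': "?r < ?r'" using rr by simp
      then have l: "?r' - 1 < length ws" "?r \<le> ?r' - 1" using passed_le[of z'] by auto
      have "\<not> pos n ws (?r' - 1) z < z 0" using passed_iff[OF z(1) l(1)] l(2) by simp
      then have "on z (?r' - 1)" using notabove[OF r'] l(1) by (simp add: on_def)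
      then show ?thesis using col_region(2)[OF l(1) level_le] lab' lab_on[OF z(1)] r' by simp
    qed
  next
    case False
    have "?r = ?r'"
    proof (rule ccontr)
      assume "?r \<noteq> ?r'"
      then have r': "?r < ?r'" using rr by simp
      then have l: "?r' - 1 < length ws" "?r \<le> ?r' - 1" using passed_le[of z'] by auto
      have "\<not> pos n ws (?r' - 1) z < z 0" using passed_iff[OF z(1) l(1)] l(2) by simp
      then have "on z (?r' - 1)" using notabove[OF r'] l(1) by (simp add: on_def)
      then show False using False by blast
    qed
    then show ?thesis using False lab' by (simp add: lab_def)
  qed
qed

text \<open>Chosen so that probes fit into the simplex: coordinate 0 takes at most
  \<open>length ws * n\<close> units for the position of the wall and one for the displacement, the
  other \<open>n\<close> coordinates at most one unit each.\<close>

definition unit :: real where "unit = 1 / real (length ws * n + n + 1)"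

text \<open>A point of level \<open>j\<close> at distance \<delta> units from wall \<open>i\<close>;
  coordinate 0 can be set last because \<open>pos\<close> does not depend on it. Walls not meeting
  at this level are at least a unit apart, so for \<open>j = n\<close> the displacements 1/2 and
  -1/2 land in the two neighbouring regions.\<close>

definition probe :: "nat \<Rightarrow> nat \<Rightarrow> real \<Rightarrow> nat \<Rightarrow> real" where
  "probe j i \<delta> = (let y = (\<lambda>m. if 1 \<le> m \<and> m \<le> j then unit else 0) in y(0 := pos n ws i y + \<delta> * unit))"

lemma unit_pos: "0 < unit"
  unfolding unit_def zero_less_divide_1_iff of_nat_0_less_iff by simp

lemma width_upd: "width n d (z(0 := c)) = width n d z"
  unfolding width_def by simp

lemma pos_upd: "pos n ws i (z(0 := c)) = pos n ws i z"
  unfolding pos_def width_upd by simp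

lemma probe_0: "probe j i \<delta> 0 = pos n ws i (probe j i \<delta>) + \<delta> * unit"
  unfolding probe_def Let_def pos_upd by simp

lemma probe_Suc: "probe j i \<delta> (Suc m) = (if m < j then unit else 0)"
  unfolding probe_def Let_def by auto

lemma width_probe:
  assumes "j \<le> n"
  shows "0 \<le> width n d (probe j i \<delta>)" "width n d (probe j i \<delta>) \<le> real n * unit"
    "d - 1 < j \<Longrightarrow> unit \<le> width n d (probe j i \<delta>)"
proof -
  have nn: "0 \<le> probe j i \<delta> (Suc m)" "probe j i \<delta> (Suc m) \<le> unit" for m
    using unit_pos by (simp_all add: probe_Suc)
  show "0 \<le> width n d (probe j i \<delta>)" unfolding width_def using nn by (intro sum_nonneg) auto
  have "width n d (probe j i \<delta>) \<le> (\<Sum>m\<in>{d - 1..<n}. unit)" unfolding width_def using nn by (intro sum_mono) auto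
  also have "\<dots> \<le> real n * unit" using unit_pos by (simp add: mult_right_mono)
  finally show "width n d (probe j i \<delta>) \<le> real n * unit" .
  assume d: "d - 1 < j"
  then have "unit = probe j i \<delta> (Suc (d - 1))" by (simp add: probe_Suc)
  also have "\<dots> \<le> width n d (probe j i \<delta>)" unfolding width_def
    using d assms nn by (intro member_le_sum) auto
  finally show "unit \<le> width n d (probe j i \<delta>)" .
qed

lemma pos_probe:
  assumes j: "j \<le> n" and i: "i < length ws"
  shows "0 \<le> pos n ws i (probe j k \<delta>)" "pos n ws i (probe j k \<delta>) \<le> real (length ws * n) * unit"
    "0 < j \<Longrightarrow> unit \<le> pos n ws i (probe j k \<delta>)"
proof -
  show "0 \<le> pos n ws i (probe j k \<delta>)" unfolding pos_def using width_probe(1)[OF j] by (intro sum_nonneg) auto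
  have "pos n ws i (probe j k \<delta>) \<le> (\<Sum>m\<le>i. real n * unit)" unfolding pos_def using width_probe(2)[OF j] by (intro sum_mono) auto
  also have "\<dots> = real (Suc i * n) * unit" by (simp add: algebra_simps)
  also have "\<dots> \<le> real (length ws * n) * unit"
    using i unit_pos by (intro mult_right_mono of_nat_mono mult_le_mono1) auto
  finally show "pos n ws i (probe j k \<delta>) \<le> real (length ws * n) * unit" .
  assume "0 < j"
  then have "unit \<le> width n (gap (ws ! 0)) (probe j k \<delta>)" using width_probe(3)[OF j, of "gap (ws ! 0)"] gap0 by simp
  also have "\<dots> \<le> pos n ws i (probe j k \<delta>)" unfolding pos_def
    using width_probe(1)[OF j] by (intro member_le_sum) auto
  finally show "unit \<le> pos n ws i (probe j k \<delta>)" .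
qed

lemma probe_simplex:
  assumes j: "j \<le> n" and i: "i < length ws" and \<delta>: "\<bar>\<delta>\<bar> \<le> 1" "0 < j \<or> 0 \<le> \<delta>"
  shows "probe j i \<delta> \<in> simplex n"
proof -
  let ?z = "probe j i \<delta>"
  have "- unit \<le> \<delta> * unit" "\<delta> * unit \<le> unit"
    using mult_right_mono[of "-1" \<delta> unit] mult_right_mono[of \<delta> 1 unit] \<delta>(1) unit_pos by simp_all
  moreover have "0 \<le> \<delta> \<Longrightarrow> 0 \<le> \<delta> * unit" using unit_pos by simp
  ultimately have z0: "0 \<le> ?z 0" "?z 0 \<le> real (length ws * n) * unit + unit"
    unfolding probe_0 using pos_probe[OF j i, of i \<delta>] \<delta>(2) by auto
  have "0 \<le> ?z m" for m using z0(1) unit_pos by (cases m) (simp_all add: probe_Suc)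
  moreover have "?z m = 0" if "n < m" for m using that j by (cases m) (simp_all add: probe_Suc)
  moreover have "(\<Sum>m\<le>n. ?z m) \<le> 1"
  proof -
    have "(\<Sum>m\<le>n. ?z m) = ?z 0 + (\<Sum>m<n. ?z (Suc m))"
      by (simp add: sum.atMost_shift)
    also have "(\<Sum>m<n. ?z (Suc m)) \<le> (\<Sum>m<n. unit)" using unit_pos by (intro sum_mono) (simp add: probe_Suc)
    finally have "(\<Sum>m\<le>n. ?z m) \<le> real (length ws * n + n + 1) * unit"
      using z0(2) by (simp add: algebra_simps)
    also have "\<dots> = 1" unfolding unit_def by (simp del: of_nat_add of_nat_mult of_nat_Suc)
    finally show ?thesis .
  qed
  ultimately show ?thesis unfolding simplex_def by simp
qed

lemma level_probe: "j \<le> n \<Longrightarrow> level n (probe j i \<delta>) = j"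
proof (rule antisym)
  assume j: "j \<le> n"
  show "level n (probe j i \<delta>) \<le> j" by (rule level_least) (simp add: probe_Suc)
  show "j \<le> level n (probe j i \<delta>)"
  proof (rule ccontr)
    assume l: "\<not> ?thesis"
    then have "probe j i \<delta> (Suc (level n (probe j i \<delta>))) = 0" using j by (intro level_zero) auto
    then show False using l unit_pos by (simp add: probe_Suc)
  qed
qed

text \<open>The width of a gap \<open>d\<close> with \<open>0 < d \<le> j\<close> has coordinate
  \<open>d\<close> among its summands, and this equals \<open>unit\<close> at the probe.\<close>

lemma pos_probe_gap:
  assumes j: "j \<le> n" and k: "k < k'" "k' < length ws" and m: "k < m" "m \<le> k'" "gap (ws ! m) \<le> j"
  shows "pos n ws k (probe j i \<delta>) + unit \<le> pos n ws k' (probe j i \<delta>)"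
proof -
  have "0 < gap (ws ! m)" using connected[of m] k m by simp
  then have "unit \<le> width n (gap (ws ! m)) (probe j i \<delta>)" using width_probe(3)[OF j, of "gap (ws ! m)"] m(3) by simp
  also have "\<dots> \<le> (\<Sum>m\<in>{k<..k'}. width n (gap (ws ! m)) (probe j i \<delta>))"
    using m width_probe(1)[OF j] by (intro member_le_sum) auto
  finally show ?thesis using pos_split[of k k' n ws "probe j i \<delta>"] k(1) by simp
qed

text \<open>Nonzero coordinates of \<open>z\<close> have index at most its level and stay positive
  at the probe. A wall avoiding \<open>z\<close> is separated from wall \<open>i\<close> by a gap of
  at most that level, so at the probe it is still a unit away on the same side, farther than the
  displacement.\<close>

lemma spec_probe:
  assumes z: "z \<in> simplex n" and i: "on z i" and j: "level n z \<le> j" "j \<le> n" and \<delta>: "\<bar>\<delta>\<bar> < 1"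
  shows "spec forms z (probe j i \<delta>)"
proof -
  let ?z = "probe j i \<delta>"
  have il: "i < length ws" "z 0 = pos n ws i z" using i by (auto simp: on_def)
  have du: "- unit < \<delta> * unit" "\<delta> * unit < unit"
    using mult_strict_right_mono[of "-1" \<delta> unit] mult_strict_right_mono[of \<delta> 1 unit] \<delta> unit_pos by auto
  have 1: "sgn (?z (Suc m)) = sgn (z (Suc m))" if "m < n" "z (Suc m) \<noteq> 0" for m
  proof -
    have "m < level n z" using level_zero[of n z m] that by (meson not_le)
    then have "0 < ?z (Suc m)" using j unit_pos by (simp add: probe_Suc)
    moreover have "0 \<le> z (Suc m)" using z by (simp add: simplex_def)
    ultimately show ?thesis using that(2) by simp
  qed
  have 2: "sgn (?z 0 - pos n ws k ?z) = sgn (z 0 - pos n ws k z)" if k: "k < length ws" "z 0 \<noteq> pos n ws k z" for k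
  proof -
    have "\<not> on z k" using k by (simp add: on_def)
    then have nb: "\<not> block ws (level n z) i k" using on_block[OF z i k(1)] by simp
    have "i \<noteq> k" using k il by auto
    then consider "k < i" | "i < k" by linarith
    then show ?thesis
    proof cases
      case 1
      obtain m where m: "k < m" "m \<le> i" "gap (ws ! m) \<le> level n z"
        using nb 1 unfolding block_def by (auto simp: min_def max_def not_less)
      have "pos n ws k ?z + unit \<le> pos n ws i ?z" using pos_probe_gap[OF j(2) 1 il(1) m(1,2)] m(3) j(1) by simp
      then have "0 < ?z 0 - pos n ws k ?z" unfolding probe_0[of j i \<delta>] using du by simp
      moreover have "0 < z 0 - pos n ws k z" using pos_mono[OF z, of k i] 1 k il by simp
      ultimately show ?thesis by simp
    next
      case 2
      obtain m where m: "i < m" "m \<le> k" "gap (ws ! m) \<le> level n z"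
        using nb 2 unfolding block_def by (auto simp: min_def max_def not_less)
      have "pos n ws i ?z + unit \<le> pos n ws k ?z" using pos_probe_gap[OF j(2) 2 k(1) m(1,2)] m(3) j(1) by simp
      then have "?z 0 - pos n ws k ?z < 0" unfolding probe_0[of j i \<delta>] using du by simp
      moreover have "z 0 - pos n ws k z < 0" using pos_mono[OF z, of i k] 2 k il by simp
      ultimately show ?thesis by simp
    qed
  qed
  show ?thesis using 1 2 unfolding spec_def forms_def by auto
qed

lemma probe_strict: "k < k' \<Longrightarrow> k' < length ws \<Longrightarrow> pos n ws k (probe n i \<delta>) + unit \<le> pos n ws k' (probe n i \<delta>)"
  using pos_probe_gap[of n k k' k'] ok[of k'] by (simp add: wall_ok_def)

lemma lab_probe:
  assumes i: "i < length ws"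
  shows "j \<le> n \<Longrightarrow> lab (probe j i 0) = col (ws ! i) j"
    "lab (probe n i (- 1 / 2)) = lft (ws ! i)" "lab (probe n i (1 / 2)) = rgt (ws ! i)"
proof -
  show "lab (probe j i 0) = col (ws ! i) j" if "j \<le> n"
  proof -
    have "on (probe j i 0) i" using i probe_0[of j i 0] by (simp add: on_def)
    from lab_on[OF probe_simplex[OF that i] this] show ?thesis by (simp add: level_probe[OF that])
  qed
  have "lab (probe n i (- 1 / 2)) = region i"
  proof (rule lab_region)
    fix k
    show "pos n ws k (probe n i (- 1 / 2)) < probe n i (- 1 / 2) 0" if "k < i"
      using probe_strict[OF that i, of i "- 1 / 2"] unit_pos probe_0[of n i "- 1 / 2"] by simp
    show "probe n i (- 1 / 2) 0 < pos n ws k (probe n i (- 1 / 2))" if "i \<le> k" "k < length ws"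
      using probe_strict[of i k i "- 1 / 2"] that unit_pos probe_0[of n i "- 1 / 2"] by (cases "i = k") auto
  qed (use i in simp)
  then show "lab (probe n i (- 1 / 2)) = lft (ws ! i)" using region_lft[OF i] by simp
  have "lab (probe n i (1 / 2)) = region (Suc i)"
  proof (rule lab_region)
    fix k
    show "pos n ws k (probe n i (1 / 2)) < probe n i (1 / 2) 0" if "k < Suc i"
      using probe_strict[of k i i "1 / 2"] that i unit_pos probe_0[of n i "1 / 2"] by (cases "i = k") auto
    show "probe n i (1 / 2) 0 < pos n ws k (probe n i (1 / 2))" if "Suc i \<le> k" "k < length ws"
      using probe_strict[of i k i "1 / 2"] that unit_pos probe_0[of n i "1 / 2"] by auto
  qed (use i in simp)
  then show "lab (probe n i (1 / 2)) = rgt (ws ! i)" by (simp add: region_def)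
qed

text \<open>Combinatorial witnesses become points: probes on the witnessing wall or half a unit
  beside it. Off the walls the label is a maximal type and refutes by itself.\<close>

lemma lab_refutes:
  assumes z: "z \<in> simplex n" and ab: "Imp a b \<in> S" "Imp a b \<notin> lab z"
  shows "\<exists>z'\<in>simplex n. spec forms z z' \<and> refutes (lab z') a b"
proof (cases "\<exists>i. on z i")
  case True
  then obtain i where i: "on z i" by blast
  then have il: "i < length ws" by (simp add: on_def)
  have "witnessed n ws i (level n z) a b" using wit[OF il level_le ab(1)] ab(2) lab_on[OF z i] by simp
  then obtain i' where i': "i' < length ws" "block ws (level n z) i i'"
    "refutes (lft (ws ! i')) a b \<or> refutes (rgt (ws ! i')) a b \<or>
      (\<exists>j'. level n z \<le> j' \<and> j' \<le> n \<and> refutes (col (ws ! i') j') a b)" unfolding witnessed_def by blast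
  have oi: "on z i'" using on_block[OF z i i'(1)] i'(2) by simp
  show ?thesis using i'(3)
  proof (elim disjE exE conjE)
    assume "refutes (lft (ws ! i')) a b"
    then show ?thesis using spec_probe[OF z oi level_le order_refl, of "- 1 / 2"] lab_probe(2)[OF i'(1)]
        probe_simplex[OF order_refl i'(1), of "- 1 / 2"] n
      by (intro bexI[of _ "probe n i' (- 1 / 2)"]) auto
  next
    assume "refutes (rgt (ws ! i')) a b"
    then show ?thesis using spec_probe[OF z oi level_le order_refl, of "1 / 2"] lab_probe(3)[OF i'(1)]
        probe_simplex[OF order_refl i'(1), of "1 / 2"] n
      by (intro bexI[of _ "probe n i' (1 / 2)"]) auto
  next
    fix j assume j: "level n z \<le> j" "j \<le> n" "refutes (col (ws ! i') j) a b"
    then show ?thesis using spec_probe[OF z oi j(1,2), of 0] lab_probe(1)[OF i'(1) j(2)]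
        probe_simplex[OF j(2) i'(1), of 0]
      by (intro bexI[of _ "probe j i' 0"]) auto
  qed
next
  case False
  then have "lab z = region (passed z)" by (simp add: lab_def)
  then have "refutes (lab z) a b" using mtyp_refutes[OF S region_mtyp[OF passed_le] ab(1)] ab(2) by simp
  then show ?thesis using z spec_refl by blast
qed

section \<open>Truth lemma and countermodel\<close>

definition val :: "nat \<Rightarrow> (nat \<Rightarrow> real) set" where
  "val m = {z \<in> simplex n. Var m \<in> lab z}"

lemma val_up: "up_in (simplex n) (spec forms) (val m)"
  unfolding up_in_def val_def using lab_mono by blast

lemma truth: "\<phi> \<in> S \<Longrightarrow> z \<in> force (simplex n) (spec forms) val \<phi> \<longleftrightarrow> z \<in> simplex n \<and> \<phi> \<in> lab z"
proof (induction \<phi> arbitrary: z)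
  case (Var m)
  show ?case by (simp add: val_def)
next
  case Bot
  have "Bot \<notin> lab z" if z: "z \<in> simplex n"
    using lab_ptyp[OF z] prime_thyD(2) unfolding ptyp_def by blast
  then show ?case by auto
next
  case (Conj a b)
  have ab: "a \<in> S" "b \<in> S" using S Conj.prems unfolding subcl_def by blast+
  have "Conj a b \<in> lab z \<longleftrightarrow> a \<in> lab z \<and> b \<in> lab z" if z: "z \<in> simplex n"
    using lab_ptyp[OF z] ab Conj.prems mem_Conj unfolding ptyp_def by blast
  then show ?case using Conj.IH(1)[OF ab(1)] Conj.IH(2)[OF ab(2)] by auto
next
  case (Disj a b)
  have ab: "a \<in> S" "b \<in> S" using S Disj.prems unfolding subcl_def by blast+
  have "Disj a b \<in> lab z \<longleftrightarrow> a \<in> lab z \<or> b \<in> lab z" if z: "z \<in> simplex n"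
    using lab_ptyp[OF z] ab Disj.prems mem_Disj unfolding ptyp_def by blast
  then show ?case using Disj.IH(1)[OF ab(1)] Disj.IH(2)[OF ab(2)] by auto
next
  case (Imp a b)
  have ab: "a \<in> S" "b \<in> S" using S Imp.prems unfolding subcl_def by blast+
  note IH = Imp.IH(1)[OF ab(1)] Imp.IH(2)[OF ab(2)]
  have mp: "b \<in> lab z'" if z': "z' \<in> simplex n" "Imp a b \<in> lab z'" "a \<in> lab z'" for z'
  proof -
    obtain T where "prime_thy T" "lab z' = T \<inter> S" using lab_ptyp[OF z'(1)] unfolding ptyp_def by blast
    then show ?thesis using thy_mp[OF prime_thyD(1), of T a b] z' ab by blast
  qed
  show ?case
  proof
    assume f: "z \<in> force (simplex n) (spec forms) val (Imp a b)"
    then have z: "z \<in> simplex n" by simp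
    have "Imp a b \<in> lab z"
    proof (rule ccontr)
      assume "Imp a b \<notin> lab z"
      then obtain z' where z': "z' \<in> simplex n" "spec forms z z'" "refutes (lab z') a b"
        using lab_refutes[OF z Imp.prems] by blast
      have "z' \<in> force (simplex n) (spec forms) val a" using IH(1) z' by (simp add: refutes_def)
      then have "z' \<in> force (simplex n) (spec forms) val b" using f z' by simp
      then show False using IH(2) z'(3) by (simp add: refutes_def)
    qed
    then show "z \<in> simplex n \<and> Imp a b \<in> lab z" using z by simp
  next
    assume z: "z \<in> simplex n \<and> Imp a b \<in> lab z"
    have "z' \<in> force (simplex n) (spec forms) val b"
      if z': "z' \<in> simplex n" "spec forms z z'" "z' \<in> force (simplex n) (spec forms) val a" for z'
    proof -
      have "Imp a b \<in> lab z'" using lab_mono[OF _ z'(1,2)] z by blast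
      moreover have "a \<in> lab z'" using IH(1) z'(3) by simp
      ultimately show ?thesis using IH(2) mp[OF z'(1)] z'(1) by simp
    qed
    then show "z \<in> force (simplex n) (spec forms) val (Imp a b)" using z by simp
  qed
qed

lemma not_in_Logic:
  assumes \<phi>: "\<phi> \<in> S" "\<phi> \<notin> col (ws ! 0) 0" shows "\<phi> \<notin> Logic Convex"
proof
  assume "\<phi> \<in> Logic Convex"
  moreover have "simplex n \<in> Convex" unfolding Convex_def using polyhedron_simplex convex_simplex by simp
  moreover have "val m \<in> Sub_o (simplex n)" for m by (rule up_in_Sub_o[OF polyhedron_simplex forms_aff val_up])
  ultimately have "eval (simplex n) val \<phi> = simplex n" unfolding Logic_def valid_on_def by blast
  then have f: "force (simplex n) (spec forms) val \<phi> = simplex n"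
    using eval_eq_force[OF polyhedron_simplex convex_simplex forms_aff val_up] by simp
  \<comment> \<open>The probe of level 0 is the origin, where all walls meet; its label is that of
    the root.\<close>
  have "0 < length ws" using ne by simp
  then have z: "probe 0 0 0 \<in> simplex n" "lab (probe 0 0 0) = col (ws ! 0) 0"
    using probe_simplex[of 0 0 0] lab_probe(1)[of 0 0] by simp_all
  then have "\<phi> \<in> lab (probe 0 0 0)" using truth[OF \<phi>(1)] f by blast
  then show False using z(2) \<phi>(2) by simp
qed

end

section \<open>Completeness\<close>

primrec subformulas :: "fm \<Rightarrow> fm set" where
  "subformulas (Var n) = {Var n}"
| "subformulas Bot = {Bot}"
| "subformulas (Conj a b) = insert (Conj a b) (subformulas a \<union> subformulas b)"
| "subformulas (Disj a b) = insert (Disj a b) (subformulas a \<union> subformulas b)"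
| "subformulas (Imp a b) = insert (Imp a b) (subformulas a \<union> subformulas b)"

lemma subformulas_self: "\<phi> \<in> subformulas \<phi>"
  by (cases \<phi>) auto

lemma subcl_subformulas: "subcl (subformulas \<phi>)"
proof -
  have "Imp a b \<in> subformulas \<phi> \<or> Conj a b \<in> subformulas \<phi> \<or> Disj a b \<in> subformulas \<phi>
      \<Longrightarrow> a \<in> subformulas \<phi> \<and> b \<in> subformulas \<phi>" for a b
    by (induction \<phi>) (auto simp: subformulas_self)
  then show ?thesis unfolding subcl_def by blast
qed

lemma finite_subformulas: "finite (subformulas \<phi>)"
  by (induction \<phi>) auto

lemma PL_complete:
  assumes \<phi>: "\<phi> \<notin> PL" shows "\<phi> \<notin> Logic Convex"
proof -
  let ?S = "subformulas \<phi>"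
  obtain X where X: "prime_thy X" "\<phi> \<notin> X" by (rule thy_maximal_avoiding[OF thy_PL \<phi>])
  obtain a where a: "a \<in> mtypes ?S X" using mtypes_nonempty[OF X(1)] by blast
  \<comment> \<open>Any bound on the cardinality serves as depth; the successor makes the positivity
    demanded by \<open>sawed_tree\<close> immediate.\<close>
  let ?n = "Suc (card (?S - X))"
  have "card (?S - X) \<le> ?n" by simp
  from tree_exists[OF finite_subformulas subcl_subformulas X(1) this a a] obtain ws where
    ws: "path ?S ?n (X \<inter> ?S) a a ws" "\<forall>w\<in>set ws. col w 0 = X \<inter> ?S"
      "\<forall>i. 0 < i \<longrightarrow> i < length ws \<longrightarrow> 0 < gap (ws ! i)" by (elim exE conjE)
  then have f: "forest ?S ?n ws" by (simp add: path_def)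
  then interpret sawed_tree ?S ?n ws by unfold_locales (use subcl_subformulas ws(3) in auto)
  have "ws ! 0 \<in> set ws" using ne by (intro nth_mem) simp
  then have "\<phi> \<notin> col (ws ! 0) 0" using ws(2) X(2) by simp
  then show ?thesis by (rule not_in_Logic[OF subformulas_self])
qed

theorem theorem5p1:
  shows "PL = Logic Convex"
proof
  show "PL \<subseteq> Logic Convex"
  proof
    fix \<phi> assume \<phi>: "\<phi> \<in> PL"
    have "eval P v \<phi> = P" if "polyhedron P" "convex_set P" "\<forall>m. v m \<in> Sub_o P" for P v
      by (rule PL_sound[OF that(1,2) _ \<phi>]) (use that(3) in simp)
    then show "\<phi> \<in> Logic Convex" unfolding Logic_def Convex_def valid_on_def by simp
  qed
  show "Logic Convex \<subseteq> PL"
    using PL_complete by blast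
qed

end
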